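(* If $\mathbf{T}$ is a quasiconformal tree and $\alpha>1$, then $\mathbf{T}$ is quasisymmetrically equivalent to a geodesic tree $T$ with $\dim_H T\le \alpha$, where $\dim_H$ denotes Hausdorff dimension.
   Context: A (metric) tree is a compact, connected, and locally connected metric space that contains at least two distinct points and has the property that for any two points $x,y$ there exists a unique arc $[x,y]$ in the space with endpoints $x$ and $y$ (for $x=y$ one sets $[x,y]=\{x\}$, a degenerate arc). A metric space is doubling if there is a constant $N\in\mathbb{N}$ such that each ball of radius $R>0$ can be covered by at most $N$ balls of radius $R/2$. A metric space $(X,d)$ is of bounded turning if there is a constant $K\ge 1$ such that for all $x,y\in X$ there exists a compact connected set $E\subset X$ with $x,y\in E$ and $\operatorname{diam}(E)\le K d(x,y)$. A quasiconformal tree is a metric tree that is doubling and of bounded turning. A metric space is geodesic if any two points $x,y$ can be joined by an arc with endpoints $x,y$ whose length equals the distance of $x$ and $y$. A geodesic tree is a metric tree that is geodesic as a metric space. A homeomorphism $f\colon (X,d_X)\to(Y,d_Y)$ is a quasisymmetry if there is a homeomorphism $\eta\colon[0,\infty)\to[0,\infty)$ with $\frac{d_Y(f(x),f(y))}{d_Y(f(x),f(z))}\le \eta\left(\frac{d_X(x,y)}{d_X(x,z)}\right)$ for all distinct $x,y,z\in X$; two spaces are quasisymmetrically equivalent if there is a quasisymmetry between them. *)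

theory Defs
  imports "HOL-Analysis.Analysis"
begin

section \<open>Metric trees\<close>

text \<open>
  Metric spaces are elements of the library type \<^typ>\<open>'a metric\<close>, i.e. a carrier set
  \<^term>\<open>mspace m\<close> together with a distance function \<^term>\<open>mdist m\<close>.

  Arcs are homeomorphic images of the unit interval.  The degenerate arc joining a point to
  itself is a singleton, parametrized by a constant map.
\<close>

definition arc_param :: "'a topology \<Rightarrow> 'a \<Rightarrow> 'a \<Rightarrow> (real \<Rightarrow> 'a) \<Rightarrow> bool" where
  "arc_param X x y g \<longleftrightarrow>
     g 0 = x \<and> g 1 = y \<and>
     (if x = y then x \<in> topspace X \<and> (\<forall>t\<in>{0..1}. g t = x)
      else embedding_map (top_of_set {0..1}) X g)"

definition is_arc :: "'a topology \<Rightarrow> 'a \<Rightarrow> 'a \<Rightarrow> 'a set \<Rightarrow> bool" where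
  "is_arc X x y A \<longleftrightarrow> (\<exists>g. arc_param X x y g \<and> A = g ` {0..1})"

definition metric_tree :: "'a metric \<Rightarrow> bool" where
  "metric_tree m \<longleftrightarrow>
     compact_space (mtopology_of m) \<and>
     connected_space (mtopology_of m) \<and>
     locally_connected_space (mtopology_of m) \<and>
     (\<exists>x\<in>mspace m. \<exists>y\<in>mspace m. x \<noteq> y) \<and>
     (\<forall>x\<in>mspace m. \<forall>y\<in>mspace m. \<exists>!A. is_arc (mtopology_of m) x y A)"

section \<open>Quasiconformal trees\<close>

definition doubling :: "'a metric \<Rightarrow> bool" where
  "doubling m \<longleftrightarrow>
     (\<exists>N::nat. \<forall>x\<in>mspace m. \<forall>R>0.
        \<exists>C. C \<subseteq> mspace m \<and> finite C \<and> card C \<le> N \<and>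
            mball_of m x R \<subseteq> (\<Union>c\<in>C. mball_of m c (R / 2)))"

text \<open>The library's \<^const>\<open>diameter\<close> is restricted to type-class metric spaces and is \<open>0\<close> on
  unbounded sets; here unbounded sets have diameter \<open>\<infinity>\<close>, and the empty set has diameter \<open>0\<close>.\<close>

definition mdiam :: "'a metric \<Rightarrow> 'a set \<Rightarrow> ennreal" where
  "mdiam m E = (SUP x\<in>E. SUP y\<in>E. ennreal (mdist m x y))"

definition bounded_turning :: "'a metric \<Rightarrow> bool" where
  "bounded_turning m \<longleftrightarrow>
     (\<exists>K\<ge>1. \<forall>x\<in>mspace m. \<forall>y\<in>mspace m.
        \<exists>E. compactin (mtopology_of m) E \<and> connectedin (mtopology_of m) E \<and>
            x \<in> E \<and> y \<in> E \<and> mdiam m E \<le> ennreal (K * mdist m x y))"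

definition quasiconformal_tree :: "'a metric \<Rightarrow> bool" where
  "quasiconformal_tree m \<longleftrightarrow> metric_tree m \<and> doubling m \<and> bounded_turning m"

section \<open>Geodesic trees\<close>

text \<open>Only the values \<open>t 0, \<dots>, t n\<close> of a partition matter; beyond \<open>n\<close> the function \<open>t\<close> is
  unconstrained.\<close>

definition curve_length :: "'a metric \<Rightarrow> (real \<Rightarrow> 'a) \<Rightarrow> ennreal" where
  "curve_length m g =
     (SUP (n, t) \<in> {(n::nat, t::nat \<Rightarrow> real). t 0 = 0 \<and> t n = 1 \<and> mono_on {..n} t}.
        \<Sum>i<n. ennreal (mdist m (g (t i)) (g (t (Suc i)))))"

text \<open>The length of an arc is computed from a parametrization; it does not depend on which
  parametrization is used.\<close>

definition geodesic_space :: "'a metric \<Rightarrow> bool" where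
  "geodesic_space m \<longleftrightarrow>
     (\<forall>x\<in>mspace m. \<forall>y\<in>mspace m.
        \<exists>g. arc_param (mtopology_of m) x y g \<and> curve_length m g = ennreal (mdist m x y))"

definition geodesic_tree :: "'a metric \<Rightarrow> bool" where
  "geodesic_tree m \<longleftrightarrow> metric_tree m \<and> geodesic_space m"

section \<open>Quasisymmetries\<close>

definition quasisymmetry :: "'a metric \<Rightarrow> 'b metric \<Rightarrow> ('a \<Rightarrow> 'b) \<Rightarrow> bool" where
  "quasisymmetry m m' f \<longleftrightarrow>
     homeomorphic_map (mtopology_of m) (mtopology_of m') f \<and>
     (\<exists>\<eta>::real \<Rightarrow> real. homeomorphic_map (top_of_set {0..}) (top_of_set {0..}) \<eta> \<and>
        (\<forall>x\<in>mspace m. \<forall>y\<in>mspace m. \<forall>z\<in>mspace m. x \<noteq> y \<and> y \<noteq> z \<and> x \<noteq> z \<longrightarrow>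
           mdist m' (f x) (f y) / mdist m' (f x) (f z) \<le> \<eta> (mdist m x y / mdist m x z)))"

definition quasisymmetrically_equivalent :: "'a metric \<Rightarrow> 'b metric \<Rightarrow> bool" where
  "quasisymmetrically_equivalent m m' \<longleftrightarrow> (\<exists>f. quasisymmetry m m' f)"

section \<open>Hausdorff dimension\<close>

text \<open>The gauge \<open>diam(U)\<^sup>s\<close>, with the conventions that the empty set contributes \<open>0\<close> and that
  every nonempty set contributes \<open>1\<close> when \<open>s = 0\<close> (note that \<^term>\<open>0 powr 0 = (0::real)\<close>).  It is
  only used for sets of finite diameter.\<close>

definition hausdorff_gauge :: "'a metric \<Rightarrow> real \<Rightarrow> 'a set \<Rightarrow> ennreal" where
  "hausdorff_gauge m s U =
     (if U = {} then 0 else if s = 0 then 1 else ennreal (enn2real (mdiam m U) powr s))"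

definition hausdorff_content :: "'a metric \<Rightarrow> real \<Rightarrow> real \<Rightarrow> 'a set \<Rightarrow> ennreal" where
  "hausdorff_content m s \<delta> A =
     (INF U \<in> {U::nat \<Rightarrow> 'a set. (\<forall>i. U i \<subseteq> mspace m \<and> mdiam m (U i) \<le> ennreal \<delta>) \<and>
                                 A \<subseteq> (\<Union>i. U i)}.
        \<Sum>i. hausdorff_gauge m s (U i))"

definition hausdorff_measure :: "'a metric \<Rightarrow> real \<Rightarrow> 'a set \<Rightarrow> ennreal" where
  "hausdorff_measure m s A = (SUP \<delta>\<in>{0<..}. hausdorff_content m s \<delta> A)"

definition hausdorff_dim :: "'a metric \<Rightarrow> ennreal" where
  "hausdorff_dim m = (INF s\<in>{s. 0 \<le> s \<and> hausdorff_measure m s (mspace m) = 0}. ennreal s)"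

end

theory Submission
  imports Defs "HOL-Probability.Discrete_Topology"
begin

text \<open>
  Replacing the metric by the diameter of the arc \<open>[x, y]\<close> changes it only by a bounded factor and makes it
  monotone along arcs.  Fix a root \<open>p\<close>, order the tree by \<open>x \<le> y\<close> iff \<open>x \<in> [p, y]\<close>, and look for a monotone
  height function \<open>h\<close>: then \<open>h x + h y - 2 h (x \<and> y)\<close> is additive along arcs, hence geodesic.  The height is
  a limit of finite sums of weights.  A finite chain of nested nets cuts the tree into cells at the
  scales \<open>\<delta> ^ n\<close>; in every cell one main direction is selected, and the weight of the cell is distributed
  over its subcells such that the sum along the main direction is preserved.  The subcells adjacent to a
  vertex of the coarser net and those off the main direction get a factor \<open>\<epsilon>\<close>, which is always the same, so
  that neighbouring cells keep comparable weights on all scales; the remaining subcells share the rest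
  equally.  The \<open>\<alpha>\<close>-th powers of the weights of the subcells add up to at most \<open>2 powr (1 - \<alpha>) + M \<epsilon> powr \<alpha>\<close>
  times that of the cell, where \<open>M\<close> bounds the number of subcells; for small \<open>\<epsilon>\<close> this factor is less than
  one, which bounds the Hausdorff dimension.
\<close>

section \<open>Rooted trees and nested nets\<close>

text \<open>A net level arises by thinning the next finer one, so nested levels are built from the
  finest one upwards and only finitely many at a time. All constants are independent of the number
  of levels, and the heights converge along a filter; the cells do not converge, so the covering
  estimate is carried over by a finite set of test points.

  The delicate estimate is the lower bound for the height gained when an arc crosses a cell. An arc
  leaving every cell off its main direction would lose a factor \<epsilon> at each scale. Counting
  prevents this: a crossing meets more subcells than the cell has neighbours above it, so some
  subcell is crossed along its own main direction, and there the loss stops. This dictates the order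
  of the constants: a bound \<open>m\<close> on the neighbours, then \<delta> so small that a
  crossing has more than \<open>m\<close> subcells, then a bound \<open>M\<close> on the subcells,
  then \<epsilon>.

  Bounded turning supplies continua and not arcs. A path is constructed by refining chains, and the
  arc contained in it is the arc of the tree by uniqueness.\<close>

lemma finite_subset_kernel:
  fixes lt :: "'a \<Rightarrow> 'a \<Rightarrow> bool"
  assumes "finite V'"
    and irr: "\<And>x. \<not> lt x x" and tr: "\<And>x y z. lt x y \<Longrightarrow> lt y z \<Longrightarrow> lt x z"
  shows "\<exists>V\<subseteq>V'. \<forall>z\<in>V'. z \<in> V \<longleftrightarrow> P z \<and> (\<forall>v\<in>V. lt v z \<longrightarrow> Q v z)"
  using assms(1)
proof (induction "card V'" arbitrary: V')
  case 0
  then show ?case by auto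
next
  case (Suc k)
  \<comment> \<open>This counts predecessors, so an element with the largest count is maximal. A
    maximal element enters the condition of no other element and can be decided last; the kernel is
    the outcome of a greedy selection running upwards.\<close>
  define c where "c x = card {u\<in>V'. lt u x}" for x
  have "V' \<noteq> {}" using Suc by auto
  then obtain z where z: "z \<in> V'" "\<And>y. y \<in> V' \<Longrightarrow> c y \<le> c z"
    using obtains_MAX[of V' c] Suc.prems by (metis Max_ge finite_imageI image_eqI)
  have zmax: "\<not> lt z y" if "y \<in> V'" for y
  proof
    assume l: "lt z y"
    have "c z < c y" unfolding c_def
    proof (rule psubset_card_mono)
      have "{u\<in>V'. lt u z} \<subseteq> {u\<in>V'. lt u y}" using l tr by blast
      moreover have "z \<in> {u\<in>V'. lt u y}" "z \<notin> {u\<in>V'. lt u z}" using l irr z by auto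
      ultimately show "{u\<in>V'. lt u z} \<subset> {u\<in>V'. lt u y}" by blast
    qed (use Suc.prems in auto)
    with z(2)[OF that] show False by simp
  qed
  have "card (V' - {z}) = k" using Suc z by simp
  with Suc obtain V where V: "V \<subseteq> V' - {z}"
    "\<forall>y\<in>V'-{z}. y \<in> V \<longleftrightarrow> P y \<and> (\<forall>v\<in>V. lt v y \<longrightarrow> Q v y)"
    by (metis finite_Diff)
  define W where "W = (if P z \<and> (\<forall>v\<in>V. lt v z \<longrightarrow> Q v z) then insert z V else V)"
  have WV: "W \<subseteq> insert z V" "V \<subseteq> W" "z \<in> W \<longleftrightarrow> P z \<and> (\<forall>v\<in>V. lt v z \<longrightarrow> Q v z)"
    using V(1) by (auto simp: W_def)
  have "W \<subseteq> V'" using WV z V by auto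
  moreover have "y \<in> W \<longleftrightarrow> P y \<and> (\<forall>v\<in>W. lt v y \<longrightarrow> Q v y)" if "y \<in> V'" for y
  proof (cases "y = z")
    case True
    then show ?thesis using WV irr by blast
  next
    case False
    then have "y \<in> W \<longleftrightarrow> y \<in> V" using WV by auto
    moreover have "y \<in> V \<longleftrightarrow> P y \<and> (\<forall>v\<in>V. lt v y \<longrightarrow> Q v y)" using V(2) False that by blast
    ultimately show ?thesis using WV zmax[OF that] by blast
  qed
  ultimately show ?case by blast
qed

text \<open>In the application \<open>d\<close> is the diameter of the arc between two points and
  \<open>mt\<close> the point where the arcs from the root separate. Topology enters only through
  the last three assumptions: \<open>ivt\<close> is the intermediate value theorem along an arc,
  \<open>disc\<close> is compactness in a form that provides ancestors, \<open>count\<close> is the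
  doubling property as a packing bound.\<close>

locale rooted_tree =
  fixes T :: "'a set" and le :: "'a \<Rightarrow> 'a \<Rightarrow> bool" (infix "\<sqsubseteq>" 50)
    and mt :: "'a \<Rightarrow> 'a \<Rightarrow> 'a" and p :: 'a and d :: "'a \<Rightarrow> 'a \<Rightarrow> real"
  assumes root: "p \<in> T" "\<And>x. x \<in> T \<Longrightarrow> p \<sqsubseteq> x"
    and le_T: "\<And>x y. x \<sqsubseteq> y \<Longrightarrow> x \<in> T \<and> y \<in> T"
    and le_refl: "\<And>x. x \<in> T \<Longrightarrow> x \<sqsubseteq> x"
    and le_antisym: "\<And>x y. x \<sqsubseteq> y \<Longrightarrow> y \<sqsubseteq> x \<Longrightarrow> x = y"
    and le_trans: "\<And>x y z. x \<sqsubseteq> y \<Longrightarrow> y \<sqsubseteq> z \<Longrightarrow> x \<sqsubseteq> z"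
    and le_linear: "\<And>x y z. x \<sqsubseteq> z \<Longrightarrow> y \<sqsubseteq> z \<Longrightarrow> x \<sqsubseteq> y \<or> y \<sqsubseteq> x"
    and mt_le: "\<And>x y. x \<in> T \<Longrightarrow> y \<in> T \<Longrightarrow> mt x y \<sqsubseteq> x \<and> mt x y \<sqsubseteq> y"
    and mt_greatest: "\<And>x y z. z \<sqsubseteq> x \<Longrightarrow> z \<sqsubseteq> y \<Longrightarrow> z \<sqsubseteq> mt x y"
    and d_refl: "\<And>x. x \<in> T \<Longrightarrow> d x x = 0"
    and d_sym: "\<And>x y. x \<in> T \<Longrightarrow> y \<in> T \<Longrightarrow> d x y = d y x"
    and d_nonneg: "\<And>x y. x \<in> T \<Longrightarrow> y \<in> T \<Longrightarrow> 0 \<le> d x y"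
    and d_tri: "\<And>x y z. x \<in> T \<Longrightarrow> y \<in> T \<Longrightarrow> z \<in> T \<Longrightarrow> d x z \<le> d x y + d y z"
    and d_mono1: "\<And>x y z. x \<sqsubseteq> y \<Longrightarrow> y \<sqsubseteq> z \<Longrightarrow> d x y \<le> d x z"
    and d_mono2: "\<And>x y z. x \<sqsubseteq> y \<Longrightarrow> y \<sqsubseteq> z \<Longrightarrow> d y z \<le> d x z"
    and d_mt: "\<And>x y. x \<in> T \<Longrightarrow> y \<in> T \<Longrightarrow> d x (mt x y) \<le> d x y"
    and ivt: "\<And>x z r. x \<sqsubseteq> z \<Longrightarrow> 0 \<le> r \<Longrightarrow> r \<le> d x z \<Longrightarrow> \<exists>y. x \<sqsubseteq> y \<and> y \<sqsubseteq> z \<and> d x y = r"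
    and disc: "\<And>\<tau>. 0 < \<tau> \<Longrightarrow> \<exists>U. finite U \<and> p \<in> U \<and> U \<subseteq> T \<and> (\<forall>x\<in>T. \<exists>u\<in>U. u \<sqsubseteq> x \<and> d u x \<le> \<tau>)"
    and count: "\<And>q::real. \<exists>M::nat. \<forall>r>0. \<forall>x\<in>T. \<forall>Y. finite Y \<and> Y \<subseteq> T \<and> (\<forall>y\<in>Y. d x y \<le> q * r) \<and>
         (\<forall>y\<in>Y. \<forall>z\<in>Y. y \<noteq> z \<longrightarrow> r \<le> d y z) \<longrightarrow> card Y \<le> M"
begin

definition lt (infix "\<sqsubset>" 50) where "x \<sqsubset> y \<longleftrightarrow> x \<sqsubseteq> y \<and> x \<noteq> y"

lemma lt_le: "x \<sqsubset> y \<Longrightarrow> x \<sqsubseteq> y" by (simp add: lt_def)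
lemma lt_irrefl: "\<not> x \<sqsubset> x" by (simp add: lt_def)
lemma lt_trans: "x \<sqsubset> y \<Longrightarrow> y \<sqsubset> z \<Longrightarrow> x \<sqsubset> z" using le_antisym le_trans lt_def by metis
lemma le_lt_trans: "x \<sqsubseteq> y \<Longrightarrow> y \<sqsubset> z \<Longrightarrow> x \<sqsubset> z" using le_antisym le_trans lt_def by metis
lemma lt_le_trans: "x \<sqsubset> y \<Longrightarrow> y \<sqsubseteq> z \<Longrightarrow> x \<sqsubset> z" using le_antisym le_trans lt_def by metis
lemma lt_not_le: "x \<sqsubset> y \<Longrightarrow> \<not> y \<sqsubseteq> x" using le_antisym lt_def by metis
lemma comparable: "x \<sqsubseteq> z \<Longrightarrow> y \<sqsubseteq> z \<Longrightarrow> x \<sqsubset> y \<or> y \<sqsubseteq> x" using le_linear lt_def by metis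

lemma mt_commute: "x \<in> T \<Longrightarrow> y \<in> T \<Longrightarrow> mt x y = mt y x"
  by (intro le_antisym mt_greatest) (simp_all add: mt_le)

lemma mt_T: "x \<in> T \<Longrightarrow> y \<in> T \<Longrightarrow> mt x y \<in> T"
  using mt_le[of x y] le_T[of "mt x y" x] by simp

lemma finite_chain_greatest:
  assumes "finite C" "C \<noteq> {}" "\<And>c. c \<in> C \<Longrightarrow> c \<sqsubseteq> x"
  shows "\<exists>g\<in>C. \<forall>c\<in>C. c \<sqsubseteq> g"
  using assms
proof (induction C rule: finite_ne_induct)
  case (singleton c)
  then show ?case using le_T le_refl by blast
next
  case (insert c C)
  then obtain g where "g \<in> C" "\<forall>c\<in>C. c \<sqsubseteq> g" by blast
  moreover have "c \<sqsubseteq> g \<or> g \<sqsubseteq> c" using insert.prems \<open>g \<in> C\<close> le_linear by blast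
  ultimately show ?case using le_trans le_refl le_T insert.prems by (metis insert_iff)
qed

lemma finite_chain_least:
  assumes "finite C" "C \<noteq> {}" "\<And>c. c \<in> C \<Longrightarrow> c \<sqsubseteq> x"
  shows "\<exists>g\<in>C. \<forall>c\<in>C. g \<sqsubseteq> c"
  using assms
proof (induction C rule: finite_ne_induct)
  case (singleton c)
  then show ?case using le_T le_refl by blast
next
  case (insert c C)
  then obtain g where "g \<in> C" "\<forall>c\<in>C. g \<sqsubseteq> c" by blast
  moreover have "c \<sqsubseteq> g \<or> g \<sqsubseteq> c" using insert.prems \<open>g \<in> C\<close> le_linear by blast
  ultimately show ?case using le_trans le_refl le_T insert.prems by (metis insert_iff)
qed

section \<open>Covers and nets with respect to the rooted order\<close>

definition high :: "real \<Rightarrow> 'a \<Rightarrow> bool" where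
  "high r z \<longleftrightarrow> (\<exists>x. z \<sqsubseteq> x \<and> r \<le> d z x)"

definition covers :: "real \<Rightarrow> 'a set \<Rightarrow> bool" where
  "covers c V \<longleftrightarrow> finite V \<and> p \<in> V \<and> V \<subseteq> T \<and> (\<forall>x\<in>T. \<exists>v\<in>V. v \<sqsubseteq> x \<and> d v x \<le> c)"

text \<open>Separation is asked of comparable vertices only; vertices on different branches may be
  arbitrarily close. Counting therefore rests on \<open>high\<close>: above each vertex other than
  the root there is a branch of size at least \<open>r\<close>. The factor 3 in the covering radius
  is what the thinning in \<open>coarser_net\<close> costs.\<close>

definition is_net :: "real \<Rightarrow> 'a set \<Rightarrow> bool" where
  "is_net r V \<longleftrightarrow> covers (3 * r) V \<and> (\<forall>u\<in>V. \<forall>v\<in>V. u \<sqsubset> v \<longrightarrow> r \<le> d u v) \<and>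
     (\<forall>v\<in>V. v \<noteq> p \<longrightarrow> high r v)"

definition consec :: "'a set \<Rightarrow> 'a \<Rightarrow> 'a \<Rightarrow> bool" where
  "consec V u v \<longleftrightarrow> u \<in> V \<and> v \<in> V \<and> u \<sqsubset> v \<and> (\<forall>z\<in>V. z \<sqsubset> v \<longrightarrow> \<not> u \<sqsubset> z)"

lemma covers_greatest:
  assumes "covers c V" "x \<in> T"
  shows "\<exists>v\<in>V. v \<sqsubseteq> x \<and> d v x \<le> c \<and> (\<forall>u\<in>V. u \<sqsubseteq> x \<longrightarrow> u \<sqsubseteq> v)"
proof -
  obtain v0 where v0: "v0 \<in> V" "v0 \<sqsubseteq> x" "d v0 x \<le> c" using assms by (auto simp: covers_def)
  have "finite {v\<in>V. v \<sqsubseteq> x}" "{v\<in>V. v \<sqsubseteq> x} \<noteq> {}" using assms v0 by (auto simp: covers_def)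
  then obtain g where g: "g \<in> {v\<in>V. v \<sqsubseteq> x}" "\<forall>u\<in>{v\<in>V. v \<sqsubseteq> x}. u \<sqsubseteq> g"
    using finite_chain_greatest[of "{v\<in>V. v \<sqsubseteq> x}" x] by blast
  then have "v0 \<sqsubseteq> g" using v0 by simp
  then have "d g x \<le> c" using d_mono2[of v0 g x] g v0 by simp
  then show ?thesis using g by blast
qed

text \<open>A point between \<open>u\<close> and \<open>v\<close> farther than \<open>c\<close> from
  \<open>u\<close> is covered by a vertex that cannot lie strictly above \<open>u\<close>, hence
  lies below it; monotonicity of \<open>d\<close> along chains then makes that vertex too
  distant.\<close>

lemma consec_gap:
  assumes "covers c V" "consec V u v"
  shows "d u v \<le> c"
proof (rule ccontr)
  assume "\<not> d u v \<le> c"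
  have uv: "u \<in> V" "v \<in> V" "u \<sqsubset> v" "u \<sqsubseteq> v" "u \<in> T" "v \<in> T" 
    using assms lt_le le_T unfolding consec_def by blast+
  have c0: "0 \<le> c" using assms root(1) d_nonneg le_T unfolding covers_def by (meson order_trans)
  define s where "s = (c + d u v) / 2"
  have s: "c < s" "s < d u v" using \<open>\<not> d u v \<le> c\<close> by (auto simp: s_def field_simps)
  then obtain x where x: "u \<sqsubseteq> x" "x \<sqsubseteq> v" "d u x = s" using ivt[OF uv(4), of s] c0 by auto
  have xv: "x \<sqsubset> v" using s x by (auto simp: lt_def)
  obtain w where w: "w \<in> V" "w \<sqsubseteq> x" "d w x \<le> c" using assms(1) x(1) le_T unfolding covers_def by blast
  have "w \<sqsubseteq> u"
    using comparable[OF x(1) w(2)] assms(2) w le_lt_trans[OF w(2) xv] unfolding consec_def by blast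
  then have "d u x \<le> d w x" using d_mono2 x(1) by blast
  then show False using x s w by simp
qed

text \<open>The greedy choice keeps the root and each high vertex that is at distance at least
  \<open>r\<close> from all chosen vertices below it. For the covering radius, let \<open>z1\<close>
  be the last vertex of \<open>U\<close> below \<open>x\<close> that is high or the root: a chosen
  vertex lies within \<open>r\<close> below it. The next vertex of \<open>U\<close> towards
  \<open>x\<close>, if there is one, is at most \<open>r\<close> away from \<open>z1\<close> and,
  not being high, within \<open>r\<close> of \<open>x\<close>.\<close>

lemma coarser_net:
  assumes U: "covers r U" and r: "0 < r"
  shows "\<exists>V\<subseteq>U. is_net r V"
proof -
  have fU: "finite U" "p \<in> U" "U \<subseteq> T" and Ux: "\<And>x. x \<in> T \<Longrightarrow> \<exists>u\<in>U. u \<sqsubseteq> x \<and> d u x \<le> r"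
    using U by (auto simp: covers_def)
  obtain V where VU: "V \<subseteq> U" and V: "\<forall>z\<in>U. z \<in> V \<longleftrightarrow> (z = p \<or> high r z) \<and> (\<forall>v\<in>V. v \<sqsubset> z \<longrightarrow> r \<le> d v z)"
    using finite_subset_kernel[OF fU(1), of lt "\<lambda>z. z = p \<or> high r z" "\<lambda>v z. r \<le> d v z"] lt_irrefl lt_trans
    by blast
  have pmin: "\<not> v \<sqsubset> p" if "v \<in> T" for v using root that lt_not_le by blast
  have pV: "p \<in> V" using V fU pmin VU by blast
  have sep: "\<forall>u\<in>V. \<forall>v\<in>V. u \<sqsubset> v \<longrightarrow> r \<le> d u v" using V VU by blast
  have hi: "\<forall>v\<in>V. v \<noteq> p \<longrightarrow> high r v" using V VU by blast
  have near: "\<exists>v\<in>V. v \<sqsubseteq> z \<and> d v z \<le> r" if "z \<in> U" "high r z \<or> z = p" for z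
  proof (cases "z \<in> V")
    case True
    then show ?thesis using le_refl d_refl r fU that by (metis less_imp_le subsetD)
  next
    case False
    then show ?thesis using V that pV lt_le by (metis linear)
  qed
  have cov: "\<exists>v\<in>V. v \<sqsubseteq> x \<and> d v x \<le> 3 * r" if x: "x \<in> T" for x
  proof -
    define C where "C = {z\<in>U. z \<sqsubseteq> x \<and> (high r z \<or> z = p)}"
    have "finite C" "p \<in> C" using fU root x by (auto simp: C_def)
    moreover have "c \<sqsubseteq> x" if "c \<in> C" for c using that by (simp add: C_def)
    ultimately obtain z1 where z1: "z1 \<in> C" "\<forall>c\<in>C. c \<sqsubseteq> z1"
      using finite_chain_greatest[of C x] by blast
    then have z1': "z1 \<in> U" "z1 \<sqsubseteq> x" "high r z1 \<or> z1 = p" "z1 \<in> T"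
      using fU by (auto simp: C_def)
    obtain v where v: "v \<in> V" "v \<sqsubseteq> z1" "d v z1 \<le> r" using near[OF z1'(1,3)] by auto
    have "d z1 x \<le> 2 * r"
    proof (cases "\<exists>z\<in>U. z1 \<sqsubset> z \<and> z \<sqsubseteq> x")
      case False
      obtain g where g: "g \<in> U" "g \<sqsubseteq> x" "d g x \<le> r" using Ux[OF x] by blast
      have "g \<sqsubseteq> z1" using False comparable[OF z1'(2) g(2)] g by blast
      then have "d z1 x \<le> d g x" using d_mono2[OF _ z1'(2)] by blast
      then show ?thesis using g r by simp
    next
      case True
      define D where "D = {z\<in>U. z1 \<sqsubset> z \<and> z \<sqsubseteq> x}"
      have "finite D" "D \<noteq> {}" using fU True by (auto simp: D_def)
      moreover have "c \<sqsubseteq> x" if "c \<in> D" for c using that by (simp add: D_def)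
      ultimately obtain z0 where z0: "z0 \<in> D" "\<forall>c\<in>D. z0 \<sqsubseteq> c"
        using finite_chain_least[of D x] by blast
      then have z0': "z0 \<in> U" "z1 \<sqsubset> z0" "z0 \<sqsubseteq> x" by (auto simp: D_def)
      have "\<not> z1 \<sqsubset> c" if "c \<in> U" "c \<sqsubset> z0" for c
      proof
        assume "z1 \<sqsubset> c"
        moreover have "c \<sqsubseteq> x" using le_trans[OF lt_le[OF that(2)] z0'(3)] .
        ultimately have "z0 \<sqsubseteq> c" using z0(2) that by (simp add: D_def)
        then show False using lt_not_le[OF that(2)] by simp
      qed
      then have "consec U z1 z0" using z0' z1' by (simp add: consec_def)
      then have "d z1 z0 \<le> r" using consec_gap[OF U] by simp
      moreover have "\<not> high r z0"
      proof
        assume "high r z0"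
        then have "z0 \<sqsubseteq> z1" using z1(2) z0' by (simp add: C_def)
        then show False using lt_not_le[OF z0'(2)] by simp
      qed
      then have "d z0 x < r" using z0'(3) not_le unfolding high_def by blast
      moreover have "d z1 x \<le> d z1 z0 + d z0 x" using d_tri x z1'(4) z0'(1) fU(3) by blast
      ultimately show ?thesis by simp
    qed
    moreover have "d v x \<le> d v z1 + d z1 x" using d_tri v(1) z1'(4) x VU fU(3) by blast
    ultimately have "d v x \<le> 3 * r" using v by simp
    then show ?thesis using v le_trans[OF v(2) z1'(2)] by blast
  qed
  have "is_net r V" unfolding is_net_def covers_def
    by (intro conjI sep hi pV finite_subset[OF VU fU(1)] subset_trans[OF VU fU(3)] ballI cov)
  then show ?thesis using VU by blast
qed

lemma is_netD:
  assumes "is_net r V"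
  shows "finite V" "p \<in> V" "V \<subseteq> T" "covers (3 * r) V"
    "\<And>u v. u \<in> V \<Longrightarrow> v \<in> V \<Longrightarrow> u \<sqsubset> v \<Longrightarrow> r \<le> d u v"
    "\<And>v. v \<in> V \<Longrightarrow> v \<noteq> p \<Longrightarrow> high r v"
proof -
  show "finite V" "p \<in> V" "V \<subseteq> T" "covers (3 * r) V"
    using assms unfolding is_net_def covers_def by simp_all
qed (use assms in \<open>simp_all add: is_net_def\<close>)

text \<open>The induction shifts levels: the chain for \<open>R * \<delta>\<close> provides the
  levels from 1 on, and level 0 is thinned out of its coarsest net, whose covering radius
  \<open>3 * (R * \<delta>)\<close> is at most \<open>R\<close>.\<close>

lemma nested_nets:
  assumes \<delta>: "0 < \<delta>" "\<delta> \<le> 1/3" and "0 < R"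
  shows "\<exists>V. (\<forall>n\<le>N. is_net (R * \<delta> ^ n) (V n)) \<and> (\<forall>n<N. V n \<subseteq> V (Suc n))"
  using \<open>0 < R\<close>
proof (induction N arbitrary: R)
  case 0
  obtain U where "covers R U" using disc[of R] 0 by (auto simp: covers_def)
  then obtain V where "is_net R V" using coarser_net 0 by blast
  then show ?case by (intro exI[of _ "\<lambda>_. V"]) auto
next
  case (Suc N)
  then obtain V where V: "\<forall>n\<le>N. is_net (R * \<delta> * \<delta> ^ n) (V n)" "\<forall>n<N. V n \<subseteq> V (Suc n)"
    using \<delta> by (metis mult_pos_pos)
  have c: "covers (3 * (R * \<delta>)) (V 0)" using V(1) is_netD(4) by fastforce
  have "3 * (R * \<delta>) \<le> R" using \<delta> Suc.prems by (simp add: mult.commute mult_left_le)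
  then have "covers R (V 0)" using c unfolding covers_def by (meson order_trans)
  then obtain V0 where V0: "V0 \<subseteq> V 0" "is_net R V0" using coarser_net Suc.prems by blast
  define W where "W n = (case n of 0 \<Rightarrow> V0 | Suc k \<Rightarrow> V k)" for n
  have "is_net (R * \<delta> ^ n) (W n)" if "n \<le> Suc N" for n
    using that V0 V(1) by (cases n) (auto simp: W_def mult.assoc)
  moreover have "W n \<subseteq> W (Suc n)" if "n < Suc N" for n
    using that V0 V(2) by (cases n) (auto simp: W_def)
  ultimately show ?case by blast
qed

text \<open>Vertices on different branches may be close, so \<open>count\<close> is applied to
  points \<open>y v\<close> at distance \<open>r / 3\<close> above them. If \<open>v\<close> is not
  below \<open>u\<close>, then it is not below \<open>y u\<close> either, so the meet of
  \<open>y u\<close> and \<open>y v\<close> lies below \<open>v\<close> and the two points are at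
  least \<open>d v (y v)\<close> apart. The root, which need not be high, costs the additional one;
  \<open>3 * q + 1\<close> is the enlarged radius in units of \<open>r / 3\<close>.\<close>

lemma net_count:
  "\<exists>M::nat. \<forall>r>0. \<forall>V. is_net r V \<longrightarrow> (\<forall>x\<in>T. card {v\<in>V. d x v \<le> q * r} \<le> M)"
proof -
  from count[of "3 * q + 1"]
  obtain M where M: "\<forall>r>0. \<forall>x\<in>T. \<forall>Y. finite Y \<and> Y \<subseteq> T \<and> (\<forall>y\<in>Y. d x y \<le> (3 * q + 1) * r) \<and>
         (\<forall>y\<in>Y. \<forall>z\<in>Y. y \<noteq> z \<longrightarrow> r \<le> d y z) \<longrightarrow> card Y \<le> M" ..
  have "card {v\<in>V. d x v \<le> q * r} \<le> Suc M" if r: "r > 0" and V: "is_net r V" and x: "x \<in> T" for r V x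
  proof -
    note n = is_netD[OF V]
    have "\<exists>y. u \<sqsubseteq> y \<and> d u y = r / 3" if u: "u \<in> V" "u \<noteq> p" for u
    proof -
      obtain z where "u \<sqsubseteq> z" "r \<le> d u z" using n(6)[OF u] by (auto simp: high_def)
      then show ?thesis using ivt[of u z "r/3"] r by auto
    qed
    then obtain y where y: "\<And>u. u \<in> V \<Longrightarrow> u \<noteq> p \<Longrightarrow> u \<sqsubseteq> y u \<and> d u (y u) = r / 3" by metis
    have sep: "r / 3 \<le> d (y u) (y v)" if uv: "u \<in> V" "u \<noteq> p" "v \<in> V" "v \<noteq> p" "u \<noteq> v" "\<not> v \<sqsubset> u" for u v
    proof -
      have nv: "\<not> v \<sqsubseteq> y u"
      proof
        assume a: "v \<sqsubseteq> y u"
        then have "u \<sqsubset> v" using y[of u] comparable[of v "y u" u] uv by (metis lt_def)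
        then have "r \<le> d u v" using n(5) uv by blast
        also have "\<dots> \<le> d u (y u)" using d_mono1[of u v "y u"] a \<open>u \<sqsubset> v\<close> lt_le by blast
        finally show False using y[of u] uv r by simp
      qed
      have T: "y u \<in> T" "y v \<in> T" using y uv le_T by blast+
      let ?m = "mt (y u) (y v)"
      have m: "?m \<sqsubseteq> y u" "?m \<sqsubseteq> y v" using mt_le T by blast+
      have "?m \<sqsubseteq> v" using comparable[of v "y v" ?m] m y[of v] uv nv le_trans lt_le by blast
      then have "d v (y v) \<le> d ?m (y v)" using d_mono2 y uv by blast
      also have "\<dots> = d (y v) (mt (y v) (y u))"
        using mt_commute[OF T] d_sym[OF mt_T[OF T] T(2)] by simp
      also have "\<dots> \<le> d (y v) (y u)" using d_mt T by simp
      finally show ?thesis using y[of v] uv d_sym[OF T] by simp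
    qed
    have sep': "r / 3 \<le> d (y u) (y v)" if "u \<in> V" "u \<noteq> p" "v \<in> V" "v \<noteq> p" "u \<noteq> v" for u v
    proof (cases "v \<sqsubset> u")
      case True
      then have "\<not> u \<sqsubset> v" using lt_trans[of u v u] lt_irrefl by auto
      then have "r / 3 \<le> d (y v) (y u)" using sep[of v u] that by auto
      then show ?thesis using d_sym[of "y u" "y v"] le_T[of u "y u"] le_T[of v "y v"] y[of u] y[of v] that by simp
    qed (use sep that in auto)
    define B where "B = {v\<in>V. d x v \<le> q * r} - {p}"
    have inj: "inj_on y B"
    proof (rule inj_onI, rule ccontr)
      fix u v assume "u \<in> B" "v \<in> B" "y u = y v" "u \<noteq> v"
      then have "r / 3 \<le> d (y u) (y u)" "y u \<in> T" using sep'[of u v] y[of u] le_T by (auto simp: B_def)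
      then show False using d_refl r by simp
    qed
    have fB: "finite B" using n by (simp add: B_def)
    have "card (y ` B) \<le> M"
    proof (rule M[rule_format, of "r/3" x])
      have yT: "y ` B \<subseteq> T" using y le_T by (auto simp: B_def)
      have "d x (y v) \<le> (3 * q + 1) * (r / 3)" if "v \<in> B" for v
        using d_tri[of x v "y v"] y[of v] that x n(3) yT by (force simp: B_def field_simps)
      then show "finite (y ` B) \<and> y ` B \<subseteq> T \<and> (\<forall>y\<in>y ` B. d x y \<le> (3 * q + 1) * (r / 3)) \<and>
         (\<forall>u\<in>y ` B. \<forall>z\<in>y ` B. u \<noteq> z \<longrightarrow> r / 3 \<le> d u z)"
        using fB yT sep' by (auto simp: B_def)
    qed (use r x in auto)
    then have "card B \<le> M" using card_image[OF inj] by simp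
    moreover have "card {v\<in>V. d x v \<le> q * r} \<le> Suc (card B)"
      using n(1) unfolding B_def by (simp add: card_Diff_singleton_if) arith
    ultimately show ?thesis by simp
  qed
  then show ?thesis by blast
qed

end

section \<open>Weights on nested nets\<close>

text \<open>\<open>m\<close> bounds the immediate successors of a vertex within its level,
  \<open>M\<close> the subcells of a cell. By the condition on \<delta> an upward crossing of a cell
  meets at least \<open>m + 4\<close> subcells, of which at most \<open>m + 1\<close> are special.
  By the condition on \<epsilon> the subcells with factor \<epsilon> carry little weight
  altogether.\<close>

locale nested_nets = rooted_tree +
  fixes V :: "nat \<Rightarrow> 'a set" and N :: nat and r :: "nat \<Rightarrow> real" and \<delta> :: real
    and m M :: nat and \<epsilon> :: real
  assumes r_pos: "\<And>n. 0 < r n" and r_Suc: "\<And>n. r (Suc n) = \<delta> * r n"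
    and \<delta>: "0 < \<delta>" "3 * \<delta> * (m + 5) \<le> 1"
    and net: "\<And>n. n \<le> N \<Longrightarrow> is_net (r n) (V n)"
    and nest: "\<And>n. n < N \<Longrightarrow> V n \<subseteq> V (Suc n)"
    and V0: "V 0 = {p}"
    and few_children: "\<And>n x. n \<le> N \<Longrightarrow> x \<in> T \<Longrightarrow> card {v\<in>V n. d x v \<le> 3 * r n} \<le> m"
    and few_subcells: "\<And>n x. n < N \<Longrightarrow> x \<in> T \<Longrightarrow> card {v\<in>V (Suc n). d x v \<le> 3 * r n} \<le> M"
    and \<epsilon>: "0 < \<epsilon>" "20 * \<epsilon> * (M + m + 1) \<le> 1"
begin

lemma net_props:
  assumes "n \<le> N"
  shows fin: "finite (V n)" and pV: "p \<in> V n" and VT: "V n \<subseteq> T" and cov: "covers (3 * r n) (V n)"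
    and sep: "\<And>u v. u \<in> V n \<Longrightarrow> v \<in> V n \<Longrightarrow> u \<sqsubset> v \<Longrightarrow> r n \<le> d u v"
  using is_netD[OF net[OF assms]] by simp_all

lemma nest_le: "k \<le> N \<Longrightarrow> n \<le> k \<Longrightarrow> V n \<subseteq> V k"
proof (induction k)
  case (Suc k)
  then show ?case using nest[of k] by (cases "n = Suc k") auto
qed simp

section \<open>Cells: all points with the same greatest vertex below them\<close>

definition pr :: "nat \<Rightarrow> 'a \<Rightarrow> 'a" where
  "pr n x = (SOME v. v \<in> V n \<and> v \<sqsubseteq> x \<and> d v x \<le> 3 * r n \<and> (\<forall>u\<in>V n. u \<sqsubseteq> x \<longrightarrow> u \<sqsubseteq> v))"

lemma pr_props:
  assumes "n \<le> N" "x \<in> T"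
  shows pr_V: "pr n x \<in> V n" and pr_le: "pr n x \<sqsubseteq> x" and pr_d: "d (pr n x) x \<le> 3 * r n"
    and pr_max: "\<And>u. u \<in> V n \<Longrightarrow> u \<sqsubseteq> x \<Longrightarrow> u \<sqsubseteq> pr n x"
proof -
  have "\<exists>v. v \<in> V n \<and> v \<sqsubseteq> x \<and> d v x \<le> 3 * r n \<and> (\<forall>u\<in>V n. u \<sqsubseteq> x \<longrightarrow> u \<sqsubseteq> v)"
    using covers_greatest[OF cov[OF assms(1)] assms(2)] by auto
  from someI_ex[OF this]
  show "pr n x \<in> V n" "pr n x \<sqsubseteq> x" "d (pr n x) x \<le> 3 * r n" "\<And>u. u \<in> V n \<Longrightarrow> u \<sqsubseteq> x \<Longrightarrow> u \<sqsubseteq> pr n x"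
    unfolding pr_def by simp_all
qed

lemma pr_eqI:
  assumes "n \<le> N" "v \<in> V n" "v \<sqsubseteq> x" "\<And>u. u \<in> V n \<Longrightarrow> u \<sqsubseteq> x \<Longrightarrow> u \<sqsubseteq> v"
  shows "pr n x = v"
proof -
  have x: "x \<in> T" using le_T assms(3) by simp
  show ?thesis using le_antisym pr_max[OF assms(1) x assms(2,3)] assms(4) pr_V[OF assms(1) x] pr_le[OF assms(1) x] by simp
qed

lemma pr_id: "n \<le> N \<Longrightarrow> v \<in> V n \<Longrightarrow> pr n v = v"
  using VT[of n] le_refl[of v] by (intro pr_eqI) auto

lemma pr_mono:
  assumes "n \<le> N" "x \<sqsubseteq> y" shows "pr n x \<sqsubseteq> pr n y"
proof -
  have "x \<in> T" "y \<in> T" using le_T assms by auto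
  then show ?thesis using pr_max[OF assms(1)] pr_V[OF assms(1)] pr_le[OF assms(1)] le_trans assms(2) by meson
qed

lemma pr_pr:
  assumes "n \<le> k" "k \<le> N" "x \<in> T"
  shows "pr n (pr k x) = pr n x"
proof (rule pr_eqI)
  have n: "n \<le> N" using assms by simp
  show "n \<le> N" "pr n x \<in> V n" using n pr_V assms by auto
  have "pr n x \<in> V k" using pr_V[OF n assms(3)] nest_le[OF assms(2,1)] by auto
  then show "pr n x \<sqsubseteq> pr k x" using pr_max[OF assms(2,3)] pr_le[OF n assms(3)] by blast
  show "u \<sqsubseteq> pr n x" if "u \<in> V n" "u \<sqsubseteq> pr k x" for u
    using pr_max[OF n assms(3) that(1)] le_trans[OF that(2) pr_le[OF assms(2,3)]] by simp
qed

text \<open>Coarser vertices have smaller priority, and the main direction at a vertex points to the vertex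
  of smallest priority above it; hence all vertices on the way to that target have the same target.\<close>

lemma ex_priority:
  "\<exists>f :: 'a \<Rightarrow> nat. inj_on f (V N) \<and> (\<forall>n\<le>N. \<forall>u\<in>V n. \<forall>v\<in>V N - V n. f u < f v)"
proof -
  obtain g :: "'a \<Rightarrow> nat" where g: "inj_on g (V N)" "\<And>v. v \<in> V N \<Longrightarrow> g v < card (V N)"
    using ex_bij_betw_finite_nat[OF fin[OF order_refl]] by (force simp: bij_betw_def)
  define lev where "lev v = (LEAST n. v \<in> V n)" for v
  \<comment> \<open>Lexicographic order by the level of first appearance and then by the enumeration
    \<open>g\<close>, coded in base \<open>card (V N)\<close>.\<close>
  define f where "f v = lev v * card (V N) + g v" for v
  have lev: "lev u \<le> n" if "u \<in> V n" for u n unfolding lev_def using that by (rule Least_le)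
  have lev2: "n < lev v" if "v \<in> V N" "v \<notin> V n" "n \<le> N" for v n
  proof (rule ccontr)
    assume "\<not> n < lev v"
    moreover have "v \<in> V (lev v)" unfolding lev_def using that(1) by (rule LeastI)
    ultimately show False using nest_le[of n "lev v"] that by auto
  qed
  have "inj_on f (V N)"
  proof (rule inj_onI)
    fix u v assume uv: "u \<in> V N" "v \<in> V N" "f u = f v"
    have "f x mod card (V N) = g x" if "x \<in> V N" for x
      using mod_less[OF g(2)[OF that]] by (simp add: f_def)
    then have "g u = g v" using uv by metis
    then show "u = v" using uv inj_onD[OF g(1)] by simp
  qed
  moreover have "f u < f v" if "n \<le> N" "u \<in> V n" "v \<in> V N - V n" for n u v
  proof -
    have "u \<in> V N" using that nest_le[of N n] by auto
    have "Suc (lev u) \<le> lev v" using lev[OF that(2)] lev2[of v n] that by auto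
    then have "Suc (lev u) * card (V N) \<le> lev v * card (V N)" by (rule mult_le_mono1)
    then show ?thesis using g(2)[OF \<open>u \<in> V N\<close>] by (simp add: f_def)
  qed
  ultimately show ?thesis by blast
qed

definition prio :: "'a \<Rightarrow> nat" where
  "prio = (SOME f. inj_on f (V N) \<and> (\<forall>n\<le>N. \<forall>u\<in>V n. \<forall>v\<in>V N - V n. f u < f v))"

lemma prio: "inj_on prio (V N)" "\<And>n u v. n \<le> N \<Longrightarrow> u \<in> V n \<Longrightarrow> v \<in> V N \<Longrightarrow> v \<notin> V n \<Longrightarrow> prio u < prio v"
  using someI_ex[OF ex_priority] unfolding prio_def by auto

text \<open>Only meaningful if some vertex lies strictly above \<open>y\<close>.\<close>

definition tgt :: "'a \<Rightarrow> 'a" where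
  "tgt y = (ARG_MIN prio u. u \<in> V N \<and> y \<sqsubset> u)"

text \<open>Vertices missing in \<open>V n\<close> have larger priority than all vertices of
  \<open>V n\<close>, so none of them is the minimum once \<open>V n\<close> offers a
  candidate.\<close>

lemma tgt_props:
  assumes "n \<le> N" "u \<in> V n" "y \<sqsubset> u"
  shows "y \<sqsubset> tgt y" "tgt y \<in> V n" "prio (tgt y) \<le> prio u"
proof -
  have u: "u \<in> V N \<and> y \<sqsubset> u" using assms nest_le[of N n] by auto
  have 1: "tgt y \<in> V N \<and> y \<sqsubset> tgt y" unfolding tgt_def by (rule arg_min_natI[of "\<lambda>u. u \<in> V N \<and> y \<sqsubset> u", OF u])
  then show "y \<sqsubset> tgt y" by simp
  show 2: "prio (tgt y) \<le> prio u" unfolding tgt_def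
    by (rule arg_min_nat_le[of "\<lambda>u. u \<in> V N \<and> y \<sqsubset> u", OF u])
  show "tgt y \<in> V n" using prio(2)[OF assms(1,2), of "tgt y"] 1 2 by fastforce
qed

text \<open>Vertices above \<open>z\<close> are above \<open>y\<close>, and the target of
  \<open>y\<close> is itself still above \<open>z\<close>. Hence both minima have the same priority,
  and \<open>prio\<close> is injective.\<close>

lemma tgt_eq:
  assumes "n \<le> N" "u \<in> V n" "y \<sqsubset> u" "y \<sqsubseteq> z" "z \<sqsubset> tgt y"
  shows "tgt z = tgt y"
proof -
  have a: "tgt y \<in> V n" using tgt_props(2)[OF assms(1,2,3)] .
  have b: "z \<sqsubset> tgt z" "tgt z \<in> V n" "prio (tgt z) \<le> prio (tgt y)" using tgt_props[OF assms(1) a assms(5)] .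
  have "y \<sqsubset> tgt z" using le_lt_trans[OF assms(4) b(1)] .
  then have "prio (tgt y) \<le> prio (tgt z)" using tgt_props(3)[OF assms(1) b(2)] by simp
  then have "prio (tgt y) = prio (tgt z)" using b by simp
  then show ?thesis using a b(2) inj_onD[OF prio(1), of "tgt z" "tgt y"] nest_le[of N n] assms(1) by auto
qed

section \<open>Subcells and the distribution of weight\<close>

definition sub :: "nat \<Rightarrow> 'a \<Rightarrow> 'a set" where
  "sub n v = {y \<in> V (Suc n). pr n y = v}"

definition subpath :: "nat \<Rightarrow> 'a \<Rightarrow> 'a \<Rightarrow> 'a set" where
  "subpath n v x = {y \<in> sub n v. y \<sqsubset> x}"

definition inner :: "nat \<Rightarrow> 'a \<Rightarrow> bool" where
  "inner n v \<longleftrightarrow> (\<exists>u\<in>V n. v \<sqsubset> u)"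

text \<open>The guard matters: with no vertex of \<open>V n\<close> above \<open>v\<close>, the
  target may be a vertex of a finer level. In that case no direction is selected and all subcells
  receive the factor \<epsilon>.\<close>

definition mainpath :: "nat \<Rightarrow> 'a \<Rightarrow> 'a set" where
  "mainpath n v = (if inner n v then subpath n v (tgt v) else {})"

text \<open>Special subcells touch a vertex of the coarser net, from above or from below.\<close>

definition special :: "nat \<Rightarrow> 'a \<Rightarrow> bool" where
  "special n y \<longleftrightarrow> y \<in> V n \<or> (\<exists>c\<in>V n. consec (V (Suc n)) y c)"

definition good :: "nat \<Rightarrow> 'a \<Rightarrow> 'a set" where
  "good n v = {y \<in> mainpath n v. \<not> special n y}"

text \<open>The numerator is what remains after the special subcells on the main path have taken
  \<epsilon> each, so that the factors along the main path add up to 1.\<close>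

definition ratio :: "nat \<Rightarrow> 'a \<Rightarrow> real" where
  "ratio n y = (let v = pr n y in
     if y \<in> good n v then (1 - \<epsilon> * card (mainpath n v - good n v)) / card (good n v) else \<epsilon>)"

primrec w :: "nat \<Rightarrow> 'a \<Rightarrow> real" where
  "w 0 y = 1"
| "w (Suc n) y = ratio n y * w n (pr n y)"

lemma sub_props:
  assumes "n < N" "v \<in> V n"
  shows "sub n v \<subseteq> V (Suc n)" "finite (sub n v)" "card (sub n v) \<le> M" "v \<in> sub n v"
    "\<And>y. y \<in> sub n v \<Longrightarrow> v \<sqsubseteq> y" "sub n v \<subseteq> T"
proof -
  have n: "n \<le> N" "Suc n \<le> N" using assms by auto
  show s: "sub n v \<subseteq> V (Suc n)" by (auto simp: sub_def)
  then show f: "finite (sub n v)" using fin[OF n(2)] finite_subset by blast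
  show sT: "sub n v \<subseteq> T" using s VT[OF n(2)] by blast
  show "v \<in> sub n v" using assms nest[OF assms(1)] pr_id[OF n(1)] by (auto simp: sub_def)
  show le: "v \<sqsubseteq> y" if "y \<in> sub n v" for y
    using pr_le[OF n(1), of y] that sT by (auto simp: sub_def)
  have "sub n v \<subseteq> {y\<in>V (Suc n). d v y \<le> 3 * r n}"
    using pr_d[OF n(1)] s sT by (auto simp: sub_def)
  then have "card (sub n v) \<le> card {y\<in>V (Suc n). d v y \<le> 3 * r n}"
    using fin[OF n(2)] by (intro card_mono) auto
  then show "card (sub n v) \<le> M" using few_subcells[OF assms(1), of v] assms VT[OF n(1)] by auto
qed

lemma V_Suc_sub: "n < N \<Longrightarrow> V (Suc n) = (\<Union>v\<in>V n. sub n v)"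
  using pr_V[of n] VT[of "Suc n"] by (auto simp: sub_def)

text \<open>Otherwise \<open>u\<close> would be below \<open>y\<close> and hence below the vertex
  \<open>v\<close> whose cell contains \<open>y\<close>. In other words, an upward arc leaves the
  cell of \<open>v\<close> only at a vertex of \<open>V n\<close>.\<close>

lemma sub_lt:
  assumes "n < N" "y \<in> sub n v" "u \<in> V n" "v \<sqsubset> u" "u \<sqsubseteq> x" "y \<sqsubseteq> x"
  shows "y \<sqsubset> u"
proof (rule ccontr)
  assume "\<not> y \<sqsubset> u"
  then have "u \<sqsubseteq> y" using comparable assms(5,6) by blast
  then have "u \<sqsubseteq> pr n y" using pr_max[of n y u] assms le_T by auto
  then show False using assms lt_not_le by (auto simp: sub_def)
qed

lemma chain_card:
  assumes "n \<le> N" "a \<in> V n" "b \<in> V n" "a \<sqsubset> b"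
  shows "d a b \<le> 3 * r n * card {y\<in>V n. a \<sqsubseteq> y \<and> y \<sqsubset> b}"
  using assms(3,4)
proof (induction "card {y\<in>V n. a \<sqsubseteq> y \<and> y \<sqsubset> b}" arbitrary: b rule: less_induct)
  case less
  define C where "C b = {y\<in>V n. a \<sqsubseteq> y \<and> y \<sqsubset> b}" for b
  have aT: "a \<in> T" "b \<in> T" using assms less.prems VT[OF assms(1)] by auto
  have fC: "finite (C b)" for b using fin[OF assms(1)] by (simp add: C_def)
  have "a \<in> C b" using assms less.prems le_refl[OF aT(1)] by (simp add: C_def)
  moreover have "c \<sqsubseteq> b" if "c \<in> C b" for c using that lt_le by (simp add: C_def)
  ultimately obtain g where g: "g \<in> C b" "\<forall>c\<in>C b. c \<sqsubseteq> g"
    using finite_chain_greatest[of "C b" b] fC by blast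
  then have g': "g \<in> V n" "a \<sqsubseteq> g" "g \<sqsubset> b" by (auto simp: C_def)
  have "consec (V n) g b" unfolding consec_def
  proof (intro conjI ballI impI)
    fix z assume z: "z \<in> V n" "z \<sqsubset> b"
    show "\<not> g \<sqsubset> z"
    proof
      assume "g \<sqsubset> z"
      then have "z \<in> C b" using z le_trans[OF g'(2) lt_le] by (simp add: C_def)
      then show False using g(2) lt_not_le[OF \<open>g \<sqsubset> z\<close>] by blast
    qed
  qed (use g' less.prems in auto)
  then have gb: "d g b \<le> 3 * r n" using consec_gap[OF cov[OF assms(1)]] by blast
  have sub: "C g \<subseteq> C b" using lt_trans g' by (auto simp: C_def)
  have "g \<notin> C g" using lt_irrefl by (simp add: C_def)
  then have lt: "card (C g) + 1 \<le> card (C b)"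
    using sub g(1) fC by (metis Suc_eq_plus1 Suc_leI psubsetI psubset_card_mono)
  have "d a g \<le> 3 * r n * card (C g)"
  proof (cases "a = g")
    case True
    then show ?thesis using d_refl[OF aT(1)] r_pos[of n] by simp
  next
    case False
    then show ?thesis using less.hyps[of g] lt g' unfolding C_def lt_def by auto
  qed
  then have "d a b \<le> 3 * r n * card (C g) + 3 * r n"
    using d_tri[of a g b] gb aT g' VT[OF assms(1)] by fastforce
  also have "\<dots> = 3 * r n * (card (C g) + 1)" by (simp add: algebra_simps)
  also have "\<dots> \<le> 3 * r n * card (C b)" using lt r_pos[of n]
    by (intro mult_left_mono) (auto simp flip: of_nat_Suc)
  finally show ?case by (simp add: C_def)
qed

text \<open>All vertices of \<open>V (Suc n)\<close> from \<open>v\<close> up to the next vertex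
  \<open>c\<close> of \<open>V n\<close> towards \<open>x\<close> belong to the cell of
  \<open>v\<close>. They bridge a distance of at least \<open>r n\<close> with gaps of at most
  \<open>3 * \<delta> * r n\<close>, so the condition on \<delta> forces many of them.\<close>

lemma subpath_card:
  assumes "n < N" "v \<in> V n" "u \<in> V n" "v \<sqsubset> u" "u \<sqsubseteq> x"
  shows "m + 4 \<le> card (subpath n v x)"
proof -
  have n: "n \<le> N" "Suc n \<le> N" using assms by auto
  define C where "C = {c\<in>V n. v \<sqsubset> c \<and> c \<sqsubseteq> x}"
  have "finite C" "u \<in> C" using fin[OF n(1)] assms by (auto simp: C_def)
  moreover have "c \<sqsubseteq> x" if "c \<in> C" for c using that by (simp add: C_def)
  ultimately obtain c where c: "c \<in> C" "\<forall>e\<in>C. c \<sqsubseteq> e" using finite_chain_least[of C x] by blast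
  then have c': "c \<in> V n" "v \<sqsubset> c" "c \<sqsubseteq> x" by (auto simp: C_def)
  have cV: "v \<in> V (Suc n)" "c \<in> V (Suc n)" using c' assms nest[OF assms(1)] by auto
  define D where "D = {y\<in>V (Suc n). v \<sqsubseteq> y \<and> y \<sqsubset> c}"
  have DT: "D \<subseteq> T" using VT[OF n(2)] by (auto simp: D_def)
  have "D \<subseteq> subpath n v x"
  proof
    fix y assume y: "y \<in> D"
    have "pr n y = v"
    proof (rule pr_eqI[OF n(1) assms(2)])
      show "v \<sqsubseteq> y" using y by (simp add: D_def)
      fix e assume e: "e \<in> V n" "e \<sqsubseteq> y"
      have ec: "e \<sqsubset> c" using le_lt_trans[OF e(2)] y by (simp add: D_def)
      have "\<not> v \<sqsubset> e"
      proof
        assume "v \<sqsubset> e"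
        then have "c \<sqsubseteq> e" using c e ec le_trans[OF lt_le[OF ec] c'(3)] by (simp add: C_def)
        then show False using lt_not_le[OF ec] by simp
      qed
      then show "e \<sqsubseteq> v" using comparable[OF \<open>v \<sqsubseteq> y\<close> e(2)] by blast
    qed
    then show "y \<in> subpath n v x" using y lt_le_trans[OF _ c'(3)] by (auto simp: D_def subpath_def sub_def)
  qed
  then have DS: "card D \<le> card (subpath n v x)"
    using sub_props(2)[OF assms(1,2)] by (intro card_mono) (auto simp: subpath_def)
  have "r n \<le> d v c" using sep[OF n(1)] assms c' by blast
  also have "\<dots> \<le> 3 * r (Suc n) * card D" using chain_card[OF n(2) cV c'(2)] by (simp add: D_def)
  finally have "1 \<le> 3 * \<delta> * card D" using r_pos[of n] by (simp add: r_Suc)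
  moreover have "3 * \<delta> * card D < 3 * \<delta> * (m + 5)" if "card D < m + 4"
    using that \<delta>(1) by (intro mult_strict_left_mono) auto
  ultimately have "\<not> card D < m + 4" using \<delta>(2) by linarith
  then show ?thesis using DS by simp
qed

lemma mainpath_sub: "mainpath n v \<subseteq> sub n v"
  by (auto simp: mainpath_def subpath_def)

text \<open>Apart from \<open>v\<close>, a special subcell immediately precedes some
  \<open>c\<close> in \<open>V n\<close>, and this \<open>c\<close> is an immediate successor of
  \<open>v\<close> in \<open>V n\<close>; there are at most \<open>m\<close> of these. Since the
  vertices below \<open>c\<close> form a chain, only one of them precedes \<open>c\<close>
  immediately, so different special subcells have different \<open>c\<close>.\<close>

lemma special_card:
  assumes "n < N" "v \<in> V n"
  shows "card {y \<in> sub n v. special n y} \<le> m + 1"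
proof -
  have n: "n \<le> N" "Suc n \<le> N" using assms by auto
  note sp = sub_props[OF assms]
  define A where "A = {y \<in> sub n v. special n y} - {v}"
  have "\<exists>c\<in>V n. consec (V (Suc n)) y c \<and> d v c \<le> 3 * r n" if y: "y \<in> A" for y
  proof -
    have ys: "y \<in> sub n v" "special n y" "y \<noteq> v" "v \<sqsubset> y" using y sp(5) lt_def by (auto simp: A_def)
    have "y \<notin> V n" using ys pr_id[OF n(1)] by (auto simp: sub_def)
    then obtain c where c: "c \<in> V n" "consec (V (Suc n)) y c" using ys(2) by (auto simp: special_def)
    have yc: "y \<sqsubset> c" using c by (simp add: consec_def)
    have "consec (V n) v c" unfolding consec_def
    proof (intro conjI ballI impI notI)
      fix z assume z: "z \<in> V n" "z \<sqsubset> c" "v \<sqsubset> z"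
      have "y \<sqsubset> z" using sub_lt[OF assms(1) ys(1) z(1) z(3) lt_le[OF z(2)] lt_le[OF yc]] .
      then show False using c(2) z nest[OF assms(1)] by (auto simp: consec_def)
    qed (use assms c lt_trans[OF ys(4) yc] in auto)
    then show ?thesis using c consec_gap[OF cov[OF n(1)]] by blast
  qed
  then obtain c where c: "\<And>y. y \<in> A \<Longrightarrow> c y \<in> V n \<and> consec (V (Suc n)) y (c y) \<and> d v (c y) \<le> 3 * r n"
    by metis
  have AV: "A \<subseteq> V (Suc n)" using sp(1) by (auto simp: A_def)
  have "inj_on c A"
  proof (rule inj_onI, rule ccontr)
    fix y z assume yz: "y \<in> A" "z \<in> A" "c y = c z" "y \<noteq> z"
    then have "y \<sqsubset> c y" "z \<sqsubset> c y" using c[of y] c[of z] by (auto simp: consec_def)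
    moreover have "y \<sqsubset> z \<or> z \<sqsubset> y"
      using comparable[of y "c y" z] calculation lt_le yz(4) lt_def by metis
    ultimately show False using c[of y] c[of z] yz AV unfolding consec_def by auto
  qed
  moreover have "c ` A \<subseteq> {u\<in>V n. d v u \<le> 3 * r n}" using c by auto
  ultimately have "card A \<le> card {u\<in>V n. d v u \<le> 3 * r n}"
    using fin[OF n(1)] by (intro card_inj_on_le) auto
  also have "\<dots> \<le> m" using few_children[OF n(1)] assms VT[OF n(1)] by blast
  finally have "card A \<le> m" .
  have "{y \<in> sub n v. special n y} \<subseteq> insert v A" by (auto simp: A_def)
  then have "card {y \<in> sub n v. special n y} \<le> card (insert v A)"
    using sp(2) by (intro card_mono) (auto simp: A_def)
  also have "\<dots> \<le> Suc (card A)" by (rule card_insert_le_m1[of "Suc (card A)" A, simplified])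
  also have "\<dots> \<le> m + 1" using \<open>card A \<le> m\<close> by simp
  finally show ?thesis .
qed

lemma inner_tgt:
  assumes "n \<le> N" "inner n v"
  shows "tgt v \<in> V n" "v \<sqsubset> tgt v"
  using assms tgt_props(1,2)[OF assms(1)] unfolding inner_def by blast+

lemma mainpath_bounds:
  assumes "n < N" "v \<in> V n" "inner n v"
  shows "3 \<le> card (good n v)" "card (mainpath n v - good n v) \<le> m + 1" "card (good n v) \<le> M"
    "finite (mainpath n v)" "good n v \<subseteq> mainpath n v"
proof -
  note sp = sub_props[OF assms(1,2)]
  have n: "n \<le> N" using assms by simp
  have t: "tgt v \<in> V n" "v \<sqsubset> tgt v" using inner_tgt[OF n assms(3)] .
  show f: "finite (mainpath n v)" using sp(2) mainpath_sub finite_subset by blast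
  show g: "good n v \<subseteq> mainpath n v" by (auto simp: good_def)
  have "mainpath n v - good n v \<subseteq> {y \<in> sub n v. special n y}"
    using mainpath_sub by (auto simp: good_def)
  then have "card (mainpath n v - good n v) \<le> card {y \<in> sub n v. special n y}"
    using sp(2) by (intro card_mono) auto
  then show b: "card (mainpath n v - good n v) \<le> m + 1" using special_card[OF assms(1,2)] by simp
  have "m + 4 \<le> card (mainpath n v)"
    using subpath_card[OF assms(1,2) t le_refl] t(1) VT[OF n] assms(3) by (auto simp: mainpath_def)
  moreover have "card (mainpath n v) = card (good n v) + card (mainpath n v - good n v)"
    using f g by (metis card_Diff_subset card_mono finite_subset le_add_diff_inverse)
  ultimately show "3 \<le> card (good n v)" using b by simp
  have "card (good n v) \<le> card (sub n v)" using g mainpath_sub sp(2) by (intro card_mono) auto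
  then show "card (good n v) \<le> M" using sp(3) by simp
qed

lemma \<epsilon>_small: "\<epsilon> * M \<le> 1/20" "\<epsilon> * (m + 1) \<le> 1/20" "\<epsilon> \<le> 1/20"
proof -
  have "20 * (\<epsilon> * M) + 20 * (\<epsilon> * (m + 1)) \<le> 1" using \<epsilon>(2) by (simp add: algebra_simps)
  moreover have "0 \<le> \<epsilon> * M" "\<epsilon> \<le> \<epsilon> * (m + 1)" using \<epsilon>(1) by (auto simp: algebra_simps)
  ultimately show "\<epsilon> * M \<le> 1/20" "\<epsilon> * (m + 1) \<le> 1/20" "\<epsilon> \<le> 1/20" using \<epsilon>(1) by linarith+
qed

text \<open>At least three good subcells share the weight, which gives the upper bound 1/2. The
  special ones take at most 1/20 of it and at most \<open>M\<close> share the rest, which gives the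
  lower bound.\<close>

lemma good_ratio:
  assumes "n < N" "v \<in> V n" "y \<in> good n v"
  shows "ratio n y = (1 - \<epsilon> * card (mainpath n v - good n v)) / card (good n v)"
    "ratio n y \<le> 1 / card (good n v)" "\<epsilon> \<le> ratio n y" "ratio n y \<le> 1/2"
proof -
  have i: "inner n v" using assms(3) by (auto simp: good_def mainpath_def split: if_splits)
  note b = mainpath_bounds[OF assms(1,2) i]
  have "pr n y = v" using assms(3) b(5) mainpath_sub[of n v] by (auto simp: sub_def)
  then show e: "ratio n y = (1 - \<epsilon> * card (mainpath n v - good n v)) / card (good n v)"
    using assms(3) by (simp add: ratio_def)
  define k where "k = card (good n v)"
  define j where "j = card (mainpath n v - good n v)"
  have k: "3 \<le> real k" "real k \<le> M" and j: "real j \<le> m + 1" using b by (auto simp: k_def j_def)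
  have "0 \<le> \<epsilon> * j" using \<epsilon> by simp
  have ej: "\<epsilon> * j \<le> 1/20" using \<epsilon>_small(2) mult_left_mono[OF j, of \<epsilon>] \<epsilon>(1) by linarith
  have ek: "\<epsilon> * k \<le> 1/20" using \<epsilon>_small(1) mult_left_mono[OF k(2), of \<epsilon>] \<epsilon>(1) by linarith
  have e': "ratio n y = (1 - \<epsilon> * j) / k" using e by (simp add: k_def j_def)
  show "ratio n y \<le> 1 / card (good n v)" unfolding e' k_def[symmetric]
    using \<open>0 \<le> \<epsilon> * j\<close> by (intro divide_right_mono) auto
  show "\<epsilon> \<le> ratio n y" unfolding e' using k ej ek by (subst pos_le_divide_eq) auto
  show "ratio n y \<le> 1/2" unfolding e' using k \<open>0 \<le> \<epsilon> * j\<close> by (subst pos_divide_le_eq) auto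
qed

lemma ratio_not_good: "y \<notin> good n (pr n y) \<Longrightarrow> ratio n y = \<epsilon>"
  by (simp add: ratio_def)

lemma ratio_bounds:
  assumes "n < N" "y \<in> V (Suc n)"
  shows "\<epsilon> \<le> ratio n y" "ratio n y \<le> 1/2" "0 < ratio n y"
proof -
  have "pr n y \<in> V n" using pr_V[of n y] assms VT[of "Suc n"] by auto
  then have "\<epsilon> \<le> ratio n y \<and> ratio n y \<le> 1/2"
    using good_ratio(3,4)[OF assms(1)] ratio_not_good[of y n] \<epsilon>_small(3) \<epsilon>(1)
    by (cases "y \<in> good n (pr n y)") auto
  then show "\<epsilon> \<le> ratio n y" "ratio n y \<le> 1/2" "0 < ratio n y" using \<epsilon>(1) by auto
qed

lemma w_pos: "n \<le> N \<Longrightarrow> v \<in> V n \<Longrightarrow> 0 < w n v"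
proof (induction n arbitrary: v)
  case (Suc n)
  then have "pr n v \<in> V n" using pr_V[of n v] VT[of "Suc n"] by auto
  then show ?case using Suc ratio_bounds(3)[of n v] by simp
qed simp

lemma w_sub:
  assumes "n < N" "v \<in> V n" "y \<in> sub n v"
  shows "\<epsilon> * w n v \<le> w (Suc n) y" "w (Suc n) y \<le> w n v / 2" "w (Suc n) y = ratio n y * w n v"
proof -
  have y: "y \<in> V (Suc n)" "pr n y = v" using assms by (auto simp: sub_def)
  show e: "w (Suc n) y = ratio n y * w n v" using y by simp
  have "0 < w n v" using w_pos[of n v] assms by simp
  then show "\<epsilon> * w n v \<le> w (Suc n) y" "w (Suc n) y \<le> w n v / 2"
    unfolding e using ratio_bounds[OF assms(1) y(1)] by (auto simp: mult_right_mono)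
qed

lemma w_not_main:
  assumes "n < N" "v \<in> V n" "y \<in> sub n v" "y \<notin> good n v"
  shows "w (Suc n) y = \<epsilon> * w n v"
  using assms ratio_not_good[of y n] by (simp add: sub_def)

lemma sum_mainpath:
  assumes "n < N" "v \<in> V n" "inner n v"
  shows "(\<Sum>y\<in>mainpath n v. w (Suc n) y) = w n v"
proof -
  note b = mainpath_bounds[OF assms]
  have ms: "mainpath n v \<subseteq> sub n v" by (rule mainpath_sub)
  define j where "j = card (mainpath n v - good n v)"
  have "(\<Sum>y\<in>mainpath n v. w (Suc n) y) =
     (\<Sum>y\<in>mainpath n v - good n v. w (Suc n) y) + (\<Sum>y\<in>good n v. w (Suc n) y)"
    using sum.subset_diff[OF b(5,4)] by simp
  also have "(\<Sum>y\<in>mainpath n v - good n v. w (Suc n) y) = j * (\<epsilon> * w n v)"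
    using w_not_main[OF assms(1,2)] ms by (subst sum.cong[OF refl, of _ _ "\<lambda>_. \<epsilon> * w n v"]) (auto simp: j_def)
  also have "(\<Sum>y\<in>good n v. w (Suc n) y) = card (good n v) * ((1 - \<epsilon> * j) / card (good n v) * w n v)"
  proof -
    have "w (Suc n) y = (1 - \<epsilon> * j) / card (good n v) * w n v" if y: "y \<in> good n v" for y
      using w_sub(3)[OF assms(1,2), of y] good_ratio(1)[OF assms(1,2) y] y ms b(5)
      by (auto simp: j_def simp del: w.simps)
    then show ?thesis by (simp del: w.simps)
  qed
  also have "\<dots> = (1 - \<epsilon> * j) * w n v" using b(1) by simp
  finally show ?thesis by (simp add: algebra_simps)
qed

text \<open>Subcells of one cell have between \<epsilon> and 1/2 times its weight. If the parents
  differ, then \<open>b\<close> is itself a vertex of \<open>V n\<close>, the parents are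
  consecutive in \<open>V n\<close>, and both \<open>a\<close> and \<open>b\<close> are special.
  Both weights then carry exactly the factor \<epsilon>, so the comparison of the parents is
  inherited with the same constant on every level.\<close>

lemma w_consec:
  assumes "n \<le> N" "consec (V n) a b"
  shows "\<epsilon> * w n a \<le> w n b \<and> \<epsilon> * w n b \<le> w n a"
  using assms
proof (induction n arbitrary: a b)
  case 0
  then show ?case by (auto simp: consec_def V0 lt_def)
next
  case (Suc n)
  then have n: "n < N" "n \<le> N" by auto
  have ab: "a \<in> V (Suc n)" "b \<in> V (Suc n)" "a \<sqsubset> b" "a \<in> T" "b \<in> T"
    using Suc.prems VT[of "Suc n"] by (auto simp: consec_def)
  define u where "u = pr n a"
  define v where "v = pr n b"
  have uv: "u \<in> V n" "v \<in> V n" "u \<sqsubseteq> a" "v \<sqsubseteq> b" "a \<in> sub n u" "b \<in> sub n v"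
    using ab pr_V[OF n(2)] pr_le[OF n(2)] by (auto simp: u_def v_def sub_def)
  have pos: "0 < w n u" "0 < w n v" using w_pos n uv by auto
  note wa = w_sub[OF n(1) uv(1,5)] and wb = w_sub[OF n(1) uv(2,6)]
  show ?case
  proof (cases "u = v")
    case True
    have "\<epsilon> * w (Suc n) a \<le> \<epsilon> * w n u" "\<epsilon> * w (Suc n) b \<le> \<epsilon> * w n v"
      using wa wb pos \<epsilon>(1) by (auto intro!: mult_left_mono)
    then show ?thesis using wa(1) wb(1) unfolding True by linarith
  next
    case False
    have "u \<sqsubseteq> v" using pr_mono[OF n(2) lt_le[OF ab(3)]] by (simp add: u_def v_def)
    then have uv': "u \<sqsubset> v" using False lt_def by simp
    have av: "a \<sqsubset> v" using sub_lt[OF n(1) uv(5) uv(2) uv' uv(4) lt_le[OF ab(3)]] .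
    have "v \<in> V (Suc n)" using uv nest[OF n(1)] by auto
    then have "\<not> v \<sqsubset> b" using Suc.prems(2) av by (auto simp: consec_def)
    then have vb: "v = b" using uv(4) lt_def by simp
    have "\<not> u \<sqsubset> z" if z: "z \<in> V n" "z \<sqsubset> v" for z
    proof
      assume "u \<sqsubset> z"
      have "a \<sqsubset> z" using sub_lt[OF n(1) uv(5) z(1) \<open>u \<sqsubset> z\<close> _ lt_le[OF ab(3)]] lt_le[OF z(2)] vb by simp
      then show False using Suc.prems(2) z nest[OF n(1)] vb by (auto simp: consec_def)
    qed
    then have "consec (V n) u v" using uv uv' by (simp add: consec_def)
    then have IH: "\<epsilon> * w n u \<le> w n v" "\<epsilon> * w n v \<le> w n u" using Suc.IH n by auto
    have "special n a" "special n b" using Suc.prems(2) vb uv(2) by (auto simp: special_def)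
    then have "w (Suc n) a = \<epsilon> * w n u" "w (Suc n) b = \<epsilon> * w n v"
      using w_not_main[OF n(1)] uv by (auto simp: good_def)
    then show ?thesis using IH \<epsilon>(1) by (simp add: mult.left_commute mult_left_mono)
  qed
qed

section \<open>The height that the arc from the root to a point collects inside one cell\<close>

definition mu :: "nat \<Rightarrow> 'a \<Rightarrow> 'a \<Rightarrow> real" where
  "mu n v x = (\<Sum>z | z \<in> V N \<and> pr n z = v \<and> z \<sqsubset> x. w N z)"

lemma fin_VN: "finite {z. z \<in> V N \<and> P z}" using fin[of N] by simp

lemma w_nonneg: "n \<le> N \<Longrightarrow> v \<in> V n \<Longrightarrow> 0 \<le> w n v" using w_pos less_imp_le by blast

lemma mu_nonneg: "0 \<le> mu n v x"
  unfolding mu_def by (rule sum_nonneg) (simp add: w_nonneg)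

lemma mu_top: "v \<in> V N \<Longrightarrow> mu N v x = (if v \<sqsubset> x then w N v else 0)"
proof -
  assume v: "v \<in> V N"
  have "{z. z \<in> V N \<and> pr N z = v \<and> z \<sqsubset> x} = (if v \<sqsubset> x then {v} else {})"
    using pr_id[of N] v by auto
  then show ?thesis by (simp add: mu_def)
qed

lemma mu_split:
  assumes "n < N" "v \<in> V n"
  shows "mu n v x = (\<Sum>y\<in>subpath n v x. mu (Suc n) y x)"
proof -
  have n: "n \<le> N" "Suc n \<le> N" using assms by auto
  have f: "finite (subpath n v x)" using sub_props(2)[OF assms] by (simp add: subpath_def)
  have eq: "{z. z \<in> V N \<and> pr n z = v \<and> z \<sqsubset> x} =
      (\<Union>y\<in>subpath n v x. {z. z \<in> V N \<and> pr (Suc n) z = y \<and> z \<sqsubset> x})" (is "?L = ?R")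
  proof (rule set_eqI)
    fix z
    show "z \<in> ?L \<longleftrightarrow> z \<in> ?R"
    proof (cases "z \<in> V N \<and> z \<sqsubset> x")
      case True
      then have zT: "z \<in> T" using VT by auto
      have "pr (Suc n) z \<sqsubset> x" using le_lt_trans[OF pr_le[OF n(2) zT]] True by simp
      moreover have "pr n (pr (Suc n) z) = pr n z" using pr_pr[OF _ n(2) zT, of n] by simp
      ultimately show ?thesis using pr_V[OF n(2) zT] True by (auto simp: subpath_def sub_def)
    qed auto
  qed
  show ?thesis unfolding mu_def eq
    by (rule sum.UNION_disjoint) (use f fin_VN in auto)
qed

text \<open>An arc leaving the cell towards its target meets exactly the subcells on the main path.
  Each of them has the same target by \<open>tgt_eq\<close>, so the induction applies to it with the
  same \<open>u\<close>, and the weights on the main path add up to \<open>w n v\<close>.\<close>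

lemma mu_main:
  assumes "n \<le> N" "v \<in> V n" "u \<in> V n" "v \<sqsubset> u" "u \<sqsubseteq> x" "u \<sqsubseteq> tgt v"
  shows "mu n v x = w n v"
  using assms
proof (induction "N - n" arbitrary: n v u)
  case 0
  then show ?case using mu_top[of v x] lt_le_trans by auto
next
  case (Suc k)
  then have n: "n < N" "Suc n \<le> N" by auto
  have i: "inner n v" using Suc.prems by (auto simp: inner_def)
  have lt: "y \<sqsubset> u" if "y \<in> sub n v" "y \<sqsubset> x \<or> y \<sqsubset> tgt v" for y
    using sub_lt[OF n(1) that(1) Suc.prems(3,4)] that(2) lt_le Suc.prems(5,6) by blast
  have eq: "subpath n v x = mainpath n v"
    using i lt lt_le_trans[OF _ Suc.prems(5)] lt_le_trans[OF _ Suc.prems(6)]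
    by (auto simp: subpath_def mainpath_def)
  have "mu (Suc n) y x = w (Suc n) y" if y: "y \<in> mainpath n v" for y
  proof (rule Suc.hyps(1))
    have ys: "y \<in> sub n v" "y \<sqsubset> tgt v" using y i by (auto simp: mainpath_def subpath_def)
    show "k = N - Suc n" using Suc.hyps by simp
    show "Suc n \<le> N" "y \<in> V (Suc n)" "u \<in> V (Suc n)" "y \<sqsubset> u" "u \<sqsubseteq> x"
      using n ys lt Suc.prems nest[OF n(1)] by (auto simp: sub_def)
    have "v \<sqsubseteq> y" using sub_props(5)[OF n(1) Suc.prems(2) ys(1)] .
    then have "tgt y = tgt v" using tgt_eq[OF Suc.prems(1,3,4) _ ys(2)] by simp
    then show "u \<sqsubseteq> tgt y" using Suc.prems by simp
  qed
  then show ?case using mu_split[OF n(1) Suc.prems(2)] eq sum_mainpath[OF n(1) Suc.prems(2) i] by simp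
qed

text \<open>The constant 5 closes the induction. Subcells off the main path contribute at most
  \<open>5 * (\<epsilon> * M) * w n v\<close>, which is at most \<open>w n v\<close>. Of those on
  it, all but the last are crossed in their main direction and contribute at most
  \<open>w n v\<close> together; the last contributes at most
  \<open>5 * (w n v / 2)\<close>.\<close>

lemma mu_le:
  assumes "n \<le> N" "v \<in> V n"
  shows "mu n v x \<le> 5 * w n v"
  using assms
proof (induction "N - n" arbitrary: n v)
  case 0
  then have n: "n = N" by simp
  then show ?case using mu_top[of v x] w_nonneg[of n v] 0 by auto
next
  case (Suc k)
  then have n: "n < N" "Suc n \<le> N" by auto
  note sp = sub_props[OF n(1) Suc.prems(2)]
  have wv: "0 \<le> w n v" using w_nonneg Suc.prems by simp
  define S where "S = subpath n v x"
  have fS: "finite S" "S \<subseteq> sub n v" "S \<subseteq> V (Suc n)" using sp by (auto simp: S_def subpath_def)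
  have IH: "mu (Suc n) y x \<le> 5 * w (Suc n) y" if "y \<in> S" for y
    by (rule Suc.hyps(1)) (use Suc.hyps n that fS in auto)
  define P where "P = S \<inter> mainpath n v"
  have fP: "finite P" using fS by (simp add: P_def)
  have "(\<Sum>y\<in>S - P. mu (Suc n) y x) \<le> (\<Sum>y\<in>S - P. 5 * (\<epsilon> * w n v))"
  proof (rule sum_mono)
    fix y assume y: "y \<in> S - P"
    then have "w (Suc n) y = \<epsilon> * w n v"
      using w_not_main[OF n(1) Suc.prems(2)] fS(2) by (auto simp: P_def good_def)
    then show "mu (Suc n) y x \<le> 5 * (\<epsilon> * w n v)" using IH[of y] y by simp
  qed
  also have "\<dots> = card (S - P) * (5 * (\<epsilon> * w n v))" by simp
  also have "\<dots> \<le> M * (5 * (\<epsilon> * w n v))"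
  proof (rule mult_right_mono)
    have "card (S - P) \<le> card (sub n v)" using fS sp(2) by (intro card_mono) auto
    then show "real (card (S - P)) \<le> M" using sp(3) by simp
  qed (use wv \<epsilon>(1) in simp)
  also have "\<dots> = 5 * (\<epsilon> * M) * w n v" by simp
  also have "\<dots> \<le> w n v" using \<epsilon>_small(1) wv by (intro mult_left_le_one_le) (auto simp: less_imp_le[OF \<epsilon>(1)])
  finally have 1: "(\<Sum>y\<in>S - P. mu (Suc n) y x) \<le> w n v" .
  have 2: "(\<Sum>y\<in>P. mu (Suc n) y x) \<le> 4 * w n v"
  proof (cases "P = {}")
    case True
    then show ?thesis using wv by simp
  next
    case False
    then have i: "inner n v" by (auto simp: P_def mainpath_def split: if_splits)
    have t: "tgt v \<in> V n" "v \<sqsubset> tgt v" using inner_tgt[OF Suc.prems(1) i] .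
    have "c \<sqsubseteq> x" if "c \<in> P" for c using that lt_le by (auto simp: P_def S_def subpath_def)
    \<comment> \<open>The last subcell of the main path that is met below \<open>x\<close>. It lies
      on the way to the common target, so it can play the role of \<open>u\<close> in
      \<open>mu_main\<close> for all earlier ones.\<close>
    then obtain g where g: "g \<in> P" "\<forall>c\<in>P. c \<sqsubseteq> g" using finite_chain_greatest[OF fP False] by blast
    have g': "g \<in> S" "g \<sqsubseteq> x" "g \<sqsubset> tgt v" "g \<in> V (Suc n)"
      using g(1) i lt_le fS(3) by (auto simp: P_def S_def mainpath_def subpath_def)
    have main: "mu (Suc n) y x = w (Suc n) y" if y: "y \<in> P - {g}" for y
    proof (rule mu_main[OF n(2) _ g'(4) _ g'(2)])
      have ys: "y \<in> sub n v" "y \<sqsubset> tgt v" using y i by (auto simp: P_def mainpath_def subpath_def)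
      show "y \<in> V (Suc n)" using ys by (simp add: sub_def)
      show "y \<sqsubset> g" using y g by (simp add: lt_def)
      have "tgt y = tgt v" using tgt_eq[OF Suc.prems(1) t sp(5)[OF ys(1)] ys(2)] .
      then show "g \<sqsubseteq> tgt y" using lt_le[OF g'(3)] by simp
    qed
    have "(\<Sum>y\<in>P. mu (Suc n) y x) = mu (Suc n) g x + (\<Sum>y\<in>P - {g}. mu (Suc n) y x)"
      using fP g(1) by (simp add: sum.remove)
    also have "(\<Sum>y\<in>P - {g}. mu (Suc n) y x) = (\<Sum>y\<in>P - {g}. w (Suc n) y)"
      using main by (simp del: w.simps)
    also have "\<dots> \<le> (\<Sum>y\<in>mainpath n v. w (Suc n) y)"
      using mainpath_bounds(4)[OF n(1) Suc.prems(2) i] w_nonneg[OF n(2)] subsetD[OF mainpath_sub[of n v]] subsetD[OF sp(1)]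
      by (intro sum_mono2) (auto simp: P_def simp del: w.simps)
    also have "\<dots> = w n v" using sum_mainpath[OF n(1) Suc.prems(2) i] .
    also have "mu (Suc n) g x \<le> 5 * w (Suc n) g" using IH g' by simp
    also have "\<dots> \<le> 5 * (w n v / 2)" using w_sub(2)[OF n(1) Suc.prems(2), of g] g'(1) fS(2) by auto
    finally show ?thesis using wv by simp
  qed
  have "mu n v x = (\<Sum>y\<in>S. mu (Suc n) y x)" using mu_split[OF n(1) Suc.prems(2)] by (simp add: S_def)
  also have "\<dots> = (\<Sum>y\<in>S - P. mu (Suc n) y x) + (\<Sum>y\<in>P. mu (Suc n) y x)"
    using fS by (intro sum.subset_diff) (auto simp: P_def)
  finally show ?case using 1 2 by simp
qed

text \<open>It suffices that one subcell \<open>y\<close> on the way is left in its own main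
  direction: by \<open>mu_main\<close> it contributes its full weight, at least
  \<open>\<epsilon> * w n v\<close>. Otherwise send every \<open>y\<close> met to
  \<open>c y\<close>, the first vertex of \<open>V n\<close> above \<open>v\<close> towards
  \<open>tgt y\<close>. If \<open>y\<close> and a later \<open>z\<close> had the same image, then
  \<open>z\<close> would be below both \<open>x\<close> and \<open>tgt y\<close>, contrary to the
  assumption. So the map is injective, but there are at least \<open>m + 4\<close> subcells and at
  most \<open>m\<close> images.\<close>

lemma mu_ge:
  assumes "n \<le> N" "v \<in> V n" "u \<in> V n" "v \<sqsubset> u" "u \<sqsubseteq> x"
  shows "\<epsilon> * w n v \<le> mu n v x"
proof (cases "n = N")
  case True
  then have "mu n v x = w n v" using mu_top[of v x] assms lt_le_trans[OF assms(4,5)] by simp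
  then show ?thesis using w_nonneg[OF assms(1,2)] \<epsilon>_small(3) \<epsilon>(1) by (simp add: mult_left_le_one_le)
next
  case False
  then have n: "n < N" "Suc n \<le> N" using assms by auto
  note sp = sub_props[OF n(1) assms(2)]
  define S where "S = subpath n v x"
  have fS: "finite S" "S \<subseteq> sub n v" "S \<subseteq> V (Suc n)" "\<And>y. y \<in> S \<Longrightarrow> y \<sqsubset> x"
    using sp by (auto simp: S_def subpath_def)
  have cS: "m + 4 \<le> card S" using subpath_card[OF n(1) assms(2-5)] by (simp add: S_def)
  have "\<exists>y\<in>S. \<exists>u1\<in>V (Suc n). y \<sqsubset> u1 \<and> u1 \<sqsubseteq> x \<and> u1 \<sqsubseteq> tgt y"
  proof (rule ccontr)
    assume not: "\<not> ?thesis"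
    have "\<exists>c\<in>V n. y \<sqsubset> c \<and> c \<sqsubseteq> tgt y \<and> d v c \<le> 3 * r n" if y: "y \<in> S" for y
    proof -
      have ys: "y \<in> sub n v" using y fS by auto
      have "y \<sqsubset> u" using sub_lt[OF n(1) ys assms(3-5)] lt_le[OF fS(4)[OF y]] by simp
      then have t: "y \<sqsubset> tgt y" "tgt y \<in> V n" using tgt_props[OF assms(1,3)] by auto
      have vy: "v \<sqsubseteq> y" using sp(5)[OF ys] .
      define C where "C = {c\<in>V n. v \<sqsubset> c \<and> c \<sqsubseteq> tgt y}"
      have "finite C" "tgt y \<in> C" using fin[OF assms(1)] t le_lt_trans[OF vy] VT[OF assms(1)] le_refl
        by (auto simp: C_def)
      moreover have "c \<sqsubseteq> tgt y" if "c \<in> C" for c using that by (simp add: C_def)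
      ultimately obtain c where c: "c \<in> C" "\<forall>e\<in>C. c \<sqsubseteq> e" using finite_chain_least[of C "tgt y"] by blast
      then have c': "c \<in> V n" "v \<sqsubset> c" "c \<sqsubseteq> tgt y" by (auto simp: C_def)
      have "consec (V n) v c" unfolding consec_def
      proof (intro conjI ballI impI notI)
        fix z assume z: "z \<in> V n" "z \<sqsubset> c" "v \<sqsubset> z"
        then have "c \<sqsubseteq> z" using c(2) le_trans[OF lt_le[OF z(2)] c'(3)] by (simp add: C_def)
        then show False using lt_not_le[OF z(2)] by simp
      qed (use assms c' in auto)
      then have "d v c \<le> 3 * r n" using consec_gap[OF cov[OF assms(1)]] by simp
      moreover have "y \<sqsubset> c" using sub_lt[OF n(1) ys c' lt_le[OF t(1)]] .
      ultimately show ?thesis using c' by blast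
    qed
    then obtain c where c: "\<And>y. y \<in> S \<Longrightarrow> c y \<in> V n \<and> y \<sqsubset> c y \<and> c y \<sqsubseteq> tgt y \<and> d v (c y) \<le> 3 * r n"
      by metis
    have no: "\<not> y \<sqsubset> z" if "y \<in> S" "z \<in> S" "c y = c z" for y z
    proof
      assume yz: "y \<sqsubset> z"
      have "z \<sqsubseteq> tgt y" using c[OF that(1)] c[OF that(2)] that(3) le_trans[of z "c z"] lt_le by simp
      then show False using not yz that fS(3) lt_le[OF fS(4)] by blast
    qed
    have "inj_on c S"
    proof (rule inj_onI, rule ccontr)
      fix y z assume yz: "y \<in> S" "z \<in> S" "c y = c z" "y \<noteq> z"
      then have "y \<sqsubset> z \<or> z \<sqsubset> y"
        using comparable[OF lt_le[OF fS(4)] lt_le[OF fS(4)], of y z] lt_def by metis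
      then show False using no yz by metis
    qed
    moreover have "c ` S \<subseteq> {e\<in>V n. d v e \<le> 3 * r n}" using c by auto
    ultimately have "card S \<le> card {e\<in>V n. d v e \<le> 3 * r n}"
      using fin[OF assms(1)] by (intro card_inj_on_le) auto
    also have "\<dots> \<le> m" using few_children[OF assms(1)] assms(2) VT[OF assms(1)] by blast
    finally show False using cS by simp
  qed
  then obtain y u1 where y: "y \<in> S" "u1 \<in> V (Suc n)" "y \<sqsubset> u1" "u1 \<sqsubseteq> x" "u1 \<sqsubseteq> tgt y" by blast
  have "\<epsilon> * w n v \<le> w (Suc n) y" using w_sub(1)[OF n(1) assms(2)] y fS by blast
  also have "\<dots> = mu (Suc n) y x" using mu_main[OF n(2) _ y(2-5)] y(1) fS(3) by auto
  also have "\<dots> \<le> (\<Sum>y\<in>S. mu (Suc n) y x)" using fS(1) y(1) mu_nonneg by (intro member_le_sum) auto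
  also have "\<dots> = mu n v x" using mu_split[OF n(1) assms(2)] by (simp add: S_def)
  finally show ?thesis .
qed

section \<open>Height increments compared with cell weights\<close>

definition h :: "'a \<Rightarrow> real" where
  "h x = (\<Sum>z | z \<in> V N \<and> z \<sqsubset> x. w N z)"

definition W :: "nat \<Rightarrow> 'a \<Rightarrow> real" where
  "W n x = w n (pr n x)"

definition rho :: "'a \<Rightarrow> 'a \<Rightarrow> real" where
  "rho x y = h x + h y - 2 * h (mt x y)"

lemma h_diff:
  assumes "a \<sqsubseteq> x"
  shows "h x - h a = (\<Sum>z | z \<in> V N \<and> a \<sqsubseteq> z \<and> z \<sqsubset> x. w N z)"
proof -
  have "{z. z \<in> V N \<and> z \<sqsubset> x} = {z. z \<in> V N \<and> z \<sqsubset> a} \<union> {z. z \<in> V N \<and> a \<sqsubseteq> z \<and> z \<sqsubset> x}"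
    using comparable[OF _ assms] lt_le lt_le_trans[OF _ assms] by blast
  then have "h x = (\<Sum>z\<in>{z. z \<in> V N \<and> z \<sqsubset> a} \<union> {z. z \<in> V N \<and> a \<sqsubseteq> z \<and> z \<sqsubset> x}. w N z)"
    by (simp add: h_def)
  also have "\<dots> = h a + (\<Sum>z | z \<in> V N \<and> a \<sqsubseteq> z \<and> z \<sqsubset> x. w N z)"
    unfolding h_def using fin_VN lt_not_le by (intro sum.union_disjoint) auto
  finally show ?thesis by simp
qed

lemma h_mono: "a \<sqsubseteq> x \<Longrightarrow> h a \<le> h x"
  using h_diff[of a x] sum_nonneg[of "{z. z \<in> V N \<and> a \<sqsubseteq> z \<and> z \<sqsubset> x}" "w N"] w_nonneg[of N] by auto

lemma h_root: "h p = 0"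
proof -
  have "{z. z \<in> V N \<and> z \<sqsubset> p} = {}" using root(2) VT[of N] lt_not_le by blast
  then show ?thesis unfolding h_def by (simp only: sum.empty)
qed

lemma h_diff_le:
  assumes "n \<le> N" "a \<sqsubseteq> x" "finite C" "\<And>z. z \<in> V N \<Longrightarrow> a \<sqsubseteq> z \<Longrightarrow> z \<sqsubset> x \<Longrightarrow> pr n z \<in> C"
  shows "h x - h a \<le> (\<Sum>c\<in>C. mu n c x)"
proof -
  have "h x - h a \<le> (\<Sum>z\<in>(\<Union>c\<in>C. {z. z \<in> V N \<and> pr n z = c \<and> z \<sqsubset> x}). w N z)"
    unfolding h_diff[OF assms(2)]
    by (rule sum_mono2) (use assms(3,4) fin_VN w_nonneg[of N] in auto)
  also have "\<dots> = (\<Sum>c\<in>C. mu n c x)" unfolding mu_def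
    by (rule sum.UNION_disjoint) (use assms(3) fin_VN in auto)
  finally show ?thesis .
qed

lemma mu_le_h:
  assumes "n \<le> N" "a \<sqsubseteq> v" "a \<sqsubseteq> x"
  shows "mu n v x \<le> h x - h a"
  unfolding h_diff[OF assms(3)] mu_def
proof (rule sum_mono2)
  show "{z. z \<in> V N \<and> pr n z = v \<and> z \<sqsubset> x} \<subseteq> {z. z \<in> V N \<and> a \<sqsubseteq> z \<and> z \<sqsubset> x}"
    using pr_le[OF assms(1)] VT[of N] le_trans[OF assms(2)] by auto
qed (use fin_VN w_nonneg[of N] in auto)

lemma h_same_cell:
  assumes "n \<le> N" "a \<sqsubseteq> x" "pr n a = pr n x"
  shows "h x - h a \<le> 5 * W n x"
proof -
  have T: "x \<in> T" using le_T assms by blast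
  have "h x - h a \<le> (\<Sum>c\<in>{pr n x}. mu n c x)"
  proof (rule h_diff_le[OF assms(1,2)])
    fix z assume "z \<in> V N" "a \<sqsubseteq> z" "z \<sqsubset> x"
    then show "pr n z \<in> {pr n x}"
      using pr_mono[OF assms(1), of a z] pr_mono[OF assms(1), of z x] lt_le le_antisym assms(3) by auto
  qed simp
  then show ?thesis using mu_le[OF assms(1) pr_V[OF assms(1) T], of x] by (simp add: W_def)
qed

text \<open>A vertex of \<open>V n\<close> that is above \<open>pr n a\<close> and below
  \<open>x\<close> lies above \<open>a\<close>. If it were not \<open>pr n x\<close>, it would be at
  least \<open>r n\<close> below it, which does not fit between \<open>a\<close> and
  \<open>x\<close>. So at most one cell boundary is crossed.\<close>

lemma pr_near:
  assumes "n \<le> N" "a \<sqsubseteq> x" "d a x < r n"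
  shows "pr n a = pr n x \<or> consec (V n) (pr n a) (pr n x)"
    and "\<And>z. a \<sqsubseteq> z \<Longrightarrow> z \<sqsubseteq> x \<Longrightarrow> pr n z \<in> {pr n a, pr n x}"
proof -
  have T: "a \<in> T" "x \<in> T" using le_T assms by blast+
  have beyond: "a \<sqsubset> c" if "c \<in> V n" "pr n a \<sqsubset> c" "c \<sqsubseteq> x" for c
    using comparable[OF assms(2) that(3)] pr_max[OF assms(1) T(1) that(1)] lt_not_le[OF that(2)] by blast
  have top: "c = pr n x" if c: "c \<in> V n" "pr n a \<sqsubset> c" "c \<sqsubseteq> x" for c
  proof (rule ccontr)
    assume "c \<noteq> pr n x"
    then have lt: "c \<sqsubset> pr n x" using pr_max[OF assms(1) T(2) c(1,3)] lt_def by blast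
    have "r n \<le> d c (pr n x)" using sep[OF assms(1) c(1) pr_V[OF assms(1) T(2)] lt] .
    also have "\<dots> \<le> d c x" using d_mono1[OF lt_le[OF lt] pr_le[OF assms(1) T(2)]] .
    also have "\<dots> \<le> d a x" using d_mono2[OF lt_le[OF beyond[OF c]] c(3)] .
    finally show False using assms(3) by simp
  qed
  have le: "pr n a \<sqsubseteq> pr n x" using pr_mono[OF assms(1,2)] .
  show "pr n a = pr n x \<or> consec (V n) (pr n a) (pr n x)"
  proof (cases "pr n a = pr n x")
    case False
    then have "pr n a \<sqsubset> pr n x" using le lt_def by simp
    moreover have "\<not> pr n a \<sqsubset> z" if z: "z \<in> V n" "z \<sqsubset> pr n x" for z
      using top[OF z(1) _ le_trans[OF lt_le[OF z(2)] pr_le[OF assms(1) T(2)]]] lt_irrefl z(2) by auto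
    ultimately show ?thesis using pr_V[OF assms(1)] T by (simp add: consec_def)
  qed simp
  fix z assume z: "a \<sqsubseteq> z" "z \<sqsubseteq> x"
  have zT: "z \<in> T" using z le_T by blast
  have "pr n a \<sqsubseteq> pr n z" using pr_mono[OF assms(1) z(1)] .
  then show "pr n z \<in> {pr n a, pr n x}"
    using top[OF pr_V[OF assms(1) zT] _ le_trans[OF pr_le[OF assms(1) zT] z(2)]] lt_def
    by (cases "pr n a = pr n z") auto
qed

lemma W_near:
  assumes "n \<le> N" "a \<sqsubseteq> x" "d a x < r n"
  shows "\<epsilon> * W n a \<le> W n x" "\<epsilon> * W n x \<le> W n a"
proof -
  have T: "a \<in> T" "x \<in> T" using le_T assms by blast+
  have "0 \<le> W n x" using w_nonneg[OF assms(1) pr_V[OF assms(1) T(2)]] by (simp add: W_def)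
  then have "\<epsilon> * W n x \<le> W n x" using \<epsilon>_small(3) \<epsilon>(1) by (simp add: mult_left_le_one_le)
  then show "\<epsilon> * W n a \<le> W n x" "\<epsilon> * W n x \<le> W n a"
    using pr_near(1)[OF assms] w_consec[OF assms(1)] unfolding W_def by auto
qed

lemma W_pos: "n \<le> N \<Longrightarrow> x \<in> T \<Longrightarrow> 0 < W n x"
  using w_pos pr_V by (simp add: W_def)

lemma h_upper:
  assumes "n \<le> N" "a \<sqsubseteq> x" "d a x < r n"
  shows "h x - h a \<le> 10 / \<epsilon> * W n a"
proof -
  have T: "a \<in> T" "x \<in> T" using le_T assms by blast+
  have W: "0 < W n a" "0 < W n x" using W_pos assms T by auto
  have "h x - h a \<le> (\<Sum>c\<in>{pr n a, pr n x}. mu n c x)"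
    by (rule h_diff_le[OF assms(1,2)]) (use pr_near(2)[OF assms] lt_le in auto)
  also have "\<dots> \<le> mu n (pr n a) x + mu n (pr n x) x"
    using mu_nonneg[of n "pr n x" x] by (cases "pr n a = pr n x") auto
  also have "\<dots> \<le> 5 * W n a + 5 * W n x"
    using mu_le[OF assms(1) pr_V[OF assms(1) T(1)], of x] mu_le[OF assms(1) pr_V[OF assms(1) T(2)], of x]
    by (simp add: W_def)
  also have "\<dots> \<le> 5 / \<epsilon> * W n a + 5 / \<epsilon> * W n a"
  proof (rule add_mono)
    show "5 * W n x \<le> 5 / \<epsilon> * W n a" using W_near(2)[OF assms] \<epsilon>(1) by (simp add: field_simps)
    have "W n a * \<epsilon> \<le> W n a * 1" using W \<epsilon>_small(3) by (intro mult_left_mono) auto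
    then show "5 * W n a \<le> 5 / \<epsilon> * W n a" using \<epsilon>(1) by (simp add: field_simps)
  qed
  finally show ?thesis by simp
qed

text \<open>The first vertex \<open>b\<close> of \<open>V n\<close> above \<open>pr n a\<close>
  towards \<open>x\<close> is at most \<open>3 * r n\<close> away from \<open>a\<close>. More than
  \<open>3 * r n\<close> remain, so \<open>b\<close> differs from \<open>pr n x\<close> and its cell
  is crossed from bottom to top. One factor \<epsilon> comes from \<open>mu_ge\<close>, the other
  from comparing the consecutive cells of \<open>a\<close> and \<open>b\<close>.\<close>

lemma h_lower:
  assumes "n \<le> N" "a \<sqsubseteq> x" "6 * r n < d a x"
  shows "\<epsilon>^2 * W n a \<le> h x - h a"
proof -
  have T: "a \<in> T" "x \<in> T" using le_T assms by blast+
  note c = cov[OF assms(1)]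
  define C where "C = {v\<in>V n. pr n a \<sqsubset> v \<and> v \<sqsubseteq> x}"
  have "C \<noteq> {}"
  proof
    assume "C = {}"
    then have "\<not> pr n a \<sqsubset> pr n x" using pr_V[OF assms(1) T(2)] pr_le[OF assms(1) T(2)] by (auto simp: C_def)
    then have "pr n a = pr n x" using pr_mono[OF assms(1,2)] lt_def by auto
    then have "d a x \<le> d (pr n x) x" using d_mono2[OF pr_le[OF assms(1) T(1)] assms(2)] by simp
    then show False using pr_d[OF assms(1) T(2)] r_pos[of n] assms(3) by simp
  qed
  moreover have "finite C" using fin[OF assms(1)] by (simp add: C_def)
  moreover have "c \<sqsubseteq> x" if "c \<in> C" for c using that by (simp add: C_def)
  ultimately obtain b where b: "b \<in> C" "\<forall>e\<in>C. b \<sqsubseteq> e" using finite_chain_least[of C x] by blast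
  then have b': "b \<in> V n" "pr n a \<sqsubset> b" "b \<sqsubseteq> x" by (auto simp: C_def)
  have bT: "b \<in> T" using b' le_T by blast
  have co: "consec (V n) (pr n a) b" unfolding consec_def
  proof (intro conjI ballI impI notI)
    fix z assume z: "z \<in> V n" "z \<sqsubset> b" "pr n a \<sqsubset> z"
    then have "b \<sqsubseteq> z" using b(2) le_trans[OF lt_le[OF z(2)] b'(3)] by (simp add: C_def)
    then show False using lt_not_le[OF z(2)] by simp
  qed (use b' pr_V[OF assms(1) T(1)] in auto)
  have ab: "a \<sqsubset> b"
    using comparable[OF assms(2) b'(3)] pr_max[OF assms(1) T(1) b'(1)] lt_not_le[OF b'(2)] by blast
  have "d a b \<le> d (pr n a) b" using d_mono2[OF pr_le[OF assms(1) T(1)] lt_le[OF ab]] .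
  also have "\<dots> \<le> 3 * r n" using consec_gap[OF c co] .
  finally have "3 * r n < d b x" using d_tri[OF T(1) bT T(2)] assms(3) by simp
  then have "b \<noteq> pr n x" using pr_d[OF assms(1) T(2)] by auto
  then have "b \<sqsubset> pr n x" using pr_max[OF assms(1) T(2) b'(1,3)] lt_def by simp
  then have "\<epsilon> * w n b \<le> mu n b x"
    using mu_ge[OF assms(1) b'(1) pr_V[OF assms(1) T(2)] _ pr_le[OF assms(1) T(2)]] by simp
  also have "\<dots> \<le> h x - h a" using mu_le_h[OF assms(1) lt_le[OF ab] assms(2)] .
  finally have "\<epsilon> * w n b \<le> h x - h a" .
  moreover have "\<epsilon> * (\<epsilon> * W n a) \<le> \<epsilon> * w n b"
    using w_consec[OF assms(1) co] \<epsilon>(1) by (simp add: W_def mult_left_mono)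
  ultimately show ?thesis by (simp add: power2_eq_square mult.assoc)
qed

lemma W_Suc:
  assumes "n < N" "x \<in> T"
  shows "\<epsilon> * W n x \<le> W (Suc n) x" "W (Suc n) x \<le> W n x / 2"
proof -
  have "pr (Suc n) x \<in> sub n (pr n x)" using pr_V[of "Suc n" x] pr_pr[of n "Suc n" x] assms by (simp add: sub_def)
  then show "\<epsilon> * W n x \<le> W (Suc n) x" "W (Suc n) x \<le> W n x / 2"
    using w_sub(1,2)[OF assms(1) pr_V[of n x]] assms unfolding W_def by auto
qed

lemma h_bounds: "x \<in> T \<Longrightarrow> 0 \<le> h x \<and> h x \<le> 5"
  using h_mono[OF root(2), of x] h_root h_same_cell[OF _ root(2), of 0 x] pr_V[of 0 x] pr_V[of 0 p] V0 root(1)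
  by (auto simp: W_def)

lemma rho_same_cell:
  assumes "n \<le> N" "x \<in> T" "y \<in> T" "pr n x = pr n y"
  shows "rho x y \<le> 10 * W n x"
proof -
  have m: "mt x y \<sqsubseteq> x" "mt x y \<sqsubseteq> y" "mt x y \<in> T" using mt_le mt_T assms by auto
  have "pr n x \<sqsubseteq> mt x y"
    using mt_greatest pr_le[OF assms(1,2)] pr_le[OF assms(1,3)] assms(4) by simp
  then have "pr n (mt x y) = pr n x"
    using pr_max[OF assms(1) m(3) pr_V[OF assms(1,2)]] pr_mono[OF assms(1) m(1)] le_antisym by blast
  then show ?thesis using h_same_cell[OF assms(1) m(1)] h_same_cell[OF assms(1) m(2)] assms(4)
    by (simp add: rho_def W_def)
qed

lemma mt_dist:
  assumes "x \<in> T" "y \<in> T"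
  shows "d (mt x y) x \<le> d x y" "d (mt x y) y \<le> d x y" "d x y \<le> d (mt x y) x + d (mt x y) y"
proof -
  note m = mt_T[OF assms]
  show 1: "d (mt x y) x \<le> d x y" using d_mt[OF assms] d_sym[OF m assms(1)] by simp
  show 2: "d (mt x y) y \<le> d x y"
    using d_mt[OF assms(2,1)] d_sym[OF m assms(2)] mt_commute[OF assms] d_sym[OF assms] by simp
  show "d x y \<le> d (mt x y) x + d (mt x y) y"
    using d_tri[OF assms(1) m assms(2)] d_sym[OF m assms(1)] by simp
qed

text \<open>Each of the two legs costs \<open>10 / \<epsilon>\<close> times the weight at the meet;
  passing from the meet to \<open>x\<close> costs another factor
  \<open>1 / \<epsilon>\<close>.\<close>

lemma rho_upper:
  assumes "n \<le> N" "x \<in> T" "y \<in> T" "d x y < r n"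
  shows "rho x y \<le> 20 / \<epsilon>^2 * W n x"
proof -
  have m: "mt x y \<sqsubseteq> x" "mt x y \<sqsubseteq> y" using mt_le assms by auto
  note md = mt_dist[OF assms(2,3)]
  have "h x - h (mt x y) \<le> 10 / \<epsilon> * W n (mt x y)" "h y - h (mt x y) \<le> 10 / \<epsilon> * W n (mt x y)"
    using h_upper[OF assms(1) m(1)] h_upper[OF assms(1) m(2)] md assms(4) by auto
  then have "rho x y \<le> 20 / \<epsilon> * W n (mt x y)" by (simp add: rho_def)
  also have "\<dots> \<le> 20 / \<epsilon> * (W n x / \<epsilon>)"
    using W_near(1)[OF assms(1) m(1)] md assms(4) \<epsilon>(1)
    by (intro mult_left_mono) (auto simp: field_simps)
  finally show ?thesis by (simp add: power2_eq_square)
qed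

text \<open>One leg from the meet has at least half the length, which exceeds
  \<open>6 * r (Suc (Suc n))\<close> because 15 \<delta> \<le> 1. Of the five factors \<epsilon>,
  two come from \<open>h_lower\<close> at level n + 2, two from descending two levels, and one from
  exchanging the meet for \<open>x\<close>.\<close>

lemma rho_lower:
  assumes "Suc (Suc n) \<le> N" "x \<in> T" "y \<in> T" "r (Suc n) \<le> d x y" "d x y < r n"
  shows "\<epsilon>^5 * W n x \<le> rho x y"
proof -
  have m: "mt x y \<sqsubseteq> x" "mt x y \<sqsubseteq> y" "mt x y \<in> T" using mt_le mt_T assms by auto
  note md = mt_dist[OF assms(2,3)]
  have n: "n \<le> N" using assms by simp
  have "d x y \<le> 2 * d (mt x y) x \<or> d x y \<le> 2 * d (mt x y) y" using md(3) by linarith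
  then obtain z where z: "z = x \<or> z = y" "d x y \<le> 2 * d (mt x y) z" by blast
  have "3 * \<delta> * 5 \<le> 3 * \<delta> * (m + 5)" using \<delta>(1) by (intro mult_left_mono) auto
  then have "\<delta> * 15 \<le> 1" using \<delta>(2) by simp
  then have "(\<delta> * 15) * r (Suc n) \<le> r (Suc n)" using r_pos[of "Suc n"] \<delta>(1)
    by (intro mult_left_le_one_le) auto
  then have "15 * r (Suc (Suc n)) \<le> r (Suc n)" by (simp only: r_Suc[of "Suc n"] mult.assoc mult.commute[of \<delta>] mult.left_commute)
  then have "6 * r (Suc (Suc n)) < d (mt x y) z" using z(2) assms(4) r_pos[of "Suc (Suc n)"] by simp
  then have lo: "\<epsilon>^2 * W (Suc (Suc n)) (mt x y) \<le> h z - h (mt x y)"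
    using h_lower[OF assms(1), of "mt x y" z] m z(1) by auto
  have "h z - h (mt x y) \<le> rho x y" using h_mono[OF m(1)] h_mono[OF m(2)] z(1) by (auto simp: rho_def)
  with lo have 1: "\<epsilon>^2 * W (Suc (Suc n)) (mt x y) \<le> rho x y" by simp
  have e: "0 \<le> \<epsilon>" using \<epsilon>(1) by simp
  have "\<epsilon>^5 * W n x = \<epsilon>^4 * (\<epsilon> * W n x)" by (simp add: eval_nat_numeral)
  also have "\<dots> \<le> \<epsilon>^4 * W n (mt x y)"
    using W_near(2)[OF n m(1)] md assms(5) e by (intro mult_left_mono) auto
  also have "\<dots> = \<epsilon>^2 * (\<epsilon> * (\<epsilon> * W n (mt x y)))" by (simp add: eval_nat_numeral)
  also have "\<dots> \<le> \<epsilon>^2 * (\<epsilon> * W (Suc n) (mt x y))"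
    using W_Suc(1)[of n "mt x y"] assms(1) m(3) e by (intro mult_left_mono) auto
  also have "\<dots> \<le> \<epsilon>^2 * W (Suc (Suc n)) (mt x y)"
    using W_Suc(1)[of "Suc n" "mt x y"] assms(1) m(3) e by (intro mult_left_mono) auto
  finally show ?thesis using 1 by simp
qed

section \<open>Number of cells and sums of powers of their weights\<close>

lemma w_le: "n \<le> N \<Longrightarrow> v \<in> V n \<Longrightarrow> w n v \<le> (1/2)^n"
proof (induction n arbitrary: v)
  case (Suc n)
  then have v: "v \<in> T" using VT[of "Suc n"] by auto
  then have p: "pr n v \<in> V n" using pr_V[of n v] Suc by simp
  have "v \<in> sub n (pr n v)" using Suc.prems by (simp add: sub_def)
  then have "w (Suc n) v \<le> w n (pr n v) / 2" using w_sub(2)[OF _ p] Suc.prems by simp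
  also have "\<dots> \<le> (1/2)^n / 2" using Suc.IH[OF _ p] Suc.prems by simp
  finally show ?case by simp
qed simp

lemma card_V: "n \<le> N \<Longrightarrow> card (V n) \<le> M ^ n"
proof (induction n)
  case 0
  then show ?case by (simp add: V0)
next
  case (Suc n)
  then have n: "n < N" "n \<le> N" by auto
  have "card (V (Suc n)) \<le> (\<Sum>v\<in>V n. card (sub n v))"
    unfolding V_Suc_sub[OF n(1)] by (rule card_UN_le[OF fin[OF n(2)]])
  also have "\<dots> \<le> (\<Sum>v\<in>V n. M)" using sub_props(3)[OF n(1)] by (rule sum_mono)
  also have "\<dots> \<le> M ^ n * M" using Suc by simp
  finally show ?case by (simp add: mult.commute)
qed

text \<open>If there are \<open>k\<close> good subcells, each has at most the weight
  \<open>w n v / k\<close>, so their powers sum to at most \<open>k powr (1 - \<alpha>)\<close>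
  times that of the cell; \<alpha> > 1 makes this decrease in \<open>k\<close>, and
  \<open>k \<ge> 3\<close>. Each of the at most \<open>M\<close> remaining subcells contributes
  \<open>\<epsilon> powr \<alpha>\<close> times that of the cell.\<close>

lemma sum_w_powr:
  assumes \<alpha>: "1 < \<alpha>" and \<kappa>: "2 powr (1 - \<alpha>) + M * \<epsilon> powr \<alpha> \<le> \<kappa>"
  shows "n \<le> N \<Longrightarrow> (\<Sum>v\<in>V n. w n v powr \<alpha>) \<le> \<kappa> ^ n"
proof (induction n)
  case 0
  then show ?case by (simp add: V0)
next
  case (Suc n)
  then have n: "n < N" "n \<le> N" by auto
  have cell: "(\<Sum>y\<in>sub n v. w (Suc n) y powr \<alpha>) \<le> \<kappa> * w n v powr \<alpha>" if v: "v \<in> V n" for v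
  proof -
    note sp = sub_props[OF n(1) v]
    have wv: "0 < w n v" using w_pos n v by simp
    have gs: "good n v \<subseteq> sub n v" using mainpath_sub by (auto simp: good_def)
    have fg: "finite (good n v)" using gs sp(2) finite_subset by blast
    have g: "(\<Sum>y\<in>good n v. w (Suc n) y powr \<alpha>) \<le> 2 powr (1 - \<alpha>) * w n v powr \<alpha>"
    proof (cases "good n v = {}")
      case False
      define k where "k = real (card (good n v))"
      have i: "inner n v" using False by (auto simp: good_def mainpath_def split: if_splits)
      have k: "3 \<le> k" using mainpath_bounds(1)[OF n(1) v i] by (simp add: k_def)
      have "(\<Sum>y\<in>good n v. w (Suc n) y powr \<alpha>) \<le> (\<Sum>y\<in>good n v. (1 / k * w n v) powr \<alpha>)"
      proof (rule sum_mono)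
        fix y assume y: "y \<in> good n v"
        then have "w (Suc n) y = ratio n y * w n v" using w_sub(3)[OF n(1) v] gs by blast
        also have "\<dots> \<le> 1 / k * w n v" using good_ratio(2)[OF n(1) v y] wv unfolding k_def by (intro mult_right_mono) auto
        finally show "w (Suc n) y powr \<alpha> \<le> (1 / k * w n v) powr \<alpha>"
          using w_nonneg[of "Suc n" y] n y gs sp(1) \<alpha> by (intro powr_mono2) (auto simp del: w.simps)
      qed
      also have "\<dots> = k * (1 / k) powr \<alpha> * w n v powr \<alpha>" using k wv by (subst powr_mult) (auto simp: k_def)
      also have "k * (1 / k) powr \<alpha> = k powr (1 - \<alpha>)"
        using k by (simp add: powr_diff powr_divide)
      also have "k powr (1 - \<alpha>) * w n v powr \<alpha> \<le> 2 powr (1 - \<alpha>) * w n v powr \<alpha>"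
        using k \<alpha> by (intro mult_right_mono powr_mono2') auto
      finally show ?thesis .
    qed simp
    have "(\<Sum>y\<in>sub n v - good n v. w (Suc n) y powr \<alpha>) = (\<Sum>y\<in>sub n v - good n v. (\<epsilon> * w n v) powr \<alpha>)"
      using w_not_main[OF n(1) v] by (intro sum.cong) (auto simp del: w.simps)
    also have "\<dots> = card (sub n v - good n v) * (\<epsilon> powr \<alpha> * w n v powr \<alpha>)"
      using wv \<epsilon>(1) by (simp add: powr_mult)
    also have "\<dots> \<le> M * (\<epsilon> powr \<alpha> * w n v powr \<alpha>)"
    proof (rule mult_right_mono)
      have "card (sub n v - good n v) \<le> card (sub n v)" using sp(2) by (intro card_mono) auto
      then show "real (card (sub n v - good n v)) \<le> M" using sp(3) by simp
    qed simp
    finally have "(\<Sum>y\<in>sub n v. w (Suc n) y powr \<alpha>) \<le> (2 powr (1 - \<alpha>) + M * \<epsilon> powr \<alpha>) * w n v powr \<alpha>"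
      using g sum.subset_diff[OF gs sp(2), of "\<lambda>y. w (Suc n) y powr \<alpha>"] by (simp add: algebra_simps)
    also have "\<dots> \<le> \<kappa> * w n v powr \<alpha>" using \<kappa> by (intro mult_right_mono) auto
    finally show ?thesis .
  qed
  have \<kappa>0: "0 \<le> \<kappa>"
  proof -
    have "0 \<le> 2 powr (1 - \<alpha>) + M * \<epsilon> powr \<alpha>" by simp
    then show ?thesis using \<kappa> by linarith
  qed
  have "(\<Sum>y\<in>V (Suc n). w (Suc n) y powr \<alpha>) = (\<Sum>v\<in>V n. \<Sum>y\<in>sub n v. w (Suc n) y powr \<alpha>)"
    unfolding V_Suc_sub[OF n(1)]
    by (rule sum.UNION_disjoint) (use fin[OF n(2)] sub_props(2)[OF n(1)] in \<open>auto simp: sub_def\<close>)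
  also have "\<dots> \<le> (\<Sum>v\<in>V n. \<kappa> * w n v powr \<alpha>)" using cell by (rule sum_mono)
  also have "\<dots> = \<kappa> * (\<Sum>v\<in>V n. w n v powr \<alpha>)" by (simp add: sum_distrib_left)
  also have "\<dots> \<le> \<kappa> * \<kappa> ^ n" using Suc.IH n \<kappa>0 by (intro mult_left_mono) auto
  finally show ?case by simp
qed

end

section \<open>Heights with controlled increments\<close>

context rooted_tree begin

definition hdist :: "('a \<Rightarrow> real) \<Rightarrow> 'a \<Rightarrow> 'a \<Rightarrow> real" where
  "hdist h x y = h x + h y - 2 * h (mt x y)"

definition height_fun :: "('a \<Rightarrow> real) \<Rightarrow> bool" where
  "height_fun h \<longleftrightarrow> (\<forall>a x. a \<sqsubseteq> x \<longrightarrow> h a \<le> h x)"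

lemma mt_self: "x \<in> T \<Longrightarrow> mt x x = x"
  using mt_le[of x x] mt_greatest[of x x x] le_refl le_antisym by blast

lemma hdist_self: "x \<in> T \<Longrightarrow> hdist h x x = 0"
  by (simp add: hdist_def mt_self)

lemma hdist_commute: "x \<in> T \<Longrightarrow> y \<in> T \<Longrightarrow> hdist h x y = hdist h y x"
  using mt_commute[of x y] by (simp add: hdist_def)

lemma hdist_nonneg: "height_fun h \<Longrightarrow> x \<in> T \<Longrightarrow> y \<in> T \<Longrightarrow> 0 \<le> hdist h x y"
  using mt_le[of x y] unfolding hdist_def height_fun_def by (smt (verit, best))

text \<open>The two meets with the middle point are comparable, and the lower one lies below the third meet.\<close>

lemma hdist_triangle:
  assumes "height_fun h" "x \<in> T" "y \<in> T" "z \<in> T"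
  shows "hdist h x z \<le> hdist h x y + hdist h y z"
proof -
  note mono = assms(1)[unfolded height_fun_def, rule_format]
  have le: "mt x y \<sqsubseteq> x" "mt x y \<sqsubseteq> y" "mt y z \<sqsubseteq> y" "mt y z \<sqsubseteq> z" using mt_le assms by auto
  have "h (mt x y) + h (mt y z) \<le> h y + h (mt x z)"
  proof (cases "mt x y \<sqsubseteq> mt y z")
    case True
    then have "mt x y \<sqsubseteq> mt x z" using le mt_greatest le_trans by blast
    then show ?thesis using mono[OF le(3)] mono[of "mt x y" "mt x z"] by simp
  next
    case False
    then have "mt y z \<sqsubseteq> mt x y" using le_linear le by blast
    then have "mt y z \<sqsubseteq> mt x z" using le mt_greatest le_trans by blast
    then show ?thesis using mono[OF le(2)] mono[of "mt y z" "mt x z"] by simp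
  qed
  then show ?thesis by (simp add: hdist_def)
qed

text \<open>On the leg from the meet to \<open>a\<close>, the meet of \<open>a\<close> and
  \<open>b\<close> is \<open>b\<close>, and \<open>b\<close> has the same meet with \<open>c\<close>
  as \<open>a\<close> has; the heights cancel.\<close>

lemma hdist_additive:
  assumes "a \<in> T" "c \<in> T" "mt a c \<sqsubseteq> b" "b \<sqsubseteq> a"
  shows "hdist h a c = hdist h a b + hdist h b c"
proof -
  have bT: "b \<in> T" using assms le_T by blast
  have 1: "mt a b = b"
    using mt_le[OF assms(1) bT] mt_greatest[OF assms(4) le_refl[OF bT]] le_antisym by blast
  have "mt a c \<sqsubseteq> mt b c" using assms mt_greatest mt_le[OF assms(1,2)] by blast
  moreover have "mt b c \<sqsubseteq> mt a c"
    using mt_greatest[of "mt b c" a c] mt_le[OF bT assms(2)] le_trans[OF _ assms(4)] by blast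
  ultimately have 2: "mt b c = mt a c" using le_antisym by blast
  show ?thesis by (simp add: hdist_def 1 2)
qed

text \<open>\<open>L\<close> selects the available levels: those up to \<open>N\<close> for a finite chain of nets, all of them in the limit.\<close>

definition tree_weights ::
  "(nat \<Rightarrow> bool) \<Rightarrow> real \<Rightarrow> real \<Rightarrow> real \<Rightarrow> ('a \<Rightarrow> real) \<Rightarrow> (nat \<Rightarrow> 'a \<Rightarrow> real) \<Rightarrow> bool" where
  "tree_weights L R \<delta> \<epsilon> h W \<longleftrightarrow>
     height_fun h \<and> (\<forall>x\<in>T. 0 \<le> h x \<and> h x \<le> 5) \<and>
     (\<forall>x\<in>T. W 0 x = 1) \<and>
     (\<forall>n. L (Suc n) \<longrightarrow> (\<forall>x\<in>T. \<epsilon> * W n x \<le> W (Suc n) x \<and> W (Suc n) x \<le> W n x / 2)) \<and>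
     (\<forall>n. L n \<longrightarrow> (\<forall>x\<in>T. \<forall>y\<in>T. d x y < R * \<delta> ^ n \<longrightarrow> hdist h x y \<le> 20 / \<epsilon>^2 * W n x)) \<and>
     (\<forall>n. L (Suc (Suc n)) \<longrightarrow> (\<forall>x\<in>T. \<forall>y\<in>T. R * \<delta> ^ Suc n \<le> d x y \<and> d x y < R * \<delta> ^ n \<longrightarrow> \<epsilon>^5 * W n x \<le> hdist h x y))"

text \<open>The cells depend on the chain of nets and are therefore quantified; only the bounds
  \<open>M\<close> and \<kappa> are uniform. Cells appear as the fibres of a map to an index
  set.\<close>

definition cells :: "('a \<Rightarrow> real) \<Rightarrow> real \<Rightarrow> nat \<Rightarrow> real \<Rightarrow> nat \<Rightarrow> bool" where
  "cells h \<alpha> M \<kappa> n \<longleftrightarrow> (\<exists>(C::'a set) \<pi> \<omega>. finite C \<and> card C \<le> M ^ n \<and> (\<forall>x\<in>T. \<pi> x \<in> C) \<and>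
     (\<forall>c\<in>C. 0 \<le> \<omega> c \<and> \<omega> c \<le> (1/2) ^ n) \<and> (\<Sum>c\<in>C. \<omega> c powr \<alpha>) \<le> \<kappa> ^ n \<and>
     (\<forall>x\<in>T. \<forall>y\<in>T. \<pi> x = \<pi> y \<longrightarrow> hdist h x y \<le> 10 * \<omega> (\<pi> x)))"

lemma finite_level_weights:
  assumes R: "0 < R" "\<And>x y. x \<in> T \<Longrightarrow> y \<in> T \<Longrightarrow> d x y < R" and \<alpha>: "1 < \<alpha>"
  obtains \<delta> \<epsilon> \<kappa> :: real and M :: nat where "0 < \<delta>" "\<delta> < 1" "0 < \<epsilon>" "\<epsilon> < 1" "0 < \<kappa>" "\<kappa> < 1" "0 < M"
    "\<And>N. \<exists>h W. tree_weights (\<lambda>n. n \<le> N) R \<delta> \<epsilon> h W \<and> (\<forall>n\<le>N. cells h \<alpha> M \<kappa> n)"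
proof -
  obtain m :: nat where m: "\<And>r V x. r > 0 \<Longrightarrow> is_net r V \<Longrightarrow> x \<in> T \<Longrightarrow> card {v\<in>V. d x v \<le> 3 * r} \<le> m"
    using net_count[of 3] by blast
  define \<delta> :: real where "\<delta> = 1 / (3 * (m + 5))"
  have \<delta>: "0 < \<delta>" "\<delta> \<le> 1/3" "\<delta> < 1" "3 * \<delta> * (m + 5) \<le> 1" by (auto simp: \<delta>_def field_simps)
  \<comment> \<open>The radius \<open>3 * r n\<close> of a cell is \<open>3 / \<delta>\<close> times
    the scale of its subcells.\<close>
  obtain M0 :: nat where M0: "\<And>r V x. r > 0 \<Longrightarrow> is_net r V \<Longrightarrow> x \<in> T \<Longrightarrow> card {v\<in>V. d x v \<le> 3 / \<delta> * r} \<le> M0"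
    using net_count[of "3 / \<delta>"] by blast
  define M where "M = Suc M0"
  have q: "0 < 1 - 2 powr (1 - \<alpha>)" using \<alpha> by (simp add: powr_less_one)
  \<comment> \<open>The first entry is the smallness that the weights require. The second makes
    \<open>M * \<epsilon> powr \<alpha>\<close> at most half of the gap
    \<open>1 - 2 powr (1 - \<alpha>)\<close>, so that \<kappa> < 1.\<close>
  define \<epsilon> where "\<epsilon> = min (1 / (20 * (real M + real m + 1))) ((1 - 2 powr (1 - \<alpha>)) / (2 * M))"
  have \<epsilon>: "0 < \<epsilon>" "20 * \<epsilon> * (M + m + 1) \<le> 1" "M * \<epsilon> \<le> (1 - 2 powr (1 - \<alpha>)) / 2" "\<epsilon> < 1"
  proof -
    have D: "0 < 20 * (real M + real m + 1)" by simp
    show "0 < \<epsilon>" using q D by (auto simp: \<epsilon>_def M_def)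
    have "\<epsilon> \<le> 1 / (20 * (real M + real m + 1))" by (simp add: \<epsilon>_def)
    then have *: "\<epsilon> * (20 * (real M + real m + 1)) \<le> 1" using D by (simp add: pos_le_divide_eq)
    then show "20 * \<epsilon> * (M + m + 1) \<le> 1" by (simp add: algebra_simps)
    have "\<epsilon> * 20 \<le> \<epsilon> * (20 * (real M + real m + 1))" using \<open>0 < \<epsilon>\<close> by (intro mult_left_mono) auto
    then show "\<epsilon> < 1" using * by simp
    have "\<epsilon> \<le> (1 - 2 powr (1 - \<alpha>)) / (2 * M)" by (simp add: \<epsilon>_def)
    then have "\<epsilon> * (2 * M) \<le> 1 - 2 powr (1 - \<alpha>)" by (subst (asm) pos_le_divide_eq) (auto simp: M_def)
    then show "M * \<epsilon> \<le> (1 - 2 powr (1 - \<alpha>)) / 2" by (simp add: mult.commute)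
  qed
  define \<kappa> where "\<kappa> = 2 powr (1 - \<alpha>) + M * \<epsilon> powr \<alpha>"
  have "\<epsilon> powr \<alpha> \<le> \<epsilon> powr 1" using \<epsilon> \<alpha> by (intro powr_mono') auto
  then have "M * \<epsilon> powr \<alpha> \<le> M * \<epsilon>" using \<epsilon>(1) by (intro mult_left_mono) auto
  then have \<kappa>1: "\<kappa> < 1" using \<epsilon>(3) q by (simp add: \<kappa>_def)
  have \<kappa>0: "0 < \<kappa>" unfolding \<kappa>_def by (intro add_pos_nonneg) auto
  show ?thesis
  proof (rule that[OF \<delta>(1,3) \<epsilon>(1,4) \<kappa>0 \<kappa>1, of M])
    show "0 < M" by (simp add: M_def)
    fix N
    define r where "r n = R * \<delta> ^ n" for n
    obtain V where V: "\<forall>n\<le>N. is_net (r n) (V n)" "\<forall>n<N. V n \<subseteq> V (Suc n)"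
      using nested_nets[OF \<delta>(1,2) R(1), of N] unfolding r_def by blast
    \<comment> \<open>Since \<open>R\<close> exceeds all distances, no vertex is high at scale
      \<open>R\<close>, and only the root survives.\<close>
    have V0: "V 0 = {p}"
    proof -
      have n0: "is_net R (V 0)" using V(1) by (auto simp: r_def)
      have "v = p" if v: "v \<in> V 0" for v
      proof (rule ccontr)
        assume "v \<noteq> p"
        then have "high R v" using is_netD(6)[OF n0 v] by simp
        then obtain z where "v \<sqsubseteq> z" "R \<le> d v z" by (auto simp: high_def)
        then show False using R(2)[of v z] le_T[of v z] by simp
      qed
      then show ?thesis using is_netD(2)[OF n0] by blast
    qed
    interpret nn: nested_nets T le mt p d V N r \<delta> m M \<epsilon>
    proof
      show "0 < r n" "r (Suc n) = \<delta> * r n" for n using R \<delta> by (auto simp: r_def)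
      show "0 < \<delta>" "3 * \<delta> * (m + 5) \<le> 1" "0 < \<epsilon>" "20 * \<epsilon> * (M + m + 1) \<le> 1" using \<delta> \<epsilon> by auto
      show "is_net (r n) (V n)" if "n \<le> N" for n using V that by blast
      show "V n \<subseteq> V (Suc n)" if "n < N" for n using V that by blast
      show "V 0 = {p}" by (rule V0)
      show "card {v\<in>V n. d x v \<le> 3 * r n} \<le> m" if "n \<le> N" "x \<in> T" for n x
        by (rule m) (use that V R \<delta> in \<open>auto simp: r_def\<close>)
      show "card {v\<in>V (Suc n). d x v \<le> 3 * r n} \<le> M" if "n < N" "x \<in> T" for n x
      proof -
        have "3 * r n = 3 / \<delta> * r (Suc n)" using \<delta> by (simp add: r_def)
        moreover have "card {v\<in>V (Suc n). d x v \<le> 3 / \<delta> * r (Suc n)} \<le> M0"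
        proof (rule M0)
          show "is_net (r (Suc n)) (V (Suc n))" using V(1) that by simp
        qed (use that R \<delta> in \<open>auto simp: r_def\<close>)
        ultimately show ?thesis by (simp add: M_def)
      qed
    qed
    have rho: "nn.rho = hdist nn.h" by (intro ext) (simp add: nn.rho_def hdist_def)
    have "tree_weights (\<lambda>n. n \<le> N) R \<delta> \<epsilon> nn.h nn.W"
      unfolding tree_weights_def
    proof (intro conjI allI ballI impI)
      show "height_fun nn.h" using nn.h_mono by (simp add: height_fun_def)
      show "0 \<le> nn.h x" "nn.h x \<le> 5" if "x \<in> T" for x using nn.h_bounds that by auto
      show "nn.W 0 x = 1" for x by (simp add: nn.W_def)
      show "\<epsilon> * nn.W n x \<le> nn.W (Suc n) x" "nn.W (Suc n) x \<le> nn.W n x / 2" if "Suc n \<le> N" "x \<in> T" for n x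
        using nn.W_Suc[of n x] that by auto
      show "hdist nn.h x y \<le> 20 / \<epsilon>^2 * nn.W n x"
        if "n \<le> N" "x \<in> T" "y \<in> T" "d x y < R * \<delta> ^ n" for n x y
        using nn.rho_upper[OF that(1-3)] that(4) unfolding rho r_def by simp
      show "\<epsilon>^5 * nn.W n x \<le> hdist nn.h x y"
        if "Suc (Suc n) \<le> N" "x \<in> T" "y \<in> T" "R * \<delta> ^ Suc n \<le> d x y \<and> d x y < R * \<delta> ^ n" for n x y
        using nn.rho_lower[OF that(1-3)] that(4) unfolding rho r_def by blast
    qed
    moreover have "cells nn.h \<alpha> M \<kappa> n" if n: "n \<le> N" for n
      unfolding cells_def
    proof (intro exI conjI ballI impI)
      show "finite (V n)" "card (V n) \<le> M ^ n" using nn.fin nn.card_V n by auto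
      show "nn.pr n x \<in> V n" if "x \<in> T" for x using nn.pr_V n that by blast
      show "0 \<le> nn.w n c" "nn.w n c \<le> (1/2) ^ n" if "c \<in> V n" for c
        using nn.w_nonneg nn.w_le n that by auto
      show "(\<Sum>c\<in>V n. nn.w n c powr \<alpha>) \<le> \<kappa> ^ n"
        by (rule nn.sum_w_powr[OF \<alpha> _ n]) (simp add: \<kappa>_def)
      show "hdist nn.h x y \<le> 10 * nn.w n (nn.pr n x)" if "x \<in> T" "y \<in> T" "nn.pr n x = nn.pr n y" for x y
        using nn.rho_same_cell[OF n that] by (simp add: rho nn.W_def)
    qed
    ultimately show "\<exists>h W. tree_weights (\<lambda>n. n \<le> N) R \<delta> \<epsilon> h W \<and> (\<forall>n\<le>N. cells h \<alpha> M \<kappa> n)" by blast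
  qed
qed

end

section \<open>Passage to the limit over finite chains of nets\<close>

definition small_cover :: "'a set \<Rightarrow> ('a \<Rightarrow> 'a \<Rightarrow> real) \<Rightarrow> real \<Rightarrow> real \<Rightarrow> nat \<Rightarrow> bool" where
  "small_cover T \<rho> \<alpha> s n \<longleftrightarrow> (\<exists>(C::nat set) E b. finite C \<and> T \<subseteq> (\<Union>c\<in>C. E c) \<and>
     (\<forall>c\<in>C. E c \<subseteq> T \<and> 0 < b c \<and> b c \<le> 11 * (1/2) ^ n \<and> (\<forall>x\<in>E c. \<forall>y\<in>E c. \<rho> x y \<le> b c)) \<and>
     (\<Sum>c\<in>C. b c powr \<alpha>) \<le> s)"

text \<open>The definition uses numbers as indices so that it does not depend on the type of the
  cells; here an arbitrary finite index set is renumbered. The bound 11 leaves room for a cell of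
  diameter 10 and an error of 1, in units of \<open>(1/2) ^ n\<close>.\<close>

lemma small_coverI:
  fixes C :: "'c set"
  assumes "finite C" "T \<subseteq> (\<Union>c\<in>C. E c)"
    and E: "\<And>c. c \<in> C \<Longrightarrow> E c \<subseteq> T" "\<And>c x y. c \<in> C \<Longrightarrow> x \<in> E c \<Longrightarrow> y \<in> E c \<Longrightarrow> \<rho> x y \<le> b c"
    and b: "\<And>c. c \<in> C \<Longrightarrow> 0 < b c" "\<And>c. c \<in> C \<Longrightarrow> b c \<le> 11 * (1/2) ^ n"
    and s: "(\<Sum>c\<in>C. b c powr \<alpha>) \<le> s"
  shows "small_cover T \<rho> \<alpha> s n"
proof -
  obtain f where f: "bij_betw f {0..<card C} C" using ex_bij_betw_nat_finite[OF assms(1)] by blast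
  then have fC: "f ` {0..<card C} = C" by (simp add: bij_betw_def)
  have "(\<Sum>i\<in>{0..<card C}. b (f i) powr \<alpha>) \<le> s" using sum.reindex_bij_betw[OF f, of "\<lambda>c. b c powr \<alpha>"] s by simp
  moreover have "T \<subseteq> (\<Union>i\<in>{0..<card C}. E (f i))" using assms(2) fC by (metis image_image)
  moreover have "f i \<in> C" if "i \<in> {0..<card C}" for i using fC that by blast
  ultimately show ?thesis unfolding small_cover_def using E b
    by (intro exI[of _ "{0..<card C}"] exI[of _ "\<lambda>i. E (f i)"] exI[of _ "\<lambda>i. b (f i)"]) simp
qed

text \<open>The index set will contain all points of the tree, so a pointwise convergent subsequence
  need not exist. Tychonoff's theorem still yields a cluster point, and its neighbourhoods together
  with the tails of the sequence generate a proper filter along which every coordinate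
  converges.\<close>

lemma pointwise_cluster_filter:
  fixes f :: "nat \<Rightarrow> 'i \<Rightarrow> real"
  assumes "\<And>n i. f n i \<in> {a..b}"
  obtains g F where "F \<noteq> bot" "F \<le> sequentially" "\<And>i. ((\<lambda>n. f n i) \<longlongrightarrow> g i) F"
proof -
  have "compactin (product_topology (\<lambda>i::'i. euclidean) UNIV) (PiE UNIV (\<lambda>i::'i. {a..b}))"
    by (simp add: compactin_PiE)
  then have "compact (PiE UNIV (\<lambda>i::'i. {a..b}))" by (simp add: euclidean_product_topology)
  moreover have "filtermap f sequentially \<noteq> bot" by (simp add: filtermap_bot_iff)
  moreover have "eventually (\<lambda>x. x \<in> PiE UNIV (\<lambda>i::'i. {a..b})) (filtermap f sequentially)"
    using assms by (auto simp: eventually_filtermap PiE_def)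
  ultimately obtain g where g: "inf (nhds g) (filtermap f sequentially) \<noteq> bot"
    unfolding compact_filter by blast
  define F where "F = inf sequentially (filtercomap f (nhds g))"
  have "F \<noteq> bot"
  proof
    assume "F = bot"
    then obtain P Q where PQ: "eventually P sequentially" "eventually Q (nhds g)" "\<And>n. P n \<Longrightarrow> \<not> Q (f n)"
      unfolding F_def trivial_limit_def eventually_inf eventually_filtercomap by metis
    have "eventually (\<lambda>y. \<not> Q y) (filtermap f sequentially)"
      unfolding eventually_filtermap using PQ(1) by (rule eventually_mono) (use PQ(3) in auto)
    then have "eventually (\<lambda>y. False) (inf (nhds g) (filtermap f sequentially))"
      unfolding eventually_inf using PQ(2) by blast
    then show False using g by (simp add: trivial_limit_def)
  qed
  moreover have "F \<le> sequentially" by (simp add: F_def)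
  moreover have "((\<lambda>n. f n i) \<longlongrightarrow> g i) F" for i
  proof -
    have "filterlim f (nhds g) F"
      unfolding F_def by (rule filterlim_mono[OF filterlim_filtercomap order_refl]) simp
    moreover have "((\<lambda>x::'i \<Rightarrow> real. x i) \<longlongrightarrow> g i) (nhds g)"
    proof (rule topological_tendstoI)
      fix S :: "real set" assume S: "open S" "g i \<in> S"
      have "open ((\<lambda>x::'i \<Rightarrow> real. x i) -` S)"
        using open_vimage[OF S(1) continuous_on_product_coordinates[of i]] .
      then show "eventually (\<lambda>x. x i \<in> S) (nhds g)"
        unfolding eventually_nhds using S(2) by (intro exI[of _ "(\<lambda>x. x i) -` S"]) auto
    qed
    ultimately show ?thesis by (rule filterlim_compose[rotated])
  qed
  ultimately show ?thesis using that by blast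
qed

context rooted_tree begin

lemma tree_weights_le:
  assumes "tree_weights L R \<delta> \<epsilon> h W" "\<And>k. k \<le> n \<Longrightarrow> L k" "x \<in> T"
  shows "W n x \<le> (1/2) ^ n"
  using assms(2)
proof (induction n)
  case 0
  then show ?case using assms by (simp add: tree_weights_def)
next
  case (Suc n)
  then have "W (Suc n) x \<le> W n x / 2" using assms(1,3) unfolding tree_weights_def by blast
  then show ?case using Suc by simp
qed

lemma tree_weights_pos:
  assumes "tree_weights L R \<delta> \<epsilon> h W" "0 < \<epsilon>" "\<And>k. k \<le> n \<Longrightarrow> L k" "x \<in> T"
  shows "0 < W n x"
  using assms(3)
proof (induction n)
  case 0
  then show ?case using assms by (simp add: tree_weights_def)
next
  case (Suc n)
  then have "\<epsilon> * W n x \<le> W (Suc n) x" using assms(1,4) unfolding tree_weights_def by blast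
  moreover have "0 < W n x" using Suc by simp
  ultimately show ?case using assms(2) by (meson less_le_trans mult_pos_pos)
qed

text \<open>The weak inequalities of \<open>tree_weights\<close> pass to the limit pointwise. A
  cover does not, since the cells vary with \<open>N\<close>. It is recovered from one large
  \<open>N\<close>: on a finite set \<open>U\<close> of test points the distances for
  \<open>N\<close> are close to the limit, and each point of the tree is put into the cells of the
  test points shortly below it.\<close>

lemma limit_weights:
  assumes R: "0 < R" "\<And>x y. x \<in> T \<Longrightarrow> y \<in> T \<Longrightarrow> d x y < R" and \<alpha>: "1 < \<alpha>"
  obtains \<delta> \<epsilon> \<kappa> :: real and h W where "0 < \<delta>" "\<delta> < 1" "0 < \<epsilon>" "\<epsilon> < 1" "0 < \<kappa>" "\<kappa> < 1"
    "tree_weights (\<lambda>n. True) R \<delta> \<epsilon> h W"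
    "\<And>n. small_cover T (hdist h) \<alpha> (20 powr \<alpha> * 2 * \<kappa> ^ n) n"
proof -
  obtain \<delta> \<epsilon> \<kappa> :: real and M :: nat where c: "0 < \<delta>" "\<delta> < 1" "0 < \<epsilon>" "\<epsilon> < 1" "0 < \<kappa>" "\<kappa> < 1" "0 < M"
    and ex: "\<And>N. \<exists>h W. tree_weights (\<lambda>n. n \<le> N) R \<delta> \<epsilon> h W \<and> (\<forall>n\<le>N. cells h \<alpha> M \<kappa> n)"
    using finite_level_weights[OF R \<alpha>] by blast
  obtain hN WN where tw: "\<And>N. tree_weights (\<lambda>n. n \<le> N) R \<delta> \<epsilon> (hN N) (WN N)"
    and ce: "\<And>N n. n \<le> N \<Longrightarrow> cells (hN N) \<alpha> M \<kappa> n" using ex by metis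
  \<comment> \<open>Heights and weights are treated at once: first component 0 stands for the
    height, \<open>Suc n\<close> for the weight of level \<open>n\<close>. The default 0 at levels
    above \<open>N\<close> does not influence the limit, as each level is eventually
    available.\<close>
  define f where "f N i = (case i of (k, x) \<Rightarrow> if x \<in> T then
     (case k of 0 \<Rightarrow> hN N x | Suc n \<Rightarrow> if n \<le> N then WN N n x else 0) else 0)" for N and i :: "nat \<times> 'a"
  have "f N i \<in> {0..5}" for N i
  proof -
    have "0 < WN N n x \<and> WN N n x \<le> 5" if "n \<le> N" "x \<in> T" for n x
    proof -
      have "(1/2::real) ^ n \<le> 1" by (simp add: power_le_one)
      then show ?thesis
        using tree_weights_le[OF tw[of N], of n x] tree_weights_pos[OF tw[of N] c(3), of n x] that by auto
    qed
    moreover have "0 \<le> hN N x \<and> hN N x \<le> 5" if "x \<in> T" for x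
      using tw[of N] that unfolding tree_weights_def by blast
    ultimately show ?thesis by (auto simp: f_def less_imp_le split: prod.splits nat.splits)
  qed
  then obtain g F where F: "F \<noteq> bot" "F \<le> sequentially" "\<And>i. ((\<lambda>n. f n i) \<longlongrightarrow> g i) F"
    using pointwise_cluster_filter by blast
  have evN: "eventually (\<lambda>N. n \<le> N) F" for n using F(2) eventually_ge_at_top filter_leD by blast
  define h where "h x = g (0, x)" for x
  define W where "W n x = g (Suc n, x)" for n x
  have hl: "((\<lambda>N. hN N x) \<longlongrightarrow> h x) F" if "x \<in> T" for x
    using F(3)[of "(0, x)"] that by (simp add: f_def h_def)
  have Wl: "((\<lambda>N. WN N n x) \<longlongrightarrow> W n x) F" if "x \<in> T" for n x
  proof (rule Lim_transform_eventually)
    show "((\<lambda>N. f N (Suc n, x)) \<longlongrightarrow> W n x) F" using F(3) by (simp add: W_def)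
    show "eventually (\<lambda>N. f N (Suc n, x) = WN N n x) F"
      using evN[of n] by (rule eventually_mono) (simp add: f_def that)
  qed
  have dl: "((\<lambda>N. hdist (hN N) x y) \<longlongrightarrow> hdist h x y) F" if "x \<in> T" "y \<in> T" for x y
    unfolding hdist_def using mt_T that by (intro tendsto_intros hl) auto
  note le = tendsto_le[OF F(1)]
  have tw': "tree_weights (\<lambda>n. True) R \<delta> \<epsilon> h W"
    unfolding tree_weights_def
  proof (intro conjI allI ballI impI)
    show "height_fun h" unfolding height_fun_def
    proof (intro allI impI)
      fix a x assume ax: "a \<sqsubseteq> x"
      show "h a \<le> h x"
      proof (rule le[OF hl hl])
        show "a \<in> T" "x \<in> T" using ax le_T by auto
        show "eventually (\<lambda>N. hN N a \<le> hN N x) F"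
          using tw ax by (intro always_eventually) (auto simp: tree_weights_def height_fun_def)
      qed
    qed
    fix x assume x: "x \<in> T"
    have "\<forall>N. 0 \<le> hN N x \<and> hN N x \<le> 5" using tw x unfolding tree_weights_def by blast
    then show "0 \<le> h x" "h x \<le> 5"
      using le[OF hl[OF x] tendsto_const] le[OF tendsto_const hl[OF x]] by auto
    have "\<forall>N. WN N 0 x = 1" using tw x unfolding tree_weights_def by blast
    then have "((\<lambda>N. 1) \<longlongrightarrow> W 0 x) F" using Wl[OF x, of 0] by simp
    then show "W 0 x = 1" using tendsto_unique[OF F(1) _ tendsto_const] by blast
    fix n
    have ev: "eventually (\<lambda>N. \<epsilon> * WN N n x \<le> WN N (Suc n) x \<and> WN N (Suc n) x \<le> WN N n x / 2) F"
      using evN[of "Suc n"] by (rule eventually_mono) (use tw x in \<open>auto simp: tree_weights_def\<close>)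
    show "\<epsilon> * W n x \<le> W (Suc n) x"
      by (rule le[OF Wl[OF x] tendsto_mult[OF tendsto_const Wl[OF x]]]) (rule eventually_mono[OF ev], simp)
    show "W (Suc n) x \<le> W n x / 2"
      by (rule le[OF tendsto_divide[OF Wl[OF x] tendsto_const] Wl[OF x]]) (auto intro: eventually_mono[OF ev])
    fix y assume y: "y \<in> T"
    show "hdist h x y \<le> 20 / \<epsilon>^2 * W n x" if "d x y < R * \<delta> ^ n"
    proof (rule le[OF tendsto_mult[OF tendsto_const Wl[OF x]] dl[OF x y]])
      show "eventually (\<lambda>N. hdist (hN N) x y \<le> 20 / \<epsilon>^2 * WN N n x) F"
        using evN[of n] by (rule eventually_mono) (use tw x y that in \<open>simp add: tree_weights_def\<close>)
    qed
    show "\<epsilon>^5 * W n x \<le> hdist h x y" if "R * \<delta> ^ Suc n \<le> d x y \<and> d x y < R * \<delta> ^ n"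
    proof (rule le[OF dl[OF x y] tendsto_mult[OF tendsto_const Wl[OF x]]])
      show "eventually (\<lambda>N. \<epsilon>^5 * WN N n x \<le> hdist (hN N) x y) F"
        using evN[of "Suc (Suc n)"]
      proof (rule eventually_mono)
        fix N assume "Suc (Suc n) \<le> N"
        then show "\<epsilon>^5 * WN N n x \<le> hdist (hN N) x y" using tw[of N] x y that unfolding tree_weights_def by blast
      qed
    qed
  qed
  have hf: "height_fun h" using tw' by (simp add: tree_weights_def)
  have "small_cover T (hdist h) \<alpha> (20 powr \<alpha> * 2 * \<kappa> ^ n) n" for n
  proof -
    \<comment> \<open>The second entry makes the errors harmless after summation: at most
      \<open>M ^ n\<close> cells with error at most \<open>(\<kappa> / M) ^ n\<close> add up to at
      most \<open>\<kappa> ^ n\<close>.\<close>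
    define \<eta> where "\<eta> = min ((1/2) ^ n) ((\<kappa> / M) ^ n)"
    have \<eta>: "0 < \<eta>" "\<eta> \<le> (1/2) ^ n" "\<eta> \<le> (\<kappa> / M) ^ n" "\<eta> \<le> 1"
      using c by (auto simp: \<eta>_def min_le_iff_disj power_le_one)
    have "((\<lambda>k. 20 / \<epsilon>^2 * (1/2::real) ^ k) \<longlongrightarrow> 20 / \<epsilon>^2 * 0) sequentially"
      by (intro tendsto_mult tendsto_const LIMSEQ_power_zero) simp
    then have "eventually (\<lambda>k. 20 / \<epsilon>^2 * (1/2::real) ^ k < \<eta> / 4) sequentially"
      using \<eta>(1) by (intro order_tendstoD(2)) auto
    then obtain k where k: "20 / \<epsilon>^2 * (1/2::real) ^ k < \<eta> / 4" by (auto simp: eventually_sequentially)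
    define \<tau> where "\<tau> = R * \<delta> ^ k / 2"
    have \<tau>: "0 < \<tau>" "\<tau> < R * \<delta> ^ k" using R c by (auto simp: \<tau>_def)
    obtain U where U: "finite U" "U \<subseteq> T" "\<forall>x\<in>T. \<exists>u\<in>U. u \<sqsubseteq> x \<and> d u x \<le> \<tau>" using disc[OF \<tau>(1)] by blast
    have near: "hdist h x u \<le> \<eta> / 4" if "u \<sqsubseteq> x" "d u x \<le> \<tau>" for u x
    proof -
      have T: "u \<in> T" "x \<in> T" using that le_T by auto
      have "d x u < R * \<delta> ^ k" using d_sym[OF T] that \<tau> by simp
      then have "hdist h x u \<le> 20 / \<epsilon>^2 * W k x" using tw' T unfolding tree_weights_def by blast
      also have "\<dots> \<le> 20 / \<epsilon>^2 * (1/2) ^ k"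
        using tree_weights_le[OF tw' _ T(2), of k] by (intro mult_left_mono) auto
      finally show ?thesis using k by simp
    qed
    have "eventually (\<lambda>N. \<bar>hdist (hN N) u v - hdist h u v\<bar> < \<eta> / 4) F" if "u \<in> T" "v \<in> T" for u v
      using tendstoD[OF dl[OF that], of "\<eta> / 4"] \<eta>(1) by (simp add: dist_real_def)
    then have "eventually (\<lambda>N. \<forall>u\<in>U. \<forall>v\<in>U. \<bar>hdist (hN N) u v - hdist h u v\<bar> < \<eta> / 4) F"
      using U by (intro eventually_ball_finite ballI) auto
    then have "eventually (\<lambda>N. n \<le> N \<and> (\<forall>u\<in>U. \<forall>v\<in>U. \<bar>hdist (hN N) u v - hdist h u v\<bar> < \<eta> / 4)) F"
      using evN by (rule eventually_conj[rotated])
    then obtain N where N: "n \<le> N" "\<forall>u\<in>U. \<forall>v\<in>U. \<bar>hdist (hN N) u v - hdist h u v\<bar> < \<eta> / 4"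
      using F(1) eventually_happens' by blast
    from ce[OF N(1)] obtain C :: "'a set" and \<pi> \<omega> where
      C: "finite C" "card C \<le> M ^ n" "\<forall>x\<in>T. \<pi> x \<in> C" "\<forall>c\<in>C. 0 \<le> \<omega> c \<and> \<omega> c \<le> (1/2) ^ n"
        "(\<Sum>c\<in>C. \<omega> c powr \<alpha>) \<le> \<kappa> ^ n" "\<forall>x\<in>T. \<forall>y\<in>T. \<pi> x = \<pi> y \<longrightarrow> hdist (hN N) x y \<le> 10 * \<omega> (\<pi> x)"
      unfolding cells_def by blast
    define E where "E c = {x\<in>T. \<exists>u\<in>U. u \<sqsubseteq> x \<and> d u x \<le> \<tau> \<and> \<pi> u = c}" for c
    \<comment> \<open>The cell accounts for \<open>10 * \<omega> c\<close>. Replacing each of two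
      points by its test point and the limit by the height for \<open>N\<close> costs
      \<open>\<eta> / 4\<close> each.\<close>
    define b where "b c = 10 * \<omega> c + \<eta>" for c
    have hb: "hdist h x y \<le> b c" if xy: "x \<in> E c" "y \<in> E c" for c x y
    proof -
      obtain u where u: "u \<in> U" "u \<sqsubseteq> x" "d u x \<le> \<tau>" "\<pi> u = c" "x \<in> T" using xy(1) by (auto simp: E_def)
      obtain v where v: "v \<in> U" "v \<sqsubseteq> y" "d v y \<le> \<tau>" "\<pi> v = c" "y \<in> T" using xy(2) by (auto simp: E_def)
      have T: "u \<in> T" "v \<in> T" using u v U by auto
      have "hdist (hN N) u v \<le> 10 * \<omega> c" using C(6) T u(4) v(4) by metis
      moreover have "\<bar>hdist (hN N) u v - hdist h u v\<bar> < \<eta> / 4" using N(2) u(1) v(1) by blast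
      ultimately have "hdist h u v \<le> 10 * \<omega> c + \<eta> / 4" by linarith
      moreover have "hdist h x y \<le> hdist h x u + hdist h u y" "hdist h u y \<le> hdist h u v + hdist h v y"
        using hdist_triangle[OF hf] T u v by auto
      moreover have "hdist h v y = hdist h y v" using hdist_commute T v by blast
      ultimately show ?thesis using near[OF u(2,3)] near[OF v(2,3)] \<eta>(1) unfolding b_def by linarith
    qed
    have cv: "T \<subseteq> (\<Union>c\<in>C. E c)"
    proof
      fix x assume x: "x \<in> T"
      then obtain u where u: "u \<in> U" "u \<sqsubseteq> x" "d u x \<le> \<tau>" using U by blast
      then have "x \<in> E (\<pi> u)" using x by (auto simp: E_def)
      moreover have "\<pi> u \<in> C" using C(3) u U by blast
      ultimately show "x \<in> (\<Union>c\<in>C. E c)" by blast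
    qed
    have b0: "0 < b c" "b c \<le> 11 * (1/2) ^ n" if "c \<in> C" for c
    proof -
      have "0 \<le> \<omega> c \<and> \<omega> c \<le> (1/2) ^ n" using C(4) that by blast
      then show "0 < b c" "b c \<le> 11 * (1/2) ^ n" using \<eta> unfolding b_def by linarith+
    qed
    have Es: "E c \<subseteq> T" for c by (auto simp: E_def)
    have sm: "(\<Sum>c\<in>C. b c powr \<alpha>) \<le> 20 powr \<alpha> * 2 * \<kappa> ^ n"
    proof -
      have "b c powr \<alpha> \<le> 20 powr \<alpha> * (\<omega> c powr \<alpha> + \<eta> powr \<alpha>)" if "c \<in> C" for c
      proof -
        have \<omega>: "0 \<le> \<omega> c" using C(4) that by blast
        define t where "t = max (\<omega> c) \<eta>"
        have t: "0 < t" "\<omega> c \<le> t" "\<eta> \<le> t" using \<eta> by (auto simp: t_def)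
        have "b c \<le> 20 * t" using t unfolding b_def by linarith
        then have "b c powr \<alpha> \<le> (20 * t) powr \<alpha>" using \<omega> \<eta> \<alpha> by (intro powr_mono2) (auto simp: b_def)
        also have "\<dots> = 20 powr \<alpha> * t powr \<alpha>" using t by (simp add: powr_mult)
        also have "\<dots> \<le> 20 powr \<alpha> * (\<omega> c powr \<alpha> + \<eta> powr \<alpha>)"
          by (intro mult_left_mono) (auto simp: t_def max_def)
        finally show ?thesis .
      qed
      then have "(\<Sum>c\<in>C. b c powr \<alpha>) \<le> (\<Sum>c\<in>C. 20 powr \<alpha> * (\<omega> c powr \<alpha> + \<eta> powr \<alpha>))" by (rule sum_mono)
      also have "\<dots> = 20 powr \<alpha> * ((\<Sum>c\<in>C. \<omega> c powr \<alpha>) + card C * \<eta> powr \<alpha>)"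
        by (simp add: sum_distrib_left[symmetric] sum.distrib)
      also have "\<dots> \<le> 20 powr \<alpha> * (\<kappa> ^ n + \<kappa> ^ n)"
      proof (intro mult_left_mono add_mono)
        have "card C * \<eta> powr \<alpha> \<le> M ^ n * \<eta> powr \<alpha>" using C(2) by (intro mult_right_mono) (auto simp flip: of_nat_power)
        also have "\<dots> \<le> M ^ n * \<eta> powr 1" using \<eta> \<alpha> by (intro mult_left_mono powr_mono') auto
        also have "\<dots> \<le> M ^ n * (\<kappa> / M) ^ n" using \<eta> by (intro mult_left_mono) auto
        also have "\<dots> = \<kappa> ^ n" using c(7) by (simp add: power_divide)
        finally show "card C * \<eta> powr \<alpha> \<le> \<kappa> ^ n" .
      qed (use C(5) in auto)
      finally show ?thesis by simp
    qed
    show ?thesis by (rule small_coverI[OF C(1) cv Es _ b0 sm]) (rule hb)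
  qed
  then show ?thesis by (rule that[OF c(1-6) tw'])
qed

end

section \<open>Paths in spaces of bounded turning\<close>

text \<open>Being joined by a chain with steps of at most \<tau> is an equivalence relation with
  open classes.\<close>

lemma connected_chain:
  fixes E :: "'b::metric_space set"
  assumes "connected E" "a \<in> E" "b \<in> E" "0 < \<tau>"
  shows "\<exists>n c. c 0 = a \<and> c n = b \<and> (\<forall>i\<le>n. c i \<in> E) \<and> (\<forall>i<n. dist (c i) (c (Suc i)) \<le> \<tau>)"
proof -
  define R where "R x y \<longleftrightarrow> (\<exists>n c. c 0 = x \<and> c n = y \<and> (\<forall>i\<le>n. c i \<in> E) \<and> (\<forall>i<n. dist (c i) (c (Suc i)) \<le> \<tau>))"
    for x y :: 'b
  have sym: "R y x" if xy: "R x y" for x y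
  proof -
    obtain n c where c: "c 0 = x" "c n = y" "\<forall>i\<le>n. c i \<in> E" "\<forall>i<n. dist (c i) (c (Suc i)) \<le> \<tau>"
      using xy unfolding R_def by blast
    have "dist (c (n - i)) (c (n - Suc i)) \<le> \<tau>" if "i < n" for i
    proof -
      have "n - i = Suc (n - Suc i)" "n - Suc i < n" using that by auto
      then show ?thesis using c(4) by (metis dist_commute)
    qed
    then show ?thesis unfolding R_def using c by (intro exI[of _ n] exI[of _ "\<lambda>i. c (n - i)"]) auto
  qed
  have trans: "R x z" if xy: "R x y" and yz: "R y z" for x y z
  proof -
    obtain n c where c: "c 0 = x" "c n = y" "\<forall>i\<le>n. c i \<in> E" "\<forall>i<n. dist (c i) (c (Suc i)) \<le> \<tau>"
      using xy unfolding R_def by blast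
    obtain m e where e: "e 0 = y" "e m = z" "\<forall>i\<le>m. e i \<in> E" "\<forall>i<m. dist (e i) (e (Suc i)) \<le> \<tau>"
      using yz unfolding R_def by blast
    define f where "f i = (if i < n then c i else e (i - n))" for i
    have "dist (f i) (f (Suc i)) \<le> \<tau>" if "i < n + m" for i
    proof (cases "i < n")
      case True
      then have "f i = c i" by (simp add: f_def)
      moreover have "f (Suc i) = c (Suc i)"
      proof (cases "Suc i < n")
        case False
        then have "Suc i = n" using True by simp
        then show ?thesis using c(2) e(1) by (simp add: f_def)
      qed (simp add: f_def)
      ultimately show ?thesis using c True by simp
    next
      case False
      then have "f i = e (i - n)" "f (Suc i) = e (Suc (i - n))" by (auto simp: f_def Suc_diff_le)
      then show ?thesis using e(4) False that by simp
    qed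
    moreover have "f 0 = x" using c e by (cases "n = 0") (auto simp: f_def)
    moreover have "f i \<in> E" if "i \<le> n + m" for i using c e that by (auto simp: f_def)
    ultimately show ?thesis unfolding R_def using e by (intro exI[of _ "n + m"] exI[of _ f]) (auto simp: f_def)
  qed
  have "R a b"
  proof (rule connected_equivalence_relation[OF assms(1-3) sym trans])
    fix x assume x: "x \<in> E"
    have "R x y" if "y \<in> E \<inter> ball x \<tau>" for y
    proof -
      define c where "c i = (if i = 0 then x else y)" for i :: nat
      show ?thesis unfolding R_def
        by (intro exI[of _ 1] exI[of _ c]) (use x that in \<open>auto simp: c_def\<close>)
    qed
    then show "\<exists>T. openin (top_of_set E) T \<and> x \<in> T \<and> (\<forall>y\<in>T. R x y)"
      using assms(4) x by (intro exI[of _ "E \<inter> ball x \<tau>"]) (auto intro: openin_open_Int)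
  qed
  then show ?thesis unfolding R_def .
qed

text \<open>Inserting chains of a common length \<open>n\<close> between the points of a chain; shorter chains are
  padded by repeating their last point.\<close>

lemma refine_chain:
  fixes Y :: "'b::metric_space set"
  assumes turning: "\<And>x y. x \<in> Y \<Longrightarrow> y \<in> Y \<Longrightarrow>
      \<exists>E\<subseteq>Y. connected E \<and> x \<in> E \<and> y \<in> E \<and> (\<forall>u\<in>E. \<forall>v\<in>E. dist u v \<le> K * dist x y)"
    and K: "1 \<le> K" and \<tau>': "0 < \<tau>'"
    and c: "\<And>i. i \<le> L \<Longrightarrow> c i \<in> Y" "\<And>i. i < L \<Longrightarrow> dist (c i) (c (Suc i)) \<le> \<tau>"
  shows "\<exists>n c'. 0 < n \<and> (\<forall>i\<le>L. c' (i * n) = c i) \<and> (\<forall>j\<le>L * n. c' j \<in> Y) \<and>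
      (\<forall>j<L * n. dist (c' j) (c' (Suc j)) \<le> \<tau>') \<and> (\<forall>i<L. \<forall>j<n. dist (c' (i * n + j)) (c i) \<le> K * \<tau>)"
proof -
  have "\<exists>n e. e 0 = c i \<and> e n = c (Suc i) \<and> (\<forall>j\<le>n. e j \<in> Y \<and> dist (e j) (c i) \<le> K * \<tau>) \<and>
      (\<forall>j<n. dist (e j) (e (Suc j)) \<le> \<tau>')" if i: "i < L" for i
  proof -
    obtain E where E: "E \<subseteq> Y" "connected E" "c i \<in> E" "c (Suc i) \<in> E"
      "\<forall>u\<in>E. \<forall>v\<in>E. dist u v \<le> K * dist (c i) (c (Suc i))"
      using turning[OF c(1) c(1), of i "Suc i"] i by auto
    obtain n e where e: "e 0 = c i" "e n = c (Suc i)" "\<forall>j\<le>n. e j \<in> E" "\<forall>j<n. dist (e j) (e (Suc j)) \<le> \<tau>'"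
      using connected_chain[OF E(2-4) \<tau>'] by blast
    have "K * dist (c i) (c (Suc i)) \<le> K * \<tau>" using K c(2)[OF i] by simp
    then have "dist (e j) (c i) \<le> K * \<tau>" if "j \<le> n" for j using e(3) E(3,5) that by force
    moreover have "e j \<in> Y" if "j \<le> n" for j using e(3) E(1) that by blast
    ultimately show ?thesis using e by blast
  qed
  then obtain n e where e: "\<And>i. i < L \<Longrightarrow> e i 0 = c i \<and> e i (n i) = c (Suc i) \<and>
      (\<forall>j\<le>n i. e i j \<in> Y \<and> dist (e i j) (c i) \<le> K * \<tau>) \<and> (\<forall>j<n i. dist (e i j) (e i (Suc j)) \<le> \<tau>')"
    by metis
  define m where "m = Suc (\<Sum>i<L. n i)"
  have m: "0 < m" by (simp add: m_def)
  have nm: "n i < m" if "i < L" for i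
    using member_le_sum[of i "{..<L}" n] that by (simp add: m_def less_Suc_eq_le)
  define e' where "e' i j = e i (min j (n i))" for i j
  have e': "e' i 0 = c i" "e' i m = c (Suc i)" "\<And>j. e' i j \<in> Y" "\<And>j. dist (e' i j) (c i) \<le> K * \<tau>"
    "\<And>j. dist (e' i j) (e' i (Suc j)) \<le> \<tau>'" if "i < L" for i
  proof -
    note ei = e[OF that]
    show "e' i 0 = c i" "e' i m = c (Suc i)" using ei nm[OF that] by (auto simp: e'_def min_def)
    show "e' i j \<in> Y" "dist (e' i j) (c i) \<le> K * \<tau>" for j using ei by (auto simp: e'_def)
    show "dist (e' i j) (e' i (Suc j)) \<le> \<tau>'" for j
    proof (cases "j < n i")
      case True
      then have "min j (n i) = j" "min (Suc j) (n i) = Suc j" by auto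
      then show ?thesis using ei True by (simp add: e'_def)
    next
      case False
      then have "min j (n i) = n i" "min (Suc j) (n i) = n i" by auto
      then show ?thesis using \<tau>' by (simp add: e'_def)
    qed
  qed
  define c' where "c' j = (if j < L * m then e' (j div m) (j mod m) else c L)" for j
  have c'1: "c' (i * m + j) = e' i j" if "i < L" "j < m" for i j
  proof -
    have "i * m + j < Suc i * m" using that by simp
    also have "\<dots> \<le> L * m" using that by (intro mult_le_mono1) simp
    finally show ?thesis using that by (simp add: c'_def)
  qed
  have c'0: "c' (i * m) = c i" if "i \<le> L" for i
  proof (cases "i = L")
    case False
    then show ?thesis using c'1[of i 0] e'(1)[of i] m that by simp
  qed (simp add: c'_def)
  have "dist (c' j) (c' (Suc j)) \<le> \<tau>'" if j: "j < L * m" for j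
  proof -
    define i where "i = j div m"
    define k where "k = j mod m"
    have jk: "j = i * m + k" "k < m" "i < L" using j m by (auto simp: i_def k_def less_mult_imp_div_less)
    have "c' (Suc j) = e' i (Suc k)"
    proof (cases "Suc k < m")
      case True
      then show ?thesis using c'1[of i "Suc k"] jk by simp
    next
      case False
      then have "Suc k = m" using jk by simp
      then have "Suc j = Suc i * m" using jk(1) by simp
      then show ?thesis using c'0[OF Suc_leI[OF jk(3)]] e'(2)[OF jk(3)] \<open>Suc k = m\<close> by (simp only:)
    qed
    moreover have "c' j = e' i k" unfolding jk(1) by (rule c'1[OF jk(3,2)])
    ultimately show ?thesis using e'(5)[OF jk(3)] by simp
  qed
  moreover have "c' j \<in> Y" for j
  proof (cases "j < L * m")
    case True
    then show ?thesis using e'(3)[OF less_mult_imp_div_less[OF True]] by (simp add: c'_def)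
  next
    case False
    then show ?thesis using c(1)[of L] by (simp add: c'_def)
  qed
  moreover have "dist (c' (i * m + j)) (c i) \<le> K * \<tau>" if "i < L" "j < m" for i j
    unfolding c'1[OF that] by (rule e'(4)[OF that(1)])
  ultimately have "0 < m \<and> (\<forall>i\<le>L. c' (i * m) = c i) \<and> (\<forall>j\<le>L * m. c' j \<in> Y) \<and>
      (\<forall>j<L * m. dist (c' j) (c' (Suc j)) \<le> \<tau>') \<and> (\<forall>i<L. \<forall>j<m. dist (c' (i * m + j)) (c i) \<le> K * \<tau>)"
    using m c'0 by blast
  then show ?thesis by blast
qed

text \<open>A continuum joining two points need not contain an arc between them. Instead, chains
  with steps \<open>dist x y / 2 ^ k\<close> are refined successively, each refinement staying
  within \<open>K\<close> times the current step; the resulting step functions converge uniformly to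
  a path. The displacements sum to at most \<open>2 * K * dist x y\<close>, and the first step
  function takes only the values \<open>x\<close> and \<open>y\<close>, whence the radius.\<close>

lemma bounded_turning_path:
  fixes Y :: "'b::metric_space set"
  assumes Y: "compact Y"
    and turning: "\<And>x y. x \<in> Y \<Longrightarrow> y \<in> Y \<Longrightarrow>
      \<exists>E\<subseteq>Y. connected E \<and> x \<in> E \<and> y \<in> E \<and> (\<forall>u\<in>E. \<forall>v\<in>E. dist u v \<le> K * dist x y)"
    and K: "1 \<le> K" and xy: "x \<in> Y" "y \<in> Y" "x \<noteq> y"
  shows "\<exists>f. path f \<and> pathstart f = x \<and> pathfinish f = y \<and> path_image f \<subseteq> Y \<inter> cball x (3 * K * dist x y)"
proof -
  define \<tau> where "\<tau> k = dist x y / 2 ^ k" for k :: nat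
  have \<tau>: "0 < \<tau> k" for k using xy by (simp add: \<tau>_def)
  define good where "good k s \<longleftrightarrow> (case s of (L, c) \<Rightarrow> 0 < L \<and> c 0 = x \<and> c L = y \<and>
     (\<forall>i\<le>L. c i \<in> Y) \<and> (\<forall>i<L. dist (c i) (c (Suc i)) \<le> \<tau> k))" for k and s :: "nat \<times> (nat \<Rightarrow> 'b)"
  define step where "step k s s' \<longleftrightarrow> (case (s, s') of ((L, c), (L', c')) \<Rightarrow> (\<exists>n>0. L' = L * n \<and>
     c' L' = c L \<and> (\<forall>i<L. \<forall>j<n. dist (c' (i * n + j)) (c i) \<le> K * \<tau> k)))"
    for k and s s' :: "nat \<times> (nat \<Rightarrow> 'b)"
  define c0 where "c0 i = (if i = 0 then x else y)" for i :: nat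
  have "\<exists>s. \<forall>k. (good k (s k) \<and> (k = 0 \<longrightarrow> s k = (1, c0))) \<and> step k (s k) (s (Suc k))"
  proof (rule dependent_nat_choice)
    show "\<exists>s. good 0 s \<and> (0 = (0::nat) \<longrightarrow> s = (1, c0))"
      using xy by (intro exI[of _ "(1, c0)"]) (auto simp: good_def c0_def \<tau>_def)
  next
    fix s k assume s: "good k s \<and> (k = 0 \<longrightarrow> s = (1, c0))"
    obtain L c where sL: "s = (L, c)" by (cases s)
    then have g: "0 < L" "c 0 = x" "c L = y" "\<And>i. i \<le> L \<Longrightarrow> c i \<in> Y" "\<And>i. i < L \<Longrightarrow> dist (c i) (c (Suc i)) \<le> \<tau> k"
      using s by (auto simp: good_def)
    obtain n c' where c': "0 < n" "\<forall>i\<le>L. c' (i * n) = c i" "\<forall>j\<le>L * n. c' j \<in> Y"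
      "\<forall>j<L * n. dist (c' j) (c' (Suc j)) \<le> \<tau> (Suc k)" "\<forall>i<L. \<forall>j<n. dist (c' (i * n + j)) (c i) \<le> K * \<tau> k"
      using refine_chain[of Y K "\<tau> (Suc k)" L c "\<tau> k", OF turning K \<tau> g(4,5)] by blast
    have "c' 0 = x" using c'(2)[rule_format, of 0] g(2) by simp
    then have "good (Suc k) (L * n, c')" using c' g by (auto simp: good_def)
    moreover have "step k s (L * n, c')" unfolding step_def sL using c' by auto
    ultimately show "\<exists>s'. (good (Suc k) s' \<and> (Suc k = 0 \<longrightarrow> s' = (1, c0))) \<and> step k s s'" by blast
  qed
  then obtain s where s: "\<And>k. good k (s k)" "s 0 = (1, c0)" "\<And>k. step k (s k) (s (Suc k))" by metis
  define L where "L k = fst (s k)" for k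
  define c where "c k = snd (s k)" for k
  have g: "0 < L k" "c k 0 = x" "c k (L k) = y" "\<And>i. i \<le> L k \<Longrightarrow> c k i \<in> Y"
    "\<And>i. i < L k \<Longrightarrow> dist (c k i) (c k (Suc i)) \<le> \<tau> k" for k
    using s(1)[of k] by (auto simp: good_def L_def c_def split: prod.splits)
  have st: "\<exists>n>0. L (Suc k) = L k * n \<and>
     (\<forall>i<L k. \<forall>j<n. dist (c (Suc k) (i * n + j)) (c k i) \<le> K * \<tau> k)" for k
    using s(3)[of k] by (auto simp: step_def L_def c_def split: prod.splits)
  \<comment> \<open>Every refinement multiplies the number of steps by an integer, so dividing the
    finer index by it gives back the coarser one. This is why the inserted chains were padded to a
    common length.\<close>
  define idx where "idx k t = nat \<lfloor>t * L k\<rfloor>" for k and t :: real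
  have idx_le: "idx k t \<le> L k" if "t \<in> {0..1}" for k t
  proof -
    have "t * L k \<le> real (L k)" using that by (intro mult_left_le_one_le) auto
    then have "\<lfloor>t * L k\<rfloor> \<le> \<lfloor>real (L k)\<rfloor>" by (rule floor_mono)
    then show ?thesis unfolding idx_def by (simp add: nat_le_iff)
  qed
  define f where "f k t = c k (idx k t)" for k t
  have fY: "f k t \<in> Y" if "t \<in> {0..1}" for k t using g(4) idx_le[OF that] by (simp add: f_def)
  have next_le: "dist (f (Suc k) t) (f k t) \<le> K * \<tau> k" if t: "t \<in> {0..1}" for k t
  proof -
    obtain n where n: "0 < n" "L (Suc k) = L k * n"
      "\<forall>i<L k. \<forall>j<n. dist (c (Suc k) (i * n + j)) (c k i) \<le> K * \<tau> k" using st by blast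
    have "idx (Suc k) t div n = idx k t"
    proof -
      have "\<lfloor>t * L (Suc k)\<rfloor> div int n = \<lfloor>t * L k\<rfloor>"
        using floor_divide_real_eq_div[of "int n" "t * L (Suc k)"] n by simp
      moreover have "nat (\<lfloor>t * L (Suc k)\<rfloor> div int n) = nat \<lfloor>t * L (Suc k)\<rfloor> div n"
        using nat_div_distrib[of "\<lfloor>t * L (Suc k)\<rfloor>" "int n"] t by simp
      ultimately show ?thesis by (simp add: idx_def)
    qed
    then have i: "idx (Suc k) t = idx k t * n + idx (Suc k) t mod n"
      using div_mult_mod_eq[of "idx (Suc k) t" n] by simp
    show ?thesis
    proof (cases "idx k t < L k")
      case True
      then have "dist (c (Suc k) (idx k t * n + idx (Suc k) t mod n)) (c k (idx k t)) \<le> K * \<tau> k"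
        using n(1,3) by simp
      then show ?thesis unfolding f_def using i by simp
    next
      case False
      then have e: "idx k t = L k" using idx_le[OF t, of k] by simp
      then have "L (Suc k) \<le> idx (Suc k) t" using i n(2) by simp
      then have "idx (Suc k) t = L (Suc k)" using idx_le[OF t, of "Suc k"] by simp
      then show ?thesis using e g(3) K \<tau>[of k] by (simp add: f_def)
    qed
  qed
  \<comment> \<open>The bound is in telescoping form, since \<open>K * \<tau> k\<close> equals
    \<open>2 * K * \<tau> k - 2 * K * \<tau> (Suc k)\<close>.\<close>
  have tail: "dist (f (k + m) t) (f k t) \<le> 2 * K * \<tau> k - 2 * K * \<tau> (k + m)" if t: "t \<in> {0..1}" for k m t
  proof (induction m)
    case (Suc m)
    have "dist (f (k + Suc m) t) (f k t) \<le> dist (f (Suc (k + m)) t) (f (k + m) t) + dist (f (k + m) t) (f k t)"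
      using dist_triangle by simp
    also have "\<dots> \<le> K * \<tau> (k + m) + (2 * K * \<tau> k - 2 * K * \<tau> (k + m))"
      using next_le[OF t] Suc by (intro add_mono) auto
    also have "\<dots> = 2 * K * \<tau> k - 2 * K * \<tau> (k + Suc m)" by (simp add: \<tau>_def)
    finally show ?case .
  qed simp
  have K\<tau>: "0 \<le> K * \<tau> k" for k using K \<tau>[of k] by simp
  have tail': "dist (f l t) (f k t) \<le> 2 * K * \<tau> k" if "t \<in> {0..1}" "k \<le> l" for k l t
    using tail[OF that(1), of k "l - k"] that(2) K\<tau>[of l] by simp
  have \<tau>0: "(\<lambda>k. C * \<tau> k) \<longlonglongrightarrow> 0" for C
  proof -
    have "(\<lambda>k. (C * dist x y) * (1/2) ^ k) \<longlonglongrightarrow> (C * dist x y) * 0"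
      by (intro tendsto_mult tendsto_const LIMSEQ_power_zero) simp
    moreover have "(C * dist x y) * (1/2) ^ k = C * \<tau> k" for k by (simp add: \<tau>_def power_one_over)
    ultimately show ?thesis by simp
  qed
  have small: "\<exists>k. C * \<tau> k < e" if "0 < e" for C e
    using order_tendstoD(2)[OF \<tau>0 that, of C] by (auto simp: eventually_sequentially)
  have "\<exists>l\<in>Y. (\<lambda>k. f k t) \<longlonglongrightarrow> l" if t: "t \<in> {0..1}" for t
  proof -
    have "Cauchy (\<lambda>k. f k t)"
    proof (rule metric_CauchyI)
      fix e :: real assume "0 < e"
      then obtain k where k: "4 * K * \<tau> k < e" using small by blast
      have "dist (f m t) (f n t) < e" if "k \<le> m" "k \<le> n" for m n
        using tail'[OF t that(1)] tail'[OF t that(2)] dist_triangle2[of "f m t" "f n t" "f k t"] k by linarith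
      then show "\<exists>M. \<forall>m\<ge>M. \<forall>n\<ge>M. dist (f m t) (f n t) < e" by blast
    qed
    moreover have "\<forall>k. f k t \<in> Y" using fY[OF t] by blast
    ultimately show ?thesis using compact_imp_complete[OF Y] unfolding complete_def by auto
  qed
  then obtain F where F: "\<And>t. t \<in> {0..1} \<Longrightarrow> F t \<in> Y \<and> (\<lambda>k. f k t) \<longlonglongrightarrow> F t" by metis
  have Ff: "dist (F t) (f k t) \<le> 2 * K * \<tau> k" if t: "t \<in> {0..1}" for k t
  proof (rule Lim_bounded)
    show "(\<lambda>l. dist (f l t) (f k t)) \<longlonglongrightarrow> dist (F t) (f k t)" using F[OF t] by (intro tendsto_intros) auto
    show "\<forall>l\<ge>k. dist (f l t) (f k t) \<le> 2 * K * \<tau> k" using tail'[OF t] by blast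
  qed
  have ends: "F 0 = x" "F 1 = y"
  proof -
    have "f k 0 = x" "f k 1 = y" for k using g by (auto simp: f_def idx_def)
    then have "(\<lambda>k. x) \<longlonglongrightarrow> F 0" "(\<lambda>k. y) \<longlonglongrightarrow> F 1" using F[of 0] F[of 1] by auto
    then show "F 0 = x" "F 1 = y" by (auto dest: LIMSEQ_const_iff[THEN iffD1])
  qed
  have osc: "dist (f k s) (f k t) \<le> \<tau> k" if "s \<in> {0..1}" "t \<in> {0..1}" "s \<le> t" "t - s < 1 / L k" for k s t
  proof -
    have "(t - s) * L k < 1" using that(4) g(1)[of k] by (simp add: field_simps)
    then have "t * L k < s * L k + 1" by (simp add: algebra_simps)
    moreover have "s * L k \<le> t * L k" using that by (intro mult_right_mono) auto
    ultimately have "\<lfloor>t * L k\<rfloor> = \<lfloor>s * L k\<rfloor> \<or> \<lfloor>t * L k\<rfloor> = \<lfloor>s * L k\<rfloor> + 1" by linarith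
    moreover have "0 \<le> \<lfloor>s * L k\<rfloor>" using that by simp
    ultimately have "idx k t = idx k s \<or> idx k t = Suc (idx k s)"
      using nat_add_distrib[of "\<lfloor>s * L k\<rfloor>" 1] unfolding idx_def by auto
    then show ?thesis
    proof
      assume "idx k t = idx k s"
      then show ?thesis using \<tau>[of k] by (simp add: f_def)
    next
      assume e: "idx k t = Suc (idx k s)"
      then have "idx k s < L k" using idx_le[OF that(2), of k] by simp
      then show ?thesis using g(5)[of "idx k s" k] e by (simp add: f_def)
    qed
  qed
  have unif: "dist (F s) (F t) \<le> 5 * K * \<tau> k" if "s \<in> {0..1}" "t \<in> {0..1}" "\<bar>t - s\<bar> < 1 / L k" for k s t
  proof -
    have "dist (f k s) (f k t) \<le> \<tau> k"
    proof (cases "s \<le> t")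
      case True
      then show ?thesis using osc[OF that(1,2)] that(3) by simp
    next
      case False
      then have "dist (f k t) (f k s) \<le> \<tau> k" using osc[OF that(2,1)] that(3) by simp
      then show ?thesis by (simp add: dist_commute)
    qed
    moreover have "\<tau> k \<le> K * \<tau> k" using K \<tau>[of k] by simp
    moreover have "dist (F s) (F t) \<le> dist (F s) (f k s) + dist (f k s) (f k t) + dist (F t) (f k t)"
      using dist_triangle[of "F s" "F t" "f k s"] dist_triangle2[of "f k s" "F t" "f k t"] by linarith
    ultimately show ?thesis using Ff[OF that(1), of k] Ff[OF that(2), of k] by linarith
  qed
  have "continuous_on {0..1} F"
    unfolding continuous_on_iff
  proof (intro ballI allI impI)
    fix t e :: real assume t: "t \<in> {0..1}" "0 < e"
    obtain k where k: "5 * K * \<tau> k < e" using small[OF t(2)] by blast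
    have "dist (F s) (F t) < e" if "s \<in> {0..1}" "dist s t < 1 / L k" for s
      using unif[OF that(1) t(1), of k] that(2) k by (simp add: dist_real_def abs_minus_commute)
    then show "\<exists>d>0. \<forall>s\<in>{0..1}. dist s t < d \<longrightarrow> dist (F s) (F t) < e"
      using g(1)[of k] by (intro exI[of _ "1 / L k"]) auto
  qed
  moreover have "dist x (F t) \<le> 3 * K * dist x y" if t: "t \<in> {0..1}" for t
  proof -
    have "f 0 t = x \<or> f 0 t = y" using s(2) by (auto simp: f_def c_def c0_def)
    then have "dist x (f 0 t) \<le> dist x y" by auto
    moreover have "dist x y \<le> K * dist x y" using K by (simp add: mult_le_cancel_right1)
    moreover have "dist x (F t) \<le> dist x (f 0 t) + dist (F t) (f 0 t)" by (rule dist_triangle2)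
    ultimately show ?thesis using Ff[OF t, of 0] by (simp add: \<tau>_def)
  qed
  ultimately have "path F" "path_image F \<subseteq> Y \<inter> cball x (3 * K * dist x y)"
    using F by (auto simp: path_def path_image_def)
  then show ?thesis using ends unfolding pathstart_def pathfinish_def by blast
qed

section \<open>Arcs in compact trees\<close>

text \<open>The tree sits in a complete normed space, so that paths and arcs of the type-class
  theory can be used. Of bounded turning only connectedness and the diameter bound are retained, and
  \<open>packing\<close> is the form in which the doubling property is used.\<close>

locale arc_tree =
  fixes Y :: "'b::{complete_space,real_normed_vector} set" and K :: real
  assumes compact_Y: "compact Y"
    and K1: "1 \<le> K"
    and turning: "\<And>x y. x \<in> Y \<Longrightarrow> y \<in> Y \<Longrightarrow>
      \<exists>E\<subseteq>Y. connected E \<and> x \<in> E \<and> y \<in> E \<and> (\<forall>u\<in>E. \<forall>v\<in>E. dist u v \<le> K * dist x y)"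
    and arc_ex: "\<And>x y. x \<in> Y \<Longrightarrow> y \<in> Y \<Longrightarrow> x \<noteq> y \<Longrightarrow>
      \<exists>g. arc g \<and> path_image g \<subseteq> Y \<and> pathstart g = x \<and> pathfinish g = y"
    and arc_unique: "\<And>g h. arc g \<Longrightarrow> path_image g \<subseteq> Y \<Longrightarrow> arc h \<Longrightarrow> path_image h \<subseteq> Y \<Longrightarrow>
      pathstart g = pathstart h \<Longrightarrow> pathfinish g = pathfinish h \<Longrightarrow> path_image g = path_image h"
    and packing: "\<And>q::real. \<exists>M::nat. \<forall>r>0. \<forall>x\<in>Y. \<forall>F. finite F \<and> F \<subseteq> Y \<and> (\<forall>y\<in>F. dist x y \<le> q * r) \<and>
      (\<forall>y\<in>F. \<forall>z\<in>F. y \<noteq> z \<longrightarrow> r \<le> dist y z) \<longrightarrow> card F \<le> M"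
begin

definition seg :: "'b \<Rightarrow> 'b \<Rightarrow> 'b set" where
  "seg x y = (if x = y then {x} else
     path_image (SOME g. arc g \<and> path_image g \<subseteq> Y \<and> pathstart g = x \<and> pathfinish g = y))"

lemma seg_self [simp]: "seg x x = {x}" by (simp add: seg_def)

lemma seg_arc:
  assumes "arc g" "path_image g \<subseteq> Y"
  shows "seg (pathstart g) (pathfinish g) = path_image g"
proof -
  let ?P = "\<lambda>h. arc h \<and> path_image h \<subseteq> Y \<and> pathstart h = pathstart g \<and> pathfinish h = pathfinish g"
  have "?P (SOME h. ?P h)" by (rule someI[of ?P g]) (use assms in simp)
  then have "path_image (SOME h. ?P h) = path_image g" using arc_unique[of "SOME h. ?P h" g] assms by simp
  then show ?thesis using arc_distinct_ends[OF assms(1)] by (simp add: seg_def)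
qed

lemma ex_seg_arc:
  assumes "x \<in> Y" "y \<in> Y" "x \<noteq> y"
  obtains g where "arc g" "path_image g = seg x y" "path_image g \<subseteq> Y" "pathstart g = x" "pathfinish g = y"
  using arc_ex[OF assms] seg_arc by metis

lemma seg_subarc:
  assumes "arc g" "path_image g \<subseteq> Y" "0 \<le> s" "s \<le> t" "t \<le> 1"
  shows "seg (g s) (g t) = g ` {s..t}"
proof (cases "s = t")
  case False
  have "arc (subpath s t g)" using arc_subpath_arc[OF assms(1), of s t] assms False by simp
  moreover have "path_image (subpath s t g) = g ` {s..t}" using assms by (simp add: path_image_subpath)
  moreover have "g ` {s..t} \<subseteq> Y" using assms by (auto simp: path_image_def)
  ultimately show ?thesis using seg_arc[of "subpath s t g"] by simp
qed simp

text \<open>Degenerate arcs are included through the constant map. The description of all subarcs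
  does most of the work of injectivity and holds in the degenerate case as well.\<close>

lemma seg_param:
  assumes "x \<in> Y" "y \<in> Y"
  obtains g where "continuous_on {0..1::real} g" "g 0 = x" "g 1 = y" "seg x y = g ` {0..1}" "g ` {0..1} \<subseteq> Y"
    "\<And>s t. 0 \<le> s \<Longrightarrow> s \<le> t \<Longrightarrow> t \<le> 1 \<Longrightarrow> seg (g s) (g t) = g ` {s..t}"
    "x \<noteq> y \<Longrightarrow> inj_on g {0..1}"
proof (cases "x = y")
  case True
  show ?thesis by (rule that[of "\<lambda>_. x"]) (use True assms in \<open>auto simp: image_constant_conv\<close>)
next
  case False
  obtain g where g: "arc g" "path_image g = seg x y" "path_image g \<subseteq> Y" "pathstart g = x" "pathfinish g = y"
    using ex_seg_arc[OF assms False] by blast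
  have inj: "inj_on g {0..1}" and cont: "continuous_on {0..1} g"
    using g(1) by (auto simp: arc_def path_def)
  show ?thesis
  proof (rule that[OF cont _ _ _ _ _ inj])
    show "g 0 = x" "g 1 = y" "seg x y = g ` {0..1}" "g ` {0..1} \<subseteq> Y"
      using g by (auto simp: pathstart_def pathfinish_def path_image_def)
    fix s t :: real assume st: "0 \<le> s" "s \<le> t" "t \<le> 1"
    show "seg (g s) (g t) = g ` {s..t}" by (rule seg_subarc[OF g(1,3) st])
  qed
qed

lemma seg_props:
  assumes "x \<in> Y" "y \<in> Y"
  shows seg_sub: "seg x y \<subseteq> Y" and seg_ends: "x \<in> seg x y" "y \<in> seg x y" and seg_compact: "compact (seg x y)"
    and seg_bounded: "bounded (seg x y)"
proof -
  obtain g where g: "continuous_on {0..1::real} g" "g 0 = x" "g 1 = y" "seg x y = g ` {0..1}" "g ` {0..1} \<subseteq> Y"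
    using seg_param[OF assms] by metis
  show "seg x y \<subseteq> Y" using g by simp
  show "x \<in> seg x y" "y \<in> seg x y" unfolding g(4) using g(2,3) by force+
  show "compact (seg x y)" unfolding g(4) by (rule compact_continuous_image[OF g(1)]) simp
  then show "bounded (seg x y)" by (rule compact_imp_bounded)
qed

lemma seg_commute: "x \<in> Y \<Longrightarrow> y \<in> Y \<Longrightarrow> seg x y = seg y x"
proof (cases "x = y")
  case False
  assume xy: "x \<in> Y" "y \<in> Y"
  obtain g where g: "arc g" "path_image g = seg x y" "path_image g \<subseteq> Y" "pathstart g = x" "pathfinish g = y"
    using ex_seg_arc[OF xy False] by blast
  then show ?thesis using seg_arc[OF arc_reversepath[OF g(1)]] by simp
qed simp

lemma seg_split:
  assumes "x \<in> Y" "y \<in> Y" "z \<in> seg x y"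
  shows "seg x y = seg x z \<union> seg z y" "seg x z \<inter> seg z y = {z}"
proof -
  obtain g where g: "g 0 = x" "g 1 = y" "seg x y = g ` {0..1::real}"
    "\<And>s t. 0 \<le> s \<Longrightarrow> s \<le> t \<Longrightarrow> t \<le> 1 \<Longrightarrow> seg (g s) (g t) = g ` {s..t}"
    "x \<noteq> y \<Longrightarrow> inj_on g {0..1}"
    using seg_param[OF assms(1,2)] by metis
  obtain s where s: "0 \<le> s" "s \<le> 1" "z = g s" using assms(3) g(3) by auto
  have 1: "seg x z = g ` {0..s}" "seg z y = g ` {s..1}" using g(4)[of 0 s] g(4)[of s 1] g(1,2) s by auto
  have "{0..1} = {0..s} \<union> {s..1}" using s by auto
  then show "seg x y = seg x z \<union> seg z y" using 1 g(3) by (metis image_Un)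
  show "seg x z \<inter> seg z y = {z}"
  proof (cases "x = y")
    case True
    then show ?thesis using assms(3) by simp
  next
    case False
    have "{0..s} \<inter> {s..1} = {s}" using s by auto
    moreover have "g ` {0..s} \<inter> g ` {s..1} = g ` ({0..s} \<inter> {s..1})"
      using inj_on_image_Int[OF g(5)[OF False], of "{0..s}" "{s..1}"] s by auto
    ultimately show ?thesis using 1 s by simp
  qed
qed

lemma seg_join:
  assumes "x \<in> Y" "m \<in> Y" "y \<in> Y" "seg x m \<inter> seg m y \<subseteq> {m}"
  shows "seg x y = seg x m \<union> seg m y"
proof (cases "x = m \<or> m = y")
  case True
  then show ?thesis using seg_ends assms by auto
next
  case False
  obtain g where g: "arc g" "path_image g = seg x m" "path_image g \<subseteq> Y" "pathstart g = x" "pathfinish g = m"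
    using ex_seg_arc assms False by metis
  obtain h where h: "arc h" "path_image h = seg m y" "path_image h \<subseteq> Y" "pathstart h = m" "pathfinish h = y"
    using ex_seg_arc assms False by metis
  have "arc (g +++ h)" by (rule arc_join) (use g h assms in auto)
  moreover have "path_image (g +++ h) = seg x m \<union> seg m y" using g h by (simp add: path_image_join)
  ultimately show ?thesis using seg_arc[of "g +++ h"] g h by simp
qed

section \<open>The order and the meets seen from a root\<close>

definition le :: "'b \<Rightarrow> 'b \<Rightarrow> 'b \<Rightarrow> bool" where
  "le p x y \<longleftrightarrow> x \<in> Y \<and> y \<in> Y \<and> x \<in> seg p y"

lemma le_antisym:
  assumes "p \<in> Y" "le p x y" "le p y x" shows "x = y"
proof -
  have xy: "x \<in> Y" "y \<in> Y" "x \<in> seg p y" "y \<in> seg p x" using assms by (auto simp: le_def)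
  then show ?thesis using seg_split(2)[OF assms(1) xy(2,3)] seg_ends(2)[OF xy(1,2)] by auto
qed

lemma le_trans:
  assumes "p \<in> Y" "le p x y" "le p y z" shows "le p x z"
  using assms seg_split(1)[of p z y] by (auto simp: le_def)

lemma le_linear:
  assumes "p \<in> Y" "le p x z" "le p y z" shows "le p x y \<or> le p y x"
proof -
  have z: "z \<in> Y" "x \<in> Y" "y \<in> Y" using assms by (auto simp: le_def)
  obtain g where g: "g 0 = p" "seg p z = g ` {0..1::real}"
    "\<And>s t. 0 \<le> s \<Longrightarrow> s \<le> t \<Longrightarrow> t \<le> 1 \<Longrightarrow> seg (g s) (g t) = g ` {s..t}"
    using seg_param[OF assms(1) z(1)] by metis
  obtain s t where st: "0 \<le> s" "s \<le> 1" "x = g s" "0 \<le> t" "t \<le> 1" "y = g t"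
    using assms(2,3) g(2) by (auto simp: le_def)
  show ?thesis
  proof (cases "s \<le> t")
    case True
    then have "x \<in> seg p y" using g(3)[of 0 t] g(1) st by auto
    then show ?thesis using z by (simp add: le_def)
  next
    case False
    then have "y \<in> seg p x" using g(3)[of 0 s] g(1) st by auto
    then show ?thesis using z by (simp add: le_def)
  qed
qed

lemma le_between:
  assumes "p \<in> Y" "le p x z"
  shows "y \<in> seg x z \<longleftrightarrow> le p x y \<and> le p y z"
proof -
  have xz: "x \<in> Y" "z \<in> Y" "x \<in> seg p z" using assms by (auto simp: le_def)
  note sp = seg_split[OF assms(1) xz(2,3)]
  show ?thesis
  proof
    assume y: "y \<in> seg x z"
    then have "y \<in> Y" using seg_sub xz by blast
    then have yz: "le p y z" using y sp(1) xz by (auto simp: le_def)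
    have "le p x y"
    proof (cases "le p y x")
      case True
      then have "y = x" using y sp(2) by (auto simp: le_def)
      then show ?thesis using True by simp
    qed (use le_linear[OF assms(1) assms(2) yz] in auto)
    then show "le p x y \<and> le p y z" using yz by simp
  next
    assume y: "le p x y \<and> le p y z"
    show "y \<in> seg x z"
    proof (cases "y \<in> seg p x")
      case True
      then have "le p y x" using y xz by (auto simp: le_def)
      then have "y = x" using le_antisym[OF assms(1)] y by blast
      then show ?thesis using seg_ends xz by blast
    next
      case False
      then show ?thesis using y sp(1) by (auto simp: le_def)
    qed
  qed
qed

text \<open>The meet is the last point of the arc from \<open>p\<close> to \<open>x\<close> that
  lies on the arc from \<open>p\<close> to \<open>y\<close>; it exists because the parameters of
  common points form a compact set. Every other common ancestor has a smaller parameter.\<close>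

lemma ex_meet:
  assumes "p \<in> Y" "x \<in> Y" "y \<in> Y"
  shows "\<exists>m. le p m x \<and> le p m y \<and> (\<forall>z. le p z x \<and> le p z y \<longrightarrow> le p z m)"
proof -
  obtain g where g: "continuous_on {0..1::real} g" "g 0 = p" "seg p x = g ` {0..1}" "g ` {0..1} \<subseteq> Y"
    "\<And>s t. 0 \<le> s \<Longrightarrow> s \<le> t \<Longrightarrow> t \<le> 1 \<Longrightarrow> seg (g s) (g t) = g ` {s..t}"
    using seg_param[OF assms(1,2)] by metis
  define S where "S = {0..1} \<inter> g -` seg p y"
  have "closed S" unfolding S_def
    by (rule continuous_closed_preimage[OF g(1)]) (auto intro: compact_imp_closed seg_compact assms)
  then have "compact S" unfolding S_def using closed_Int_compact compact_Icc
    by (metis inf.left_idem inf_commute S_def)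
  moreover have "0 \<in> S" using g(2) seg_ends assms by (auto simp: S_def)
  ultimately obtain s where s: "s \<in> S" "\<forall>t\<in>S. t \<le> s" using compact_attains_sup[of S] by blast
  have s01: "0 \<le> s" "s \<le> 1" "g s \<in> seg p y" using s by (auto simp: S_def)
  have m: "le p (g s) x" "le p (g s) y" using s01 g(3,4) assms by (auto simp: le_def)
  moreover have "le p z (g s)" if z: "le p z x" "le p z y" for z
  proof -
    obtain t where t: "0 \<le> t" "t \<le> 1" "z = g t" using z(1) g(3) by (auto simp: le_def)
    then have "t \<in> S" using z(2) by (auto simp: S_def le_def)
    then have "z \<in> seg p (g s)" using g(5)[of 0 s] g(2) s s01 t by auto
    then show ?thesis using z(1) m(1) by (auto simp: le_def)
  qed
  ultimately show ?thesis by blast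
qed

definition mt :: "'b \<Rightarrow> 'b \<Rightarrow> 'b \<Rightarrow> 'b" where
  "mt p x y = (SOME m. le p m x \<and> le p m y \<and> (\<forall>z. le p z x \<and> le p z y \<longrightarrow> le p z m))"

lemma mt_props:
  assumes "p \<in> Y" "x \<in> Y" "y \<in> Y"
  shows "le p (mt p x y) x" "le p (mt p x y) y" "\<And>z. le p z x \<Longrightarrow> le p z y \<Longrightarrow> le p z (mt p x y)"
    "mt p x y \<in> Y"
  using someI_ex[OF ex_meet[OF assms]] unfolding mt_def[symmetric] by (auto simp: le_def)

text \<open>A common point of both legs is a common ancestor of \<open>x\<close> and
  \<open>y\<close> above the meet, hence equals the meet. So the legs join to an arc, which is the
  arc from \<open>x\<close> to \<open>y\<close> by uniqueness.\<close>

lemma seg_mt: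
  assumes "p \<in> Y" "x \<in> Y" "y \<in> Y"
  shows "seg x y = seg (mt p x y) x \<union> seg (mt p x y) y"
proof -
  note m = mt_props[OF assms]
  have "seg x (mt p x y) \<inter> seg (mt p x y) y \<subseteq> {mt p x y}"
  proof
    fix u assume u: "u \<in> seg x (mt p x y) \<inter> seg (mt p x y) y"
    then have "u \<in> seg (mt p x y) x" using seg_commute assms m(4) by blast
    then have "le p u x" "le p (mt p x y) u" "le p u y" using u le_between[OF assms(1)] m by blast+
    then show "u \<in> {mt p x y}" using m(3) le_antisym[OF assms(1)] by blast
  qed
  then have "seg x y = seg x (mt p x y) \<union> seg (mt p x y) y" by (rule seg_join[OF assms(2) m(4) assms(3)])
  then show ?thesis using seg_commute[OF assms(2) m(4)] by simp
qed

lemma seg_triangle: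
  assumes "x \<in> Y" "y \<in> Y" "z \<in> Y"
  shows "seg x z \<subseteq> seg x y \<union> seg y z"
proof -
  note m = mt_props[OF assms(2,1,3)]
  have "seg (mt y x z) x \<subseteq> seg y x" "seg (mt y x z) z \<subseteq> seg y z"
    using seg_split(1)[OF assms(2)] m assms by (auto simp: le_def)
  then show ?thesis using seg_mt[OF assms(2,1,3)] seg_commute[OF assms(1,2)] by auto
qed

section \<open>The arc-diameter metric\<close>

definition dm :: "'b \<Rightarrow> 'b \<Rightarrow> real" where
  "dm x y = diameter (seg x y)"

lemma dm_ge: "x \<in> Y \<Longrightarrow> y \<in> Y \<Longrightarrow> u \<in> seg x y \<Longrightarrow> v \<in> seg x y \<Longrightarrow> dist u v \<le> dm x y"
  unfolding dm_def using diameter_bounded_bound seg_bounded by blast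

lemma dist_le_dm: "x \<in> Y \<Longrightarrow> y \<in> Y \<Longrightarrow> dist x y \<le> dm x y"
  using dm_ge seg_ends by simp

lemma dm_le: "x \<in> Y \<Longrightarrow> y \<in> Y \<Longrightarrow> (\<And>u v. u \<in> seg x y \<Longrightarrow> v \<in> seg x y \<Longrightarrow> dist u v \<le> c) \<Longrightarrow> dm x y \<le> c"
  unfolding dm_def using seg_ends(1)[of x y] by (intro diameter_le) (auto simp flip: dist_norm)

lemma dm_mono: "seg u v \<subseteq> seg x y \<Longrightarrow> x \<in> Y \<Longrightarrow> y \<in> Y \<Longrightarrow> dm u v \<le> dm x y"
  unfolding dm_def using diameter_subset seg_bounded by blast

lemma dm_self [simp]: "dm x x = 0" by (simp add: dm_def)

lemma dm_commute: "x \<in> Y \<Longrightarrow> y \<in> Y \<Longrightarrow> dm x y = dm y x" by (simp add: dm_def seg_commute)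

lemma dm_nonneg: "x \<in> Y \<Longrightarrow> y \<in> Y \<Longrightarrow> 0 \<le> dm x y"
  using dist_le_dm[of x y] by (meson order_trans zero_le_dist)

lemma dm_triangle:
  assumes "x \<in> Y" "y \<in> Y" "z \<in> Y"
  shows "dm x z \<le> dm x y + dm y z"
proof (rule dm_le[OF assms(1,3)])
  fix u v assume "u \<in> seg x z" "v \<in> seg x z"
  then have uv: "u \<in> seg x y \<or> u \<in> seg y z" "v \<in> seg x y \<or> v \<in> seg y z" using seg_triangle[OF assms] by auto
  note b = dm_ge[OF assms(1,2)] dm_ge[OF assms(2,3)]
  note e = seg_ends[OF assms(1,2)] seg_ends[OF assms(2,3)]
  have nn: "0 \<le> dm x y" "0 \<le> dm y z" using dm_nonneg assms by auto
  have "dist u v \<le> dist u y + dist v y" by (rule dist_triangle2)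
  from uv show "dist u v \<le> dm x y + dm y z"
  proof (elim disjE)
    assume "u \<in> seg x y" "v \<in> seg y z"
    then show ?thesis using b(1)[of u y] b(2)[of v y] e \<open>dist u v \<le> dist u y + dist v y\<close> by linarith
  next
    assume "u \<in> seg y z" "v \<in> seg x y"
    then show ?thesis using b(2)[of u y] b(1)[of v y] e \<open>dist u v \<le> dist u y + dist v y\<close> by linarith
  next
    assume "u \<in> seg x y" "v \<in> seg x y"
    then show ?thesis using b(1)[of u v] nn by linarith
  next
    assume "u \<in> seg y z" "v \<in> seg y z"
    then show ?thesis using b(2)[of u v] nn by linarith
  qed
qed

text \<open>The arc contained in the path of \<open>bounded_turning_path\<close> stays in a ball of
  radius \<open>3 * K * dist x y\<close> and is the arc of the tree by uniqueness. Together with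
  \<open>dist_le_dm\<close> this makes both metrics bi-Lipschitz equivalent.\<close>

lemma dm_le_dist:
  assumes "x \<in> Y" "y \<in> Y"
  shows "dm x y \<le> 6 * K * dist x y"
proof (cases "x = y")
  case False
  obtain f where f: "path f" "pathstart f = x" "pathfinish f = y" "path_image f \<subseteq> Y \<inter> cball x (3 * K * dist x y)"
    using bounded_turning_path[OF compact_Y turning K1 assms False] by blast
  obtain q where q: "arc q" "path_image q \<subseteq> path_image f" "pathstart q = x" "pathfinish q = y"
    using path_contains_arc[OF f(1-3) False] by blast
  have "seg x y = path_image q" using seg_arc[OF q(1)] q f(4) by auto
  then have s: "seg x y \<subseteq> cball x (3 * K * dist x y)" using q f by auto
  show ?thesis
  proof (rule dm_le[OF assms])
    fix u v assume "u \<in> seg x y" "v \<in> seg x y"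
    then have "dist x u \<le> 3 * K * dist x y" "dist x v \<le> 3 * K * dist x y" using s by auto
    then show "dist u v \<le> 6 * K * dist x y" using dist_triangle3[of u v x] by linarith
  qed
qed simp

lemma dm_continuous:
  assumes "x \<in> Y" shows "continuous_on Y (dm x)"
proof (rule continuous_on_iff[THEN iffD2], intro ballI allI impI)
  fix a e assume a: "a \<in> Y" "(0::real) < e"
  have "dist (dm x b) (dm x a) < e" if b: "b \<in> Y" "dist b a < e / (6 * K)" for b
  proof -
    have "\<bar>dm x b - dm x a\<bar> \<le> dm a b"
      using dm_triangle[OF assms a(1) b(1)] dm_triangle[OF assms b(1) a(1)] dm_commute[OF a(1) b(1)] by linarith
    also have "\<dots> \<le> 6 * K * dist a b" using dm_le_dist a b by blast
    also have "\<dots> < e" using b(2) K1 by (simp add: dist_commute field_simps)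
    finally show ?thesis by (simp add: dist_real_def)
  qed
  then show "\<exists>d>0. \<forall>b\<in>Y. dist b a < d \<longrightarrow> dist (dm x b) (dm x a) < e"
    using a K1 by (intro exI[of _ "e / (6 * K)"]) auto
qed

text \<open>An ordinary finite net is not enough, because the nearby point has to be an ancestor. A
  point \<open>x\<close> close to a net point \<open>f\<close> is also close to its meet with
  \<open>f\<close>, and this meet lies on the arc from \<open>p\<close> to \<open>f\<close>.
  Subdividing these finitely many arcs finely gives an ancestor close to the meet; each of the two
  errors is at most \<open>\<tau> / 2\<close>.\<close>

lemma ancestor_net:
  assumes p: "p \<in> Y" and \<tau>: "0 < \<tau>"
  shows "\<exists>U. finite U \<and> p \<in> U \<and> U \<subseteq> Y \<and> (\<forall>x\<in>Y. \<exists>u\<in>U. le p u x \<and> dm u x \<le> \<tau>)"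
proof -
  define e where "e = \<tau> / (12 * K)"
  have e: "0 < e" "6 * K * e = \<tau> / 2" using \<tau> K1 by (auto simp: e_def)
  obtain F where F: "F \<subseteq> Y" "finite F" "Y \<subseteq> (\<Union>f\<in>F. ball f e)"
    by (rule compactE_image[OF compact_Y, of Y "\<lambda>f. ball f e"]) (use e in auto)
  have "\<exists>U. finite U \<and> U \<subseteq> Y \<and> (\<forall>m. le p m f \<longrightarrow> (\<exists>u\<in>U. le p u m \<and> dm u m \<le> \<tau> / 2))" if f: "f \<in> F" for f
  proof -
    have fY: "f \<in> Y" using f F by auto
    obtain g where g: "continuous_on {0..1::real} g" "g 0 = p" "seg p f = g ` {0..1}" "g ` {0..1} \<subseteq> Y"
      "\<And>s t. 0 \<le> s \<Longrightarrow> s \<le> t \<Longrightarrow> t \<le> 1 \<Longrightarrow> seg (g s) (g t) = g ` {s..t}"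
      using seg_param[OF p fY] by metis
    have "uniformly_continuous_on {0..1} g" by (rule compact_uniformly_continuous[OF g(1)]) simp
    then obtain d where d: "0 < d" "\<And>s t. s \<in> {0..1} \<Longrightarrow> t \<in> {0..1} \<Longrightarrow> dist s t < d \<Longrightarrow> dist (g s) (g t) < e"
      using e(1) unfolding uniformly_continuous_on_def by metis
    obtain n :: nat where n': "1 / d < n" using reals_Archimedean2 by blast
    moreover have "0 < 1 / d" using d(1) by simp
    ultimately have "0 < real n" by (rule less_trans[rotated])
    with n' have n: "0 < n" "1 / d < n" by auto
    define U where "U = (\<lambda>i. g (real i / n)) ` {..n}"
    have "\<exists>u\<in>U. le p u m \<and> dm u m \<le> \<tau> / 2" if m: "le p m f" for m
    proof -
      obtain s where s: "0 \<le> s" "s \<le> 1" "m = g s" using m g(3) by (auto simp: le_def)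
      define i where "i = nat \<lfloor>s * n\<rfloor>"
      have i: "real i \<le> s * n" "s * n < real i + 1" using s unfolding i_def by (auto simp: of_nat_nat)
      have "s * n \<le> n" using s by (intro mult_left_le_one_le) auto
      then have "i \<le> n" using i by linarith
      have ist: "real i / n \<le> s" "s - real i / n < d" "0 \<le> real i / n"
      proof -
        show "real i / n \<le> s" using i n by (simp add: pos_divide_le_eq)
        have "(s - real i / n) * n < 1" using i n by (simp add: algebra_simps)
        then have "s - real i / n < 1 / n" using n by (simp add: pos_less_divide_eq)
        also have "1 / n < d" using n d by (simp add: field_simps)
        finally show "s - real i / n < d" .
      qed simp
      let ?u = "g (real i / n)"
      have uY: "?u \<in> Y" "m \<in> Y" using g(4) ist s by auto
      have "?u \<in> seg p m" using g(5)[of 0 s] g(2) s ist by auto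
      then have "le p ?u m" using uY by (simp add: le_def)
      moreover have "dist ?u m < e" using d(2)[of "real i / n" s] ist s by (simp add: dist_real_def)
      then have "6 * K * dist ?u m \<le> 6 * K * e" using K1 by (intro mult_left_mono) auto
      then have "dm ?u m \<le> \<tau> / 2" using dm_le_dist[OF uY] e(2) by linarith
      moreover have "?u \<in> U" using \<open>i \<le> n\<close> by (auto simp: U_def)
      ultimately show ?thesis by blast
    qed
    moreover have "finite U" "U \<subseteq> Y" using g(4) n by (auto simp: U_def image_subset_iff)
    ultimately show ?thesis by blast
  qed
  then obtain U where U: "\<And>f. f \<in> F \<Longrightarrow> finite (U f) \<and> U f \<subseteq> Y \<and>
    (\<forall>m. le p m f \<longrightarrow> (\<exists>u\<in>U f. le p u m \<and> dm u m \<le> \<tau> / 2))" by metis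
  have "\<exists>u\<in>insert p (\<Union>f\<in>F. U f). le p u x \<and> dm u x \<le> \<tau>" if x: "x \<in> Y" for x
  proof -
    obtain f where f: "f \<in> F" "dist f x < e" using F(3) x by auto
    have fY: "f \<in> Y" using f F by auto
    note m = mt_props[OF p x fY]
    obtain u where u: "u \<in> U f" "le p u (mt p x f)" "dm u (mt p x f) \<le> \<tau> / 2" using U[OF f(1)] m(2) by blast
    have uY: "u \<in> Y" using u(2) by (simp add: le_def)
    have "dm (mt p x f) x \<le> dm x f" by (rule dm_mono) (use seg_mt[OF p x fY] x fY in auto)
    also have "\<dots> \<le> 6 * K * dist x f" using dm_le_dist x fY by blast
    also have "\<dots> \<le> 6 * K * e" using f(2) K1 by (intro mult_left_mono) (auto simp: dist_commute)
    finally have "dm (mt p x f) x \<le> \<tau> / 2" using e(2) by simp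
    then have "dm u x \<le> \<tau>" using dm_triangle[OF uY m(4) x] u(3) by linarith
    moreover have "le p u x" using le_trans[OF p u(2) m(1)] .
    ultimately show ?thesis using u f by blast
  qed
  moreover have "finite (insert p (\<Union>f\<in>F. U f))" "insert p (\<Union>f\<in>F. U f) \<subseteq> Y" using F U p by auto
  ultimately show ?thesis by blast
qed

lemma rooted_tree:
  assumes p: "p \<in> Y"
  shows "rooted_tree Y (le p) (mt p) p dm"
proof
  show "p \<in> Y" by (rule p)
  show "le p p x" if "x \<in> Y" for x using that p seg_ends by (simp add: le_def)
  show "x \<in> Y \<and> y \<in> Y" if "le p x y" for x y using that by (simp add: le_def)
  show "le p x x" if "x \<in> Y" for x using that p seg_ends by (simp add: le_def)
  show "x = y" if "le p x y" "le p y x" for x y using le_antisym[OF p that] .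
  show "le p x z" if "le p x y" "le p y z" for x y z using le_trans[OF p that] .
  show "le p x y \<or> le p y x" if "le p x z" "le p y z" for x y z using le_linear[OF p that] .
  show "le p (mt p x y) x \<and> le p (mt p x y) y" if "x \<in> Y" "y \<in> Y" for x y using mt_props[OF p that] by simp
  show "le p z (mt p x y)" if "le p z x" "le p z y" for x y z
  proof -
    have "x \<in> Y" "y \<in> Y" using that by (auto simp: le_def)
    then show ?thesis using mt_props(3)[OF p] that by blast
  qed
  show "dm x x = 0" for x by simp
  show "dm x y = dm y x" if "x \<in> Y" "y \<in> Y" for x y using dm_commute that .
  show "0 \<le> dm x y" if "x \<in> Y" "y \<in> Y" for x y using dm_nonneg that .
  show "dm x z \<le> dm x y + dm y z" if "x \<in> Y" "y \<in> Y" "z \<in> Y" for x y z using dm_triangle that .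
  have mono: "dm x y \<le> dm x z \<and> dm y z \<le> dm x z" if "le p x y" "le p y z" for x y z
  proof -
    have Y: "x \<in> Y" "z \<in> Y" using that by (auto simp: le_def)
    have "y \<in> seg x z" using le_between[OF p le_trans[OF p that]] that by blast
    then show ?thesis using dm_mono Y seg_split(1)[OF Y] by blast
  qed
  then show "dm x y \<le> dm x z" "dm y z \<le> dm x z" if "le p x y" "le p y z" for x y z using that by blast+
  show "dm x (mt p x y) \<le> dm x y" if "x \<in> Y" "y \<in> Y" for x y
  proof (rule dm_mono)
    show "seg x (mt p x y) \<subseteq> seg x y"
      using seg_mt[OF p that] seg_commute[OF that(1) mt_props(4)[OF p that]] by simp
  qed (use that in auto)
  show "\<exists>y. le p x y \<and> le p y z \<and> dm x y = r" if xz: "le p x z" "0 \<le> r" "r \<le> dm x z" for x z r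
  proof -
    have Y: "x \<in> Y" "z \<in> Y" using xz by (auto simp: le_def)
    obtain g where g: "continuous_on {0..1::real} g" "g 0 = x" "g 1 = z" "seg x z = g ` {0..1}" "g ` {0..1} \<subseteq> Y"
      using seg_param[OF Y] by metis
    have "continuous_on {0..1} (\<lambda>t. dm x (g t))"
      using continuous_on_compose2[OF dm_continuous[OF Y(1)] g(1)] g(5) by auto
    then obtain t where t: "0 \<le> t" "t \<le> 1" "dm x (g t) = r"
      using IVT'[of "\<lambda>t. dm x (g t)" 0 r 1] g(2,3) xz by auto
    then have "g t \<in> seg x z" using g(4) by auto
    then show ?thesis using le_between[OF p xz(1)] t(3) by blast
  qed
  show "\<exists>U. finite U \<and> p \<in> U \<and> U \<subseteq> Y \<and> (\<forall>x\<in>Y. \<exists>u\<in>U. le p u x \<and> dm u x \<le> \<tau>)" if "0 < \<tau>" for \<tau>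
    using ancestor_net[OF p that] .
  show "\<exists>M::nat. \<forall>r>0. \<forall>x\<in>Y. \<forall>F. finite F \<and> F \<subseteq> Y \<and> (\<forall>y\<in>F. dm x y \<le> q * r) \<and>
         (\<forall>y\<in>F. \<forall>z\<in>F. y \<noteq> z \<longrightarrow> r \<le> dm y z) \<longrightarrow> card F \<le> M" for q :: real
  proof -
    \<comment> \<open>Points that are \<open>r\<close> apart for \<open>dm\<close> are
      \<open>r / (6 * K)\<close> apart for \<open>dist\<close>; in that unit the radius
      \<open>q * r\<close> has the factor \<open>q * (6 * K)\<close>.\<close>
    from packing[of "q * (6 * K)"]
    obtain M :: nat where M: "\<forall>r>0. \<forall>x\<in>Y. \<forall>F. finite F \<and> F \<subseteq> Y \<and> (\<forall>y\<in>F. dist x y \<le> q * (6 * K) * r) \<and>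
      (\<forall>y\<in>F. \<forall>z\<in>F. y \<noteq> z \<longrightarrow> r \<le> dist y z) \<longrightarrow> card F \<le> M" ..
    have "card F \<le> M" if r: "0 < r" and x: "x \<in> Y" and F: "finite F" "F \<subseteq> Y" "\<forall>y\<in>F. dm x y \<le> q * r"
      "\<forall>y\<in>F. \<forall>z\<in>F. y \<noteq> z \<longrightarrow> r \<le> dm y z" for r x F
    proof (rule M[rule_format, of "r / (6 * K)" x])
      have K0: "0 < 6 * K" using K1 by simp
      show "0 < r / (6 * K)" using r K0 by simp
      have 1: "dist x y \<le> q * (6 * K) * (r / (6 * K))" if "y \<in> F" for y
        using dist_le_dm[OF x, of y] F(2,3) that K0 by fastforce
      have 2: "r / (6 * K) \<le> dist y z" if yz: "y \<in> F" "z \<in> F" "y \<noteq> z" for y z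
      proof -
        have "r \<le> 6 * K * dist y z" using dm_le_dist[of y z] F(2,4) yz by fastforce
        then show ?thesis using K0 by (simp add: pos_divide_le_eq mult.commute)
      qed
      show "finite F \<and> F \<subseteq> Y \<and> (\<forall>y\<in>F. dist x y \<le> q * (6 * K) * (r / (6 * K))) \<and>
        (\<forall>y\<in>F. \<forall>z\<in>F. y \<noteq> z \<longrightarrow> r / (6 * K) \<le> dist y z)" by (intro conjI ballI impI F(1,2) 1 2)
    qed (rule x)
    then show ?thesis by blast
  qed
qed

end

section \<open>The geodesic metric\<close>

lemma geometric_level:
  fixes \<delta> R s :: real
  assumes "0 < \<delta>" "\<delta> < 1" "0 < s" "s < R"
  obtains n where "R * \<delta> ^ Suc n \<le> s" "s < R * \<delta> ^ n"
proof -
  have "(\<lambda>k. R * \<delta> ^ k) \<longlonglongrightarrow> R * 0" using assms by (intro tendsto_mult tendsto_const LIMSEQ_power_zero) auto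
  then have "eventually (\<lambda>k. R * \<delta> ^ k < s) sequentially" using assms by (intro order_tendstoD(2)) auto
  then obtain k where k: "R * \<delta> ^ k < s" by (auto simp: eventually_sequentially)
  define n where "n = (LEAST k. R * \<delta> ^ Suc k \<le> s)"
  have "R * \<delta> ^ Suc k \<le> R * \<delta> ^ k" using assms by (intro mult_left_mono power_decreasing) auto
  then have "R * \<delta> ^ Suc k \<le> s" using k by simp
  then have n: "R * \<delta> ^ Suc n \<le> s" unfolding n_def by (rule LeastI)
  have "s < R * \<delta> ^ n"
  proof (cases n)
    case 0
    then show ?thesis using assms by simp
  next
    case (Suc j)
    then have "\<not> R * \<delta> ^ Suc j \<le> s" using not_less_Least[of j "\<lambda>k. R * \<delta> ^ Suc k \<le> s"] by (simp add: n_def)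
    then show ?thesis using Suc by simp
  qed
  then show ?thesis using n that by blast
qed

text \<open>The exponent translates a factor \<open>a\<close> per level into a power of the scale,
  which shrinks by \<delta> per level.\<close>

lemma power_eq_powr_of_base:
  fixes a \<delta> :: real
  assumes "0 < \<delta>" "\<delta> < 1" "0 < a" "a < 1"
  shows "0 < ln a / ln \<delta>" "(\<delta> ^ j) powr (ln a / ln \<delta>) = a ^ j"
proof -
  have l: "ln \<delta> < 0" "ln a < 0" using assms by auto
  then show "0 < ln a / ln \<delta>" by (simp add: divide_neg_neg)
  have "(\<delta> ^ j) powr (ln a / ln \<delta>) = exp (ln a / ln \<delta> * (j * ln \<delta>))"
    using assms by (simp add: powr_def ln_realpow)
  also have "\<dots> = exp (j * ln a)" using l by simp
  also have "\<dots> = a ^ j" using assms by (simp add: exp_of_nat_mult)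
  finally show "(\<delta> ^ j) powr (ln a / ln \<delta>) = a ^ j" .
qed

context rooted_tree begin

lemma weights_power_bounds:
  assumes "tree_weights (\<lambda>n. True) R \<delta> \<epsilon> h W" "0 < \<epsilon>" "x \<in> T"
  shows "\<epsilon> ^ j * W n x \<le> W (n + j) x \<and> W (n + j) x \<le> (1/2) ^ j * W n x"
proof (induction j)
  case (Suc j)
  have "\<epsilon> * W (n + j) x \<le> W (Suc (n + j)) x" "W (Suc (n + j)) x \<le> W (n + j) x / 2"
    using assms(1,3) by (auto simp: tree_weights_def)
  moreover have "\<epsilon> * (\<epsilon> ^ j * W n x) \<le> \<epsilon> * W (n + j) x" using Suc assms(2) by (intro mult_left_mono) auto
  ultimately show ?case using Suc by simp
qed simp

text \<open>Both \<open>hdist h x y\<close> and \<open>hdist h x z\<close> are comparable to weights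
  at the same point \<open>x\<close>, at the levels \<open>n\<close> and \<open>k\<close> of the two
  distances. Only the change of weight between these levels matters: per level it is a factor
  between \<epsilon> and 1/2. If \<open>y\<close> is at the finer or the same level, the factor 1/2
  gives the exponent \<beta>; if \<open>z\<close> is at the finer level, the factor \<epsilon> gives
  the exponent \<gamma>.\<close>

lemma geodesic_height:
  assumes R: "0 < R" "\<And>x y. x \<in> T \<Longrightarrow> y \<in> T \<Longrightarrow> d x y < R"
    and pos: "\<And>x y. x \<in> T \<Longrightarrow> y \<in> T \<Longrightarrow> x \<noteq> y \<Longrightarrow> 0 < d x y" and \<alpha>: "1 < \<alpha>"
  obtains h A L \<beta> \<gamma> \<kappa> D where "height_fun h"
    "\<And>x y. x \<in> T \<Longrightarrow> y \<in> T \<Longrightarrow> x \<noteq> y \<Longrightarrow> 0 < hdist h x y"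
    "\<And>e. 0 < e \<Longrightarrow> \<exists>s>0. \<forall>x\<in>T. \<forall>y\<in>T. d x y < s \<longrightarrow> hdist h x y < e"
    "\<And>e. 0 < e \<Longrightarrow> \<exists>s>0. \<forall>x\<in>T. \<forall>y\<in>T. hdist h x y < s \<longrightarrow> d x y < e"
    "0 < A" "0 < L" "0 < \<beta>" "0 < \<gamma>"
    "\<And>x y z t. x \<in> T \<Longrightarrow> y \<in> T \<Longrightarrow> z \<in> T \<Longrightarrow> x \<noteq> y \<Longrightarrow> x \<noteq> z \<Longrightarrow> d x y \<le> t * d x z \<Longrightarrow>
       hdist h x y \<le> A * ((L * t) powr \<beta> + (L * t) powr \<gamma>) * hdist h x z"
    "0 < \<kappa>" "\<kappa> < (1::real)"
    "\<And>n. small_cover T (hdist h) \<alpha> (D * \<kappa> ^ n) n"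
proof -
  obtain \<delta> \<epsilon> \<kappa> h W where c: "0 < \<delta>" "\<delta> < 1" "0 < \<epsilon>" "\<epsilon> < 1" "0 < \<kappa>" "\<kappa> < 1"
    and tw: "tree_weights (\<lambda>n. True) R \<delta> \<epsilon> h W"
    and cells: "\<And>n. small_cover T (hdist h) \<alpha> (20 powr \<alpha> * 2 * \<kappa> ^ n) n"
    using limit_weights[OF R \<alpha>] by blast
  define B where "B = 20 / \<epsilon>^2"
  have B: "0 < B" using c by (simp add: B_def)
  have up: "hdist h x y \<le> B * W n x" if "x \<in> T" "y \<in> T" "d x y < R * \<delta> ^ n" for n x y
    using tw that unfolding tree_weights_def B_def by blast
  have low: "\<epsilon>^5 * W n x \<le> hdist h x y" if "x \<in> T" "y \<in> T" "R * \<delta> ^ Suc n \<le> d x y" "d x y < R * \<delta> ^ n" for n x y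
    using tw that unfolding tree_weights_def by blast
  have Wp: "0 < W n x" if "x \<in> T" for n x by (rule tree_weights_pos[OF tw c(3) _ that]) simp
  have W1: "W n x \<le> (1/2) ^ n" if "x \<in> T" for n x by (rule tree_weights_le[OF tw _ that]) simp
  have hf: "height_fun h" using tw by (simp add: tree_weights_def)
  have lev: "\<exists>n. R * \<delta> ^ Suc n \<le> d x y \<and> d x y < R * \<delta> ^ n" if "x \<in> T" "y \<in> T" "x \<noteq> y" for x y
    using geometric_level[OF c(1,2) pos[OF that] R(2)[OF that(1,2)]] by metis
  have hpos: "0 < hdist h x y" if xy: "x \<in> T" "y \<in> T" "x \<noteq> y" for x y
  proof -
    obtain n where "R * \<delta> ^ Suc n \<le> d x y" "d x y < R * \<delta> ^ n" using lev[OF xy] by blast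
    then have "\<epsilon>^5 * W n x \<le> hdist h x y" by (rule low[OF xy(1,2)])
    moreover have "0 < \<epsilon>^5 * W n x" using Wp[OF xy(1)] c by simp
    ultimately show ?thesis by simp
  qed
  have lim0: "\<exists>n. C * q ^ n < e" if "0 < q" "q < 1" "0 < e" for C q e :: real
  proof -
    have "(\<lambda>n. C * q ^ n) \<longlonglongrightarrow> C * 0" using that by (intro tendsto_mult tendsto_const LIMSEQ_power_zero) auto
    then have "eventually (\<lambda>n. C * q ^ n < e) sequentially" using that by (intro order_tendstoD(2)) auto
    then show ?thesis by (auto simp: eventually_sequentially)
  qed
  have top1: "\<exists>s>0. \<forall>x\<in>T. \<forall>y\<in>T. d x y < s \<longrightarrow> hdist h x y < e" if e: "0 < e" for e
  proof -
    obtain n where n: "B * (1/2) ^ n < e" using lim0[of "1/2" e B] e by auto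
    have "hdist h x y < e" if "x \<in> T" "y \<in> T" "d x y < R * \<delta> ^ n" for x y
    proof -
      have "B * W n x \<le> B * (1/2) ^ n" using W1[OF that(1)] B by (intro mult_left_mono) auto
      then show ?thesis using up[OF that] n by simp
    qed
    then show ?thesis using R c by (intro exI[of _ "R * \<delta> ^ n"]) auto
  qed
  have top2: "\<exists>s>0. \<forall>x\<in>T. \<forall>y\<in>T. hdist h x y < s \<longrightarrow> d x y < e" if e: "0 < e" for e
  proof -
    obtain n where n: "R * \<delta> ^ n < e" using lim0[OF c(1,2) e, of R] by auto
    have "d x y < e" if xy: "x \<in> T" "y \<in> T" "hdist h x y < \<epsilon> ^ (5 + n)" for x y
    proof (rule ccontr)
      assume "\<not> d x y < e"
      then have ge: "R * \<delta> ^ n < d x y" using n by simp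
      moreover have "0 < R * \<delta> ^ n" using R c by simp
      ultimately have "x \<noteq> y" using d_refl xy by fastforce
      then obtain k where k: "R * \<delta> ^ Suc k \<le> d x y" "d x y < R * \<delta> ^ k" using lev xy by blast
      have "k < n"
      proof (rule ccontr)
        assume "\<not> k < n"
        then have "R * \<delta> ^ k \<le> R * \<delta> ^ n" using R c by (intro mult_left_mono power_decreasing) auto
        then show False using k ge by simp
      qed
      then have "\<epsilon> ^ n \<le> \<epsilon> ^ k" using c by (intro power_decreasing) auto
      also have "\<dots> \<le> W k x" using weights_power_bounds[OF tw c(3) xy(1), where j = k and n = 0] tw xy(1)
        by (simp add: tree_weights_def)
      finally have "\<epsilon>^5 * \<epsilon> ^ n \<le> \<epsilon>^5 * W k x" using c by (intro mult_left_mono) auto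
      also have "\<dots> \<le> hdist h x y" by (rule low[OF xy(1,2) k])
      finally show False using xy(3) by (simp add: power_add)
    qed
    then show ?thesis using c by (intro exI[of _ "\<epsilon> ^ (5 + n)"]) auto
  qed
  define \<beta> where "\<beta> = ln (1/2) / ln \<delta>"
  define \<gamma> where "\<gamma> = ln \<epsilon> / ln \<delta>"
  have \<beta>: "0 < \<beta>" "\<And>j. (\<delta> ^ j) powr \<beta> = (1/2) ^ j"
    using power_eq_powr_of_base[OF c(1,2), of "1/2"] by (auto simp: \<beta>_def)
  have \<gamma>: "0 < \<gamma>" "\<And>j. (\<delta> ^ j) powr \<gamma> = \<epsilon> ^ j"
    using power_eq_powr_of_base[OF c(1,2,3,4)] by (auto simp: \<gamma>_def)
  define A where "A = B / \<epsilon>^5"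
  have A: "0 < A" using B c by (simp add: A_def)
  have qs: "hdist h x y \<le> A * ((1 / \<delta> * t) powr \<beta> + (1 / \<delta> * t) powr \<gamma>) * hdist h x z"
    if xyz: "x \<in> T" "y \<in> T" "z \<in> T" "x \<noteq> y" "x \<noteq> z" and t: "d x y \<le> t * d x z" for x y z t
  proof -
    obtain n where n: "R * \<delta> ^ Suc n \<le> d x y" "d x y < R * \<delta> ^ n"
      using lev[OF xyz(1,2,4)] by blast
    obtain k where k: "R * \<delta> ^ Suc k \<le> d x z" "d x z < R * \<delta> ^ k"
      using lev[OF xyz(1,3,5)] by blast
    \<comment> \<open>A level determines the distance only up to the factor \<delta>; division by
      \<delta> makes up for this rounding.\<close>
    define u where "u = 1 / \<delta> * t"
    have dp: "0 < d x y" "0 < d x z" by (fact pos[OF xyz(1,2,4)], fact pos[OF xyz(1,3,5)])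
    have "0 < t * d x z" using dp(1) t by (rule less_le_trans)
    then have tp: "0 < t" using zero_less_mult_pos2[OF _ dp(2)] by blast
    have u0: "0 < u" using tp c by (simp add: u_def)
    have "R * \<delta> ^ Suc n \<le> t * (R * \<delta> ^ k)"
    proof -
      have "t * d x z \<le> t * (R * \<delta> ^ k)" using k(2) tp by (intro mult_left_mono) auto
      then show ?thesis using n(1) t by linarith
    qed
    then have "R * (\<delta> * \<delta> ^ n) \<le> R * (t * \<delta> ^ k)" by (simp add: algebra_simps)
    then have "\<delta> * \<delta> ^ n \<le> t * \<delta> ^ k" using R by simp
    then have key: "\<delta> ^ n \<le> u * \<delta> ^ k" using c by (simp add: u_def field_simps)
    have "W n x \<le> (u powr \<beta> + u powr \<gamma>) * W k x"
    proof (cases "k \<le> n")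
      case True
      define j where "j = n - k"
      have nj: "n = k + j" using True by (simp add: j_def)
      have "\<delta> ^ k * \<delta> ^ j \<le> \<delta> ^ k * u" using key by (simp add: nj power_add mult.commute)
      then have "\<delta> ^ j \<le> u" using c by simp
      then have "(1/2) ^ j \<le> u powr \<beta>" using \<beta> c powr_mono2[of \<beta> "\<delta> ^ j" u] by simp
      have "W n x \<le> (1/2) ^ j * W k x" 
        using weights_power_bounds[OF tw c(3) xyz(1), where j = j and n = k] unfolding nj by blast
      also have "\<dots> \<le> (u powr \<beta> + u powr \<gamma>) * W k x"
      proof (rule mult_right_mono)
        have "0 \<le> u powr \<gamma>" by simp
        then show "(1/2) ^ j \<le> u powr \<beta> + u powr \<gamma>" using \<open>(1/2) ^ j \<le> u powr \<beta>\<close> by linarith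
      qed (use Wp[OF xyz(1), of k] in simp)
      finally show ?thesis .
    next
      case False
      define j where "j = k - n"
      have kj: "k = n + j" using False by (simp add: j_def)
      have "\<delta> ^ n * 1 \<le> \<delta> ^ n * (u * \<delta> ^ j)" using key by (simp add: kj power_add mult.assoc mult.left_commute)
      then have "1 \<le> u * \<delta> ^ j" using c by (simp only: mult_le_cancel_left_pos zero_less_power)
      then have "1 \<le> (u * \<delta> ^ j) powr \<gamma>" using \<gamma>(1) by (simp add: ge_one_powr_ge_zero)
      then have g: "1 \<le> u powr \<gamma> * \<epsilon> ^ j" using u0 c \<gamma>(2) by (simp add: powr_mult)
      have e: "\<epsilon> ^ j * W n x \<le> W k x" 
        using weights_power_bounds[OF tw c(3) xyz(1), where j = j and n = n] unfolding kj by blast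
      have "W n x \<le> (u powr \<gamma> * \<epsilon> ^ j) * W n x" using g Wp[OF xyz(1), of n] by (simp add: mult_le_cancel_right1)
      also have "\<dots> = u powr \<gamma> * (\<epsilon> ^ j * W n x)" by simp
      also have "\<dots> \<le> u powr \<gamma> * W k x" using e by (intro mult_left_mono) auto
      also have "\<dots> \<le> (u powr \<beta> + u powr \<gamma>) * W k x"
        using Wp[OF xyz(1), of k] by (intro mult_right_mono) auto
      finally show ?thesis .
    qed
    then have "B * W n x \<le> B * ((u powr \<beta> + u powr \<gamma>) * W k x)" using B by (intro mult_left_mono) auto
    moreover have "hdist h x y \<le> B * W n x" by (rule up[OF xyz(1,2) n(2)])
    moreover have "B * ((u powr \<beta> + u powr \<gamma>) * W k x) = A * (u powr \<beta> + u powr \<gamma>) * (\<epsilon>^5 * W k x)"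
      using c by (simp add: A_def)
    moreover have "A * (u powr \<beta> + u powr \<gamma>) * (\<epsilon>^5 * W k x) \<le> A * (u powr \<beta> + u powr \<gamma>) * hdist h x z"
      using low[OF xyz(1,3) k] A by (intro mult_left_mono) auto
    ultimately show ?thesis unfolding u_def by linarith
  qed
  show ?thesis
    by (rule that[OF hf hpos top1 top2 A _ \<beta>(1) \<gamma>(1) qs c(5,6) cells]) (use c in auto)
qed

end

context arc_tree begin

text \<open>Additivity along an arc is known on the leg from the meet to the first endpoint.
  Exchanging the endpoints gives the other leg, and each point of the arc lies on one of
  them.\<close>

lemma geodesic_metric:
  assumes "Y \<noteq> {}" and \<alpha>: "1 < \<alpha>"
  obtains \<rho> A L \<beta> \<gamma> \<kappa> D where
    "\<And>x y. x \<in> Y \<Longrightarrow> y \<in> Y \<Longrightarrow> 0 \<le> \<rho> x y"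
    "\<And>x y. x \<in> Y \<Longrightarrow> y \<in> Y \<Longrightarrow> \<rho> x y = \<rho> y x"
    "\<And>x y. x \<in> Y \<Longrightarrow> y \<in> Y \<Longrightarrow> \<rho> x y = 0 \<longleftrightarrow> x = y"
    "\<And>x y z. x \<in> Y \<Longrightarrow> y \<in> Y \<Longrightarrow> z \<in> Y \<Longrightarrow> \<rho> x z \<le> \<rho> x y + \<rho> y z"
    "\<And>x y z. x \<in> Y \<Longrightarrow> z \<in> Y \<Longrightarrow> y \<in> seg x z \<Longrightarrow> \<rho> x z = \<rho> x y + \<rho> y z"
    "\<And>e. 0 < e \<Longrightarrow> \<exists>s>0. \<forall>x\<in>Y. \<forall>y\<in>Y. dist x y < s \<longrightarrow> \<rho> x y < e"
    "\<And>e. 0 < e \<Longrightarrow> \<exists>s>0. \<forall>x\<in>Y. \<forall>y\<in>Y. \<rho> x y < s \<longrightarrow> dist x y < e"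
    "0 < A" "0 < L" "0 < \<beta>" "0 < \<gamma>"
    "\<And>x y z. x \<in> Y \<Longrightarrow> y \<in> Y \<Longrightarrow> z \<in> Y \<Longrightarrow> x \<noteq> y \<Longrightarrow> x \<noteq> z \<Longrightarrow>
       \<rho> x y \<le> A * ((L * (dist x y / dist x z)) powr \<beta> + (L * (dist x y / dist x z)) powr \<gamma>) * \<rho> x z"
    "0 < \<kappa>" "\<kappa> < (1::real)"
    "\<And>n. small_cover Y \<rho> \<alpha> (D * \<kappa> ^ n) n"
proof -
  obtain p where p: "p \<in> Y" using assms by blast
  interpret rt: rooted_tree Y "le p" "mt p" p dm by (rule rooted_tree[OF p])
  define R where "R = diameter Y + 1"
  have R0: "0 < R" using diameter_ge_0[OF compact_imp_bounded[OF compact_Y]] by (simp add: R_def)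
  have R: "dm x y < R" if "x \<in> Y" "y \<in> Y" for x y
    using diameter_subset[OF seg_sub[OF that] compact_imp_bounded[OF compact_Y]] by (simp add: dm_def R_def)
  have pos: "0 < dm x y" if "x \<in> Y" "y \<in> Y" "x \<noteq> y" for x y
    using dist_le_dm[OF that(1,2)] that(3) by (meson less_le_trans zero_less_dist_iff)
  obtain h A L \<beta> \<gamma> \<kappa> D where H: "rt.height_fun h"
    "\<And>x y. x \<in> Y \<Longrightarrow> y \<in> Y \<Longrightarrow> x \<noteq> y \<Longrightarrow> 0 < rt.hdist h x y"
    "\<And>e. 0 < e \<Longrightarrow> \<exists>s>0. \<forall>x\<in>Y. \<forall>y\<in>Y. dm x y < s \<longrightarrow> rt.hdist h x y < e"
    "\<And>e. 0 < e \<Longrightarrow> \<exists>s>0. \<forall>x\<in>Y. \<forall>y\<in>Y. rt.hdist h x y < s \<longrightarrow> dm x y < e"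
    "0 < A" "0 < L" "0 < \<beta>" "0 < \<gamma>"
    "\<And>x y z t. x \<in> Y \<Longrightarrow> y \<in> Y \<Longrightarrow> z \<in> Y \<Longrightarrow> x \<noteq> y \<Longrightarrow> x \<noteq> z \<Longrightarrow> dm x y \<le> t * dm x z \<Longrightarrow>
       rt.hdist h x y \<le> A * ((L * t) powr \<beta> + (L * t) powr \<gamma>) * rt.hdist h x z"
    "0 < \<kappa>" "\<kappa> < (1::real)"
    "\<And>n. small_cover Y (rt.hdist h) \<alpha> (D * \<kappa> ^ n) n"
    by (rule rt.geodesic_height[OF R0 R pos \<alpha>]) blast+
  let ?\<rho> = "rt.hdist h"
  have K0: "0 < 6 * K" using K1 by simp
  have add1: "?\<rho> x z = ?\<rho> x y + ?\<rho> y z" if xz: "x \<in> Y" "z \<in> Y" "y \<in> seg (mt p x z) x" for x y z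
    using rt.hdist_additive[OF xz(1,2)] le_between[OF p mt_props(1)[OF p xz(1,2)]] xz(3) by blast
  have add: "?\<rho> x z = ?\<rho> x y + ?\<rho> y z" if xz: "x \<in> Y" "z \<in> Y" "y \<in> seg x z" for x y z
  proof -
    have yY: "y \<in> Y" using seg_sub xz by blast
    consider "y \<in> seg (mt p x z) x" | "y \<in> seg (mt p z x) z"
      using xz(3) seg_mt[OF p xz(1,2)] rt.mt_commute[OF xz(1,2)] by auto
    then show ?thesis
    proof cases
      case 1
      then show ?thesis by (rule add1[OF xz(1,2)])
    next
      case 2
      then have "?\<rho> z x = ?\<rho> z y + ?\<rho> y x" by (rule add1[OF xz(2,1)])
      then show ?thesis using rt.hdist_commute xz(1,2) yY by simp
    qed
  qed
  show ?thesis
  \<comment> \<open>The constant inside the powers grows by \<open>6 * K\<close>, the largest factor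
    by which a ratio of arc diameters can exceed the ratio of distances.\<close>
  proof (rule that[of ?\<rho> A "6 * K * L" \<beta> \<gamma> \<kappa> D])
    show "0 \<le> ?\<rho> x y" if "x \<in> Y" "y \<in> Y" for x y using rt.hdist_nonneg[OF H(1) that] .
    show "?\<rho> x y = ?\<rho> y x" if "x \<in> Y" "y \<in> Y" for x y using rt.hdist_commute[OF that] .
    show "?\<rho> x y = 0 \<longleftrightarrow> x = y" if "x \<in> Y" "y \<in> Y" for x y
      using H(2)[OF that] rt.hdist_self[OF that(1), of h] by (cases "x = y") auto
    show "?\<rho> x z \<le> ?\<rho> x y + ?\<rho> y z" if "x \<in> Y" "y \<in> Y" "z \<in> Y" for x y z
      using rt.hdist_triangle[OF H(1) that] .
    show "?\<rho> x z = ?\<rho> x y + ?\<rho> y z" if "x \<in> Y" "z \<in> Y" "y \<in> seg x z" for x y z using add[OF that] .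
    show "\<exists>s>0. \<forall>x\<in>Y. \<forall>y\<in>Y. dist x y < s \<longrightarrow> ?\<rho> x y < e" if e: "0 < e" for e
    proof -
      obtain s where s: "0 < s" "\<forall>x\<in>Y. \<forall>y\<in>Y. dm x y < s \<longrightarrow> ?\<rho> x y < e" using H(3)[OF e] by blast
      have "?\<rho> x y < e" if "x \<in> Y" "y \<in> Y" "dist x y < s / (6 * K)" for x y
      proof -
        have "6 * K * dist x y < s" using that(3) K0 by (simp add: field_simps)
        then have "dm x y < s" using dm_le_dist[OF that(1,2)] by simp
        then show ?thesis using s(2) that by blast
      qed
      then show ?thesis using s(1) K0 by (intro exI[of _ "s / (6 * K)"]) auto
    qed
    show "\<exists>s>0. \<forall>x\<in>Y. \<forall>y\<in>Y. ?\<rho> x y < s \<longrightarrow> dist x y < e" if e: "0 < e" for e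
    proof -
      obtain s where s: "0 < s" "\<forall>x\<in>Y. \<forall>y\<in>Y. ?\<rho> x y < s \<longrightarrow> dm x y < e" using H(4)[OF e] by blast
      have "dist x y < e" if "x \<in> Y" "y \<in> Y" "?\<rho> x y < s" for x y
        using dist_le_dm[OF that(1,2)] s(2) that by force
      then show ?thesis using s(1) by blast
    qed
    show "0 < A" "0 < 6 * K * L" "0 < \<beta>" "0 < \<gamma>" "0 < \<kappa>" "\<kappa> < 1" using H K0 by auto
    show "?\<rho> x y \<le> A * ((6 * K * L * (dist x y / dist x z)) powr \<beta> + (6 * K * L * (dist x y / dist x z)) powr \<gamma>) * ?\<rho> x z"
      if xyz: "x \<in> Y" "y \<in> Y" "z \<in> Y" "x \<noteq> y" "x \<noteq> z" for x y z
    proof -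
      have dz: "0 < dist x z" using xyz by simp
      have "dm x y \<le> 6 * K * dist x y" using dm_le_dist xyz by blast
      also have "\<dots> = 6 * K * (dist x y / dist x z) * dist x z" using dz by simp
      also have "\<dots> \<le> 6 * K * (dist x y / dist x z) * dm x z"
        using dist_le_dm[OF xyz(1,3)] K0 by (intro mult_left_mono) auto
      finally have "?\<rho> x y \<le> A * ((L * (6 * K * (dist x y / dist x z))) powr \<beta> + (L * (6 * K * (dist x y / dist x z))) powr \<gamma>) * ?\<rho> x z"
        by (rule H(9)[OF xyz])
      then show ?thesis by (simp only: mult.assoc mult.left_commute)
    qed
  qed (rule H(12))
qed

end

section \<open>Abstract metric spaces and the main theorem\<close>

lemma openin_mtopology_of:
  "openin (mtopology_of m) U \<longleftrightarrow>
     U \<subseteq> mspace m \<and> (\<forall>x\<in>U. \<exists>r>0. \<forall>y\<in>mspace m. mdist m x y < r \<longrightarrow> y \<in> U)"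
proof -
  interpret Metric_space "mspace m" "mdist m" by blast
  have "mball x r \<subseteq> U \<longleftrightarrow> (\<forall>y\<in>mspace m. mdist m x y < r \<longrightarrow> y \<in> U)" if "x \<in> mspace m" for x r
    using that by (auto simp: subset_iff in_mball)
  then show ?thesis unfolding mtopology_of_def openin_mtopology by (meson subsetD)
qed

lemma Hausdorff_mtopology_of: "Hausdorff_space (mtopology_of m)"
  unfolding mtopology_of_def by (rule Metric_space.Hausdorff_space_mtopology) blast

text \<open>A point is sent to its distance function minus the distance function of a base point,
  which is bounded. On the discrete copy of the type every function is continuous, so all bounded
  functions are available; off the carrier the value is 0.\<close>

lemma kuratowski_embedding:
  obtains \<phi> :: "'a \<Rightarrow> ('a discrete \<Rightarrow>\<^sub>C real)" where
    "\<And>x y. x \<in> mspace m \<Longrightarrow> y \<in> mspace m \<Longrightarrow> dist (\<phi> x) (\<phi> y) = mdist m x y"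
proof (cases "mspace m = {}")
  case True
  then show ?thesis using that by auto
next
  case False
  then obtain a where a: "a \<in> mspace m" by blast
  define f where "f x u = (let z = of_discrete u in if z \<in> mspace m then mdist m x z - mdist m a z else 0)"
    for x and u :: "'a discrete"
  have fb: "\<bar>f x u - f y u\<bar> \<le> mdist m x y" if "x \<in> mspace m" "y \<in> mspace m" for x y u
  proof (cases "of_discrete u \<in> mspace m")
    case True
    then show ?thesis
      using mdist_triangle[OF that True] mdist_triangle[OF that(2,1) True] mdist_commute[of m x y]
      by (simp add: f_def Let_def)
  qed (simp add: f_def)
  have bc: "f x \<in> bcontfun" if x: "x \<in> mspace m" for x
  proof -
    have "f a u = 0" for u by (simp add: f_def Let_def)
    then have "norm (f x u) \<le> mdist m x a" for u using fb[OF x a, of u] by simp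
    then have "bounded (range (f x))" by (auto simp: bounded_iff)
    moreover have "continuous_on UNIV (f x)" by (auto simp: continuous_on_open_vimage open_discrete)
    ultimately show ?thesis by (simp add: bcontfun_def)
  qed
  have ap: "apply_bcontfun (Bcontfun (f x)) = f x" if "x \<in> mspace m" for x
    by (rule Bcontfun_inverse[OF bc[OF that]])
  show ?thesis
  proof (rule that[of "\<lambda>x. Bcontfun (f x)"])
    fix x y assume xy: "x \<in> mspace m" "y \<in> mspace m"
    show "dist (Bcontfun (f x)) (Bcontfun (f y)) = mdist m x y"
    proof (rule antisym)
      show "dist (Bcontfun (f x)) (Bcontfun (f y)) \<le> mdist m x y"
        by (rule dist_bound) (use fb[OF xy] ap xy in \<open>simp add: dist_real_def\<close>)
      have "mdist m y y = 0" using xy by simp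
      with xy have "mdist m x y = dist (f x (discrete y)) (f y (discrete y))"
        by (simp only: f_def discrete_inverse dist_real_def Let_def UNIV_I if_True) simp
      also have "\<dots> \<le> dist (Bcontfun (f x)) (Bcontfun (f y))"
        using dist_bounded[of "Bcontfun (f x)" "discrete y" "Bcontfun (f y)"] ap xy by simp
      finally show "mdist m x y \<le> dist (Bcontfun (f x)) (Bcontfun (f y))" .
    qed
  qed
qed

text \<open>Iterated halving covers a ball containing the set by \<open>N ^ k\<close> balls of
  radius at most \<open>r / 2\<close>, and each of these contains at most one point of an
  \<open>r\<close>-separated set. The exponent \<open>k\<close> depends on \<open>q\<close>
  alone.\<close>

lemma doubling_packing:
  assumes "doubling m"
  shows "\<exists>M::nat. \<forall>r>0. \<forall>x\<in>mspace m. \<forall>F. finite F \<and> F \<subseteq> mspace m \<and> (\<forall>y\<in>F. mdist m x y \<le> q * r) \<and>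
      (\<forall>y\<in>F. \<forall>z\<in>F. y \<noteq> z \<longrightarrow> r \<le> mdist m y z) \<longrightarrow> card F \<le> M"
proof -
  obtain N :: nat where N: "\<And>x R. x \<in> mspace m \<Longrightarrow> R > 0 \<Longrightarrow>
     \<exists>C. C \<subseteq> mspace m \<and> finite C \<and> card C \<le> N \<and> mball_of m x R \<subseteq> (\<Union>c\<in>C. mball_of m c (R / 2))"
    using assms unfolding doubling_def by blast
  have it: "\<exists>C. C \<subseteq> mspace m \<and> finite C \<and> card C \<le> N ^ k \<and> mball_of m x R \<subseteq> (\<Union>c\<in>C. mball_of m c (R / 2 ^ k))"
    if x: "x \<in> mspace m" and R: "R > 0" for x R k
  proof (induction k)
    case 0
    then show ?case using x by (intro exI[of _ "{x}"]) auto
  next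
    case (Suc k)
    then obtain C where C: "C \<subseteq> mspace m" "finite C" "card C \<le> N ^ k" "mball_of m x R \<subseteq> (\<Union>c\<in>C. mball_of m c (R / 2 ^ k))"
      by blast
    have "\<exists>D. D \<subseteq> mspace m \<and> finite D \<and> card D \<le> N \<and> mball_of m c (R / 2 ^ k) \<subseteq> (\<Union>e\<in>D. mball_of m e (R / 2 ^ Suc k))"
      if "c \<in> C" for c
      using N[of c "R / 2 ^ k"] that C(1) R by (auto simp: field_simps)
    then obtain D where D: "\<And>c. c \<in> C \<Longrightarrow> D c \<subseteq> mspace m \<and> finite (D c) \<and> card (D c) \<le> N \<and>
        mball_of m c (R / 2 ^ k) \<subseteq> (\<Union>e\<in>D c. mball_of m e (R / 2 ^ Suc k))" by metis
    have "card (\<Union>c\<in>C. D c) \<le> (\<Sum>c\<in>C. card (D c))" by (rule card_UN_le[OF C(2)])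
    also have "\<dots> \<le> (\<Sum>c\<in>C. N)" using D by (intro sum_mono) blast
    also have "\<dots> \<le> N ^ Suc k" using C(3) by (simp add: mult.commute)
    finally have "card (\<Union>c\<in>C. D c) \<le> N ^ Suc k" .
    moreover have "mball_of m x R \<subseteq> (\<Union>e\<in>(\<Union>c\<in>C. D c). mball_of m e (R / 2 ^ Suc k))"
    proof
      fix y assume "y \<in> mball_of m x R"
      then obtain c where c: "c \<in> C" "y \<in> mball_of m c (R / 2 ^ k)" using C(4) by blast
      then have "y \<in> (\<Union>e\<in>D c. mball_of m e (R / 2 ^ Suc k))" using D[OF c(1)] by blast
      then show "y \<in> (\<Union>e\<in>(\<Union>c\<in>C. D c). mball_of m e (R / 2 ^ Suc k))" using c(1) by blast
    qed
    moreover have "finite (\<Union>c\<in>C. D c)" using C(2) D by blast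
    moreover have "(\<Union>c\<in>C. D c) \<subseteq> mspace m" using D by blast
    ultimately show ?case by blast
  qed
  obtain k :: nat where k: "2 * (\<bar>q\<bar> + 1) < 2 ^ k" using real_arch_pow[of 2] by auto
  have "card F \<le> N ^ k" if r: "0 < r" and x: "x \<in> mspace m" and F: "finite F" "F \<subseteq> mspace m"
    "\<forall>y\<in>F. mdist m x y \<le> q * r" "\<forall>y\<in>F. \<forall>z\<in>F. y \<noteq> z \<longrightarrow> r \<le> mdist m y z" for r x F
  proof -
    define R where "R = (\<bar>q\<bar> + 1) * r"
    have R: "R > 0" using r by (simp add: R_def)
    obtain C where C: "C \<subseteq> mspace m" "finite C" "card C \<le> N ^ k" "mball_of m x R \<subseteq> (\<Union>c\<in>C. mball_of m c (R / 2 ^ k))"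
      using it[OF x R] by blast
    have small: "R / 2 ^ k \<le> r / 2"
    proof -
      have "2 * (\<bar>q\<bar> + 1) * r \<le> 2 ^ k * r" using k r by (intro mult_right_mono) auto
      then show ?thesis by (simp add: R_def field_simps)
    qed
    have "\<exists>c\<in>C. mdist m c y < r / 2" if y: "y \<in> F" for y
    proof -
      have "q * r \<le> \<bar>q\<bar> * r" using r by (intro mult_right_mono) auto
      moreover have "R = \<bar>q\<bar> * r + r" by (simp add: R_def distrib_right)
      ultimately have "q * r < R" using r by linarith
      moreover have "mdist m x y \<le> q * r" using F(3) y by blast
      ultimately have "mdist m x y < R" by simp
      then have "y \<in> mball_of m x R" using F(2) x y by auto
      then obtain c where c: "c \<in> C" "y \<in> mball_of m c (R / 2 ^ k)" using C(4) by blast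
      then have "mdist m c y < R / 2 ^ k" by simp
      then have "mdist m c y < r / 2" using small by linarith
      then show ?thesis using c(1) by blast
    qed
    then obtain f where f: "\<And>y. y \<in> F \<Longrightarrow> f y \<in> C \<and> mdist m (f y) y < r / 2" by metis
    have "inj_on f F"
    proof (rule inj_onI, rule ccontr)
      fix y z assume yz: "y \<in> F" "z \<in> F" "f y = f z" "y \<noteq> z"
      have "mdist m y z \<le> mdist m y (f y) + mdist m (f y) z"
        by (rule mdist_triangle) (use yz(1,2) F(2) f[OF yz(1)] C(1) in blast)+
      then have "mdist m y z < r" using f[OF yz(1)] f[OF yz(2)] yz(3) mdist_commute[of m y "f y"] by simp
      moreover have "r \<le> mdist m y z" using F(4) yz by blast
      ultimately show False by simp
    qed
    then have "card F \<le> card C" using f C(2) by (intro card_inj_on_le) auto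
    then show ?thesis using C(3) by simp
  qed
  then show ?thesis by blast
qed

text \<open>The maximum is used in place of the sum of the two powers because its inverse is
  explicit, namely the minimum of the inverse powers.\<close>

lemma homeomorphic_map_powr:
  fixes \<beta> \<gamma> A L :: real
  assumes "0 < \<beta>" "0 < \<gamma>" "0 < A" "0 < L"
  shows "homeomorphic_map (top_of_set {0..}) (top_of_set {0..}) (\<lambda>t. A * max ((L * t) powr \<beta>) ((L * t) powr \<gamma>))"
proof (rule homeomorphic_maps_imp_map)
  let ?f = "\<lambda>t. A * max ((L * t) powr \<beta>) ((L * t) powr \<gamma>)"
  let ?g = "\<lambda>v. min ((v / A) powr (1 / \<beta>)) ((v / A) powr (1 / \<gamma>)) / L"
  have inv: "(u powr a) powr (1 / a) = u" "(u powr (1 / a)) powr a = u" if "0 \<le> u" "0 < a" for u a :: real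
    using that by (auto simp: powr_powr)
  have mono: "u powr a \<le> v powr a" if "0 \<le> u" "u \<le> v" "0 < a" for u v a :: real
    using that by (intro powr_mono2) auto
  have 1: "min ((max (u powr \<beta>) (u powr \<gamma>)) powr (1 / \<beta>)) ((max (u powr \<beta>) (u powr \<gamma>)) powr (1 / \<gamma>)) = u"
    if u: "0 \<le> u" for u
  proof (cases "u powr \<beta> \<le> u powr \<gamma>")
    case True
    have "u \<le> (u powr \<gamma>) powr (1 / \<beta>)" using mono[OF _ True, of "1 / \<beta>"] inv(1)[OF u assms(1)] assms by simp
    then show ?thesis using True inv(1)[OF u assms(2)] by (simp add: max_def min_def)
  next
    case False
    then have "u \<le> (u powr \<beta>) powr (1 / \<gamma>)"
      using mono[of "u powr \<gamma>" "u powr \<beta>" "1 / \<gamma>"] inv(1)[OF u assms(2)] assms by simp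
    then show ?thesis using False inv(1)[OF u assms(1)] by (simp add: max_def min_def)
  qed
  have 2: "max ((min (v powr (1 / \<beta>)) (v powr (1 / \<gamma>))) powr \<beta>) ((min (v powr (1 / \<beta>)) (v powr (1 / \<gamma>))) powr \<gamma>) = v"
    if v: "0 \<le> v" for v
  proof (cases "v powr (1 / \<beta>) \<le> v powr (1 / \<gamma>)")
    case True
    have "(v powr (1 / \<beta>)) powr \<gamma> \<le> v" using mono[OF _ True, of \<gamma>] inv(2)[OF v assms(2)] assms by simp
    then show ?thesis using True inv(2)[OF v assms(1)] by (simp add: max_def min_def)
  next
    case False
    then have "(v powr (1 / \<gamma>)) powr \<beta> \<le> v"
      using mono[of "v powr (1 / \<gamma>)" "v powr (1 / \<beta>)" \<beta>] inv(2)[OF v assms(1)] assms by simp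
    then show ?thesis using False inv(2)[OF v assms(2)] by (simp add: max_def min_def)
  qed
  have "continuous_on {0..} ?f" using assms by (intro continuous_intros continuous_on_powr') auto
  moreover have "continuous_on {0..} ?g" using assms by (intro continuous_intros continuous_on_powr') auto
  moreover have "?f \<in> {0..} \<rightarrow> {0..}" "?g \<in> {0..} \<rightarrow> {0..}"
    using assms by (auto simp: le_max_iff_disj)
  moreover have "?g (?f t) = t" if "t \<in> {0..}" for t
  proof -
    have "0 \<le> L * t" using that assms by simp
    then show ?thesis using 1[of "L * t"] assms by simp
  qed
  moreover have "?f (?g v) = v" if "v \<in> {0..}" for v
  proof -
    have "0 \<le> v / A" using that assms by simp
    moreover have "L * ?g v = min ((v / A) powr (1 / \<beta>)) ((v / A) powr (1 / \<gamma>))" using assms by simp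
    ultimately show ?thesis using 2[of "v / A"] assms by simp
  qed
  ultimately show "homeomorphic_maps (top_of_set {0..}) (top_of_set {0..}) ?f ?g"
    unfolding homeomorphic_maps_def by (simp add: continuous_map_in_subtopology image_subset_iff_funcset)
qed

text \<open>The covering sums at exponent \<alpha> tend to 0 while the diameters of the covering
  sets tend to 0. So the measure at \<alpha> vanishes, and \<alpha> takes part in the infimum
  defining the dimension.\<close>

lemma hausdorff_dim_le:
  assumes \<alpha>: "0 < \<alpha>" and \<kappa>: "0 < \<kappa>" "\<kappa> < 1"
    and cov: "\<And>n. small_cover (mspace m) (mdist m) \<alpha> (D * \<kappa> ^ n) n"
  shows "hausdorff_dim m \<le> ennreal \<alpha>"
proof -
  have content: "hausdorff_content m \<alpha> \<delta> (mspace m) \<le> ennreal (D * \<kappa> ^ n)" if n: "11 * (1/2) ^ n \<le> \<delta>" for n \<delta>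
  proof -
    obtain C :: "nat set" and E b where C: "finite C" "mspace m \<subseteq> (\<Union>c\<in>C. E c)"
      "\<forall>c\<in>C. E c \<subseteq> mspace m \<and> 0 < b c \<and> b c \<le> 11 * (1/2) ^ n \<and> (\<forall>x\<in>E c. \<forall>y\<in>E c. mdist m x y \<le> b c)"
      "(\<Sum>c\<in>C. b c powr \<alpha>) \<le> D * \<kappa> ^ n"
      using cov[of n] unfolding small_cover_def by blast
    obtain f where f: "bij_betw f {0..<card C} C" using ex_bij_betw_nat_finite[OF C(1)] by blast
    \<comment> \<open>Finite covers become sequences by appending empty sets, whose gauge is
      0.\<close>
    define U where "U i = (if i < card C then E (f i) else {})" for i
    have fC: "f i \<in> C" if "i < card C" for i using f that by (auto simp: bij_betw_def)
    have dU: "mdiam m (U i) \<le> ennreal (b (f i))" if "i < card C" for i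
      using that C(3) fC[OF that] unfolding mdiam_def U_def by (auto intro!: SUP_least ennreal_leI)
    have "mdiam m (U i) \<le> ennreal \<delta>" for i
    proof (cases "i < card C")
      case True
      have "b (f i) \<le> \<delta>" using C(3) fC[OF True] n by force
      then show ?thesis using dU[OF True] by (meson ennreal_leI order_trans)
    next
      case False
      then show ?thesis by (simp add: U_def mdiam_def)
    qed
    moreover have "U i \<subseteq> mspace m" for i using C(3) fC by (auto simp: U_def)
    moreover have "mspace m \<subseteq> (\<Union>i. U i)"
    proof
      fix x assume "x \<in> mspace m"
      then obtain c where "c \<in> C" "x \<in> E c" using C(2) by blast
      moreover have "c \<in> f ` {0..<card C}" using f \<open>c \<in> C\<close> by (simp add: bij_betw_def)
      then obtain i where "i < card C" "f i = c" by auto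
      ultimately show "x \<in> (\<Union>i. U i)" by (auto simp: U_def)
    qed
    ultimately have "hausdorff_content m \<alpha> \<delta> (mspace m) \<le> (\<Sum>i. hausdorff_gauge m \<alpha> (U i))"
      unfolding hausdorff_content_def by (intro INF_lower) auto
    also have "\<dots> = (\<Sum>i<card C. hausdorff_gauge m \<alpha> (U i))"
      by (rule suminf_finite) (auto simp: U_def hausdorff_gauge_def)
    also have "\<dots> \<le> (\<Sum>i<card C. ennreal (b (f i) powr \<alpha>))"
    proof (rule sum_mono)
      fix i assume i: "i \<in> {..<card C}"
      have b: "0 < b (f i)" using C(3) fC i by auto
      have "enn2real (mdiam m (U i)) \<le> enn2real (ennreal (b (f i)))"
        using dU i by (intro enn2real_mono) auto
      then have "enn2real (mdiam m (U i)) powr \<alpha> \<le> b (f i) powr \<alpha>"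
        using b \<alpha> by (intro powr_mono2) (auto simp: enn2real_nonneg)
      then show "hausdorff_gauge m \<alpha> (U i) \<le> ennreal (b (f i) powr \<alpha>)"
        using \<alpha> by (auto simp: hausdorff_gauge_def intro: ennreal_leI)
    qed
    also have "\<dots> = ennreal (\<Sum>i<card C. b (f i) powr \<alpha>)" by simp
    also have "(\<Sum>i<card C. b (f i) powr \<alpha>) = (\<Sum>c\<in>C. b c powr \<alpha>)"
      using sum.reindex_bij_betw[OF f] by (simp add: atLeast0LessThan)
    also have "ennreal \<dots> \<le> ennreal (D * \<kappa> ^ n)" using C(4) by (rule ennreal_leI)
    finally show ?thesis .
  qed
  have zero: "hausdorff_content m \<alpha> \<delta> (mspace m) = 0" if "0 < \<delta>" for \<delta>
  proof -
    have "hausdorff_content m \<alpha> \<delta> (mspace m) \<le> 0"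
    proof (rule ennreal_le_epsilon)
      fix e :: real assume "0 < e"
      have lim: "(\<lambda>n. c * k ^ n) \<longlonglongrightarrow> 0" if "0 < k" "k < 1" for c k :: real
        using tendsto_mult[OF tendsto_const LIMSEQ_power_zero, of k c] that by simp
      have l1: "(\<lambda>n. D * \<kappa> ^ n) \<longlonglongrightarrow> 0" by (rule lim[OF \<kappa>])
      have l2: "(\<lambda>n. 11 * (1/2::real) ^ n) \<longlonglongrightarrow> 0" by (rule lim) auto
      have "eventually (\<lambda>n. D * \<kappa> ^ n < e) sequentially" "eventually (\<lambda>n. 11 * (1/2) ^ n < \<delta>) sequentially"
        by (rule order_tendstoD(2)[OF l1 \<open>0 < e\<close>], rule order_tendstoD(2)[OF l2 that])
      then have "eventually (\<lambda>n. D * \<kappa> ^ n < e \<and> 11 * (1/2) ^ n < \<delta>) sequentially" by (rule eventually_conj)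
      then obtain n where n: "D * \<kappa> ^ n < e" "11 * (1/2) ^ n < \<delta>" by (auto simp: eventually_sequentially)
      have "ennreal (D * \<kappa> ^ n) \<le> ennreal e" using n by (intro ennreal_leI) simp
      then show "hausdorff_content m \<alpha> \<delta> (mspace m) \<le> 0 + ennreal e" using content[of n \<delta>] n by simp
    qed
    then show ?thesis by simp
  qed
  have "hausdorff_measure m \<alpha> (mspace m) = 0"
    unfolding hausdorff_measure_def using zero by (auto intro!: antisym SUP_least)
  then show ?thesis unfolding hausdorff_dim_def using \<alpha> by (intro INF_lower) auto
qed

theorem theorem1p3:
  fixes T :: "'a metric" and \<alpha> :: real
  assumes "quasiconformal_tree T" and "\<alpha> > 1"
  shows "\<exists>S :: 'a metric. geodesic_tree S \<and> quasisymmetrically_equivalent T S \<and>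
           hausdorff_dim S \<le> ennreal \<alpha>"
proof -
  let ?M = "mspace T" and ?X = "mtopology_of T"
  have tree: "metric_tree T" and dbl: "doubling T" and bt: "bounded_turning T"
    using assms(1) by (auto simp: quasiconformal_tree_def)
  have cX: "compact_space ?X" and two: "\<exists>x\<in>?M. \<exists>y\<in>?M. x \<noteq> y"
    and arcs: "\<And>x y. x \<in> ?M \<Longrightarrow> y \<in> ?M \<Longrightarrow> \<exists>!A. is_arc ?X x y A"
    using tree by (auto simp: metric_tree_def)
  have HX: "Hausdorff_space ?X" by (rule Hausdorff_mtopology_of)
  obtain \<phi> :: "'a \<Rightarrow> ('a discrete \<Rightarrow>\<^sub>C real)" where
    \<phi>: "\<And>x y. x \<in> ?M \<Longrightarrow> y \<in> ?M \<Longrightarrow> dist (\<phi> x) (\<phi> y) = mdist T x y"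
    using kuratowski_embedding by blast
  have inj: "inj_on \<phi> ?M"
  proof (rule inj_onI)
    fix x y assume xy: "x \<in> ?M" "y \<in> ?M" "\<phi> x = \<phi> y"
    then have "mdist T x y = 0" using \<phi>[OF xy(1,2)] by simp
    then show "x = y" using xy by simp
  qed
  define Y where "Y = \<phi> ` ?M"
  define \<psi> where "\<psi> = inv_into ?M \<phi>"
  have \<psi>\<phi>: "\<psi> (\<phi> x) = x" if "x \<in> ?M" for x using inj that by (simp add: \<psi>_def)
  have \<psi>: "\<psi> y \<in> ?M" "\<phi> (\<psi> y) = y" if "y \<in> Y" for y
    using that by (auto simp: \<psi>_def Y_def inv_into_into f_inv_into_f)
  have cont\<phi>: "continuous_map ?X euclidean \<phi>"
    unfolding continuous_map_def
  proof (intro conjI allI impI)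
    fix U :: "('a discrete \<Rightarrow>\<^sub>C real) set" assume "openin euclidean U"
    then have U: "open U" by simp
    show "openin ?X {x \<in> topspace ?X. \<phi> x \<in> U}"
      unfolding openin_mtopology_of
    proof (intro conjI ballI)
      fix x assume x: "x \<in> {x \<in> topspace ?X. \<phi> x \<in> U}"
      then obtain r where "0 < r" "ball (\<phi> x) r \<subseteq> U" using U open_contains_ball by blast
      then show "\<exists>r>0. \<forall>y\<in>?M. mdist T x y < r \<longrightarrow> y \<in> {x \<in> topspace ?X. \<phi> x \<in> U}"
        using x \<phi> by (intro exI[of _ r]) auto
    qed auto
  qed auto
  have cont\<psi>: "continuous_map (top_of_set Y) ?X \<psi>"
    unfolding continuous_map_def
  proof (intro conjI allI impI)
    fix U assume U: "openin ?X U"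
    show "openin (top_of_set Y) {y \<in> topspace (top_of_set Y). \<psi> y \<in> U}"
      unfolding openin_euclidean_subtopology_iff
    proof (intro conjI ballI)
      fix y assume y: "y \<in> {y \<in> topspace (top_of_set Y). \<psi> y \<in> U}"
      then obtain r where r: "0 < r" "\<And>z. z \<in> ?M \<Longrightarrow> mdist T (\<psi> y) z < r \<Longrightarrow> z \<in> U"
        using U by (auto simp: openin_mtopology_of)
      have "z \<in> {y \<in> topspace (top_of_set Y). \<psi> y \<in> U}" if z: "z \<in> Y" "dist z y < r" for z
      proof -
        have "mdist T (\<psi> y) (\<psi> z) = dist y z" using \<phi>[of "\<psi> y" "\<psi> z"] \<psi> y z by simp
        then show ?thesis using r(2)[of "\<psi> z"] z \<psi> by (simp add: dist_commute)
      qed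
      then show "\<exists>e>0. \<forall>z\<in>Y. dist z y < e \<longrightarrow> z \<in> {y \<in> topspace (top_of_set Y). \<psi> y \<in> U}"
        using r(1) by blast
    qed auto
  qed (use \<psi> in auto)
  have compY: "compact Y"
    using image_compactin[of ?X ?M euclidean \<phi>] cont\<phi> cX by (simp add: Y_def compact_space_def)
  have arc_to_param: "arc_param ?X (\<psi> (pathstart g)) (\<psi> (pathfinish g)) (\<psi> \<circ> g)"
    if g: "arc g" "path_image g \<subseteq> Y" for g
  proof -
    have gY: "g t \<in> Y" if "t \<in> {0..1}" for t using g(2) that by (auto simp: path_image_def)
    have "continuous_map (top_of_set {0..1}) (top_of_set Y) g"
      using g gY by (auto simp: arc_def path_def continuous_map_in_subtopology)
    then have c: "continuous_map (top_of_set {0..1}) ?X (\<psi> \<circ> g)" by (rule continuous_map_compose[OF _ cont\<psi>])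
    have "inj_on \<psi> Y" using \<psi>(2) by (metis inj_onI)
    then have i: "inj_on (\<psi> \<circ> g) {0..1}"
      using g gY by (auto simp: arc_def inj_on_def)
    \<comment> \<open>A continuous injection from a compact space into a Hausdorff space is an
      embedding.\<close>
    then have "embedding_map (top_of_set {0..1}) ?X (\<psi> \<circ> g)"
      using c HX by (intro continuous_imp_embedding_map) (auto simp: compact_space_subtopology)
    moreover have "\<psi> (pathstart g) \<noteq> \<psi> (pathfinish g)"
      using inj_onD[OF i, of 0 1] by (auto simp: pathstart_def pathfinish_def)
    ultimately show ?thesis by (simp add: arc_param_def pathstart_def pathfinish_def)
  qed
  have param_to_arc: "arc (\<phi> \<circ> g) \<and> path_image (\<phi> \<circ> g) \<subseteq> Y \<and> g ` {0..1} \<subseteq> ?M"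
    if g: "arc_param ?X x y g" "x \<noteq> y" for x y g
  proof -
    have e: "embedding_map (top_of_set {0..1}) ?X g" using g by (simp add: arc_param_def)
    then have hm: "homeomorphic_map (top_of_set {0..1}) (subtopology ?X (g ` {0..1})) g"
      by (simp add: embedding_map_def)
    have c: "continuous_map (top_of_set {0..1}) ?X g"
      using homeomorphic_imp_continuous_map[OF hm] continuous_map_into_fulltopology by blast
    have i: "inj_on g {0..1}" using homeomorphic_imp_injective_map[OF hm] by simp
    have gM: "g ` {0..1} \<subseteq> ?M" using continuous_map_image_subset_topspace[OF c] by simp
    have "continuous_on {0..1} (\<phi> \<circ> g)" using continuous_map_compose[OF c cont\<phi>] by simp
    moreover have "inj_on (\<phi> \<circ> g) {0..1}" using i inj gM by (meson comp_inj_on inj_on_subset)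
    ultimately show ?thesis using gM by (auto simp: arc_def path_def path_image_def Y_def)
  qed
  obtain K where K: "1 \<le> K" "\<And>x y. x \<in> ?M \<Longrightarrow> y \<in> ?M \<Longrightarrow>
        \<exists>E. compactin ?X E \<and> connectedin ?X E \<and> x \<in> E \<and> y \<in> E \<and> mdiam T E \<le> ennreal (K * mdist T x y)"
    using bt unfolding bounded_turning_def by blast
  interpret at: arc_tree Y K
  proof
    show "compact Y" "1 \<le> K" by (fact compY, fact K(1))
    show "\<exists>E\<subseteq>Y. connected E \<and> x \<in> E \<and> y \<in> E \<and> (\<forall>u\<in>E. \<forall>v\<in>E. dist u v \<le> K * dist x y)"
      if xy: "x \<in> Y" "y \<in> Y" for x y
    proof -
      obtain E where E: "connectedin ?X E" "\<psi> x \<in> E" "\<psi> y \<in> E" "mdiam T E \<le> ennreal (K * mdist T (\<psi> x) (\<psi> y))"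
        using K(2) \<psi>(1) xy by metis
      have EM: "E \<subseteq> ?M" using connectedin_subset_topspace[OF E(1)] by simp
      have D: "mdist T (\<psi> x) (\<psi> y) = dist x y" using \<phi>[of "\<psi> x" "\<psi> y"] \<psi> xy by simp
      have le: "mdist T u v \<le> K * dist x y" if "u \<in> E" "v \<in> E" for u v
      proof -
        have "ennreal (mdist T u v) \<le> mdiam T E"
          unfolding mdiam_def using that by (meson SUP_upper SUP_upper2)
        then have "ennreal (mdist T u v) \<le> ennreal (K * dist x y)" using E(4) D by simp
        then show ?thesis using K(1) by (subst (asm) ennreal_le_iff) auto
      qed
      have "\<forall>u\<in>\<phi> ` E. \<forall>v\<in>\<phi> ` E. dist u v \<le> K * dist x y"
      proof clarify
        fix u v assume uv: "u \<in> E" "v \<in> E"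
        then have "dist (\<phi> u) (\<phi> v) = mdist T u v" using \<phi>[of u v] EM by blast
        then show "dist (\<phi> u) (\<phi> v) \<le> K * dist x y" using le[OF uv] by simp
      qed
      moreover have "connected (\<phi> ` E)" using connectedin_continuous_map_image[OF cont\<phi> E(1)] by simp
      moreover have "x \<in> \<phi> ` E" "y \<in> \<phi> ` E" using E(2,3) \<psi> xy by (metis imageI)+
      moreover have "\<phi> ` E \<subseteq> Y" using EM by (auto simp: Y_def)
      ultimately show ?thesis by blast
    qed
    show "\<exists>g. arc g \<and> path_image g \<subseteq> Y \<and> pathstart g = x \<and> pathfinish g = y"
      if xy: "x \<in> Y" "y \<in> Y" "x \<noteq> y" for x y
    proof -
      have ne: "\<psi> x \<noteq> \<psi> y" using xy \<psi>(2) by metis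
      obtain g where g: "arc_param ?X (\<psi> x) (\<psi> y) g" using arcs[OF \<psi>(1)[OF xy(1)] \<psi>(1)[OF xy(2)]] by (auto simp: is_arc_def)
      have "arc (\<phi> \<circ> g) \<and> path_image (\<phi> \<circ> g) \<subseteq> Y" using param_to_arc[OF g ne] by blast
      moreover have "pathstart (\<phi> \<circ> g) = x" "pathfinish (\<phi> \<circ> g) = y"
        using g \<psi>(2) xy by (auto simp: arc_param_def pathstart_def pathfinish_def)
      ultimately show ?thesis by blast
    qed
    show "path_image g = path_image h"
      if g: "arc g" "path_image g \<subseteq> Y" and h: "arc h" "path_image h \<subseteq> Y"
        and e: "pathstart g = pathstart h" "pathfinish g = pathfinish h" for g h
    proof -
      have Y: "pathstart g \<in> Y" "pathfinish g \<in> Y" using g(2) pathstart_in_path_image pathfinish_in_path_image by blast+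
      have "is_arc ?X (\<psi> (pathstart g)) (\<psi> (pathfinish g)) ((\<psi> \<circ> g) ` {0..1})"
        "is_arc ?X (\<psi> (pathstart g)) (\<psi> (pathfinish g)) ((\<psi> \<circ> h) ` {0..1})"
        using arc_to_param[OF g] arc_to_param[OF h] e by (auto simp: is_arc_def)
      then have "(\<psi> \<circ> g) ` {0..1} = (\<psi> \<circ> h) ` {0..1}" using arcs \<psi>(1) Y by blast
      then have "\<psi> ` path_image g = \<psi> ` path_image h" by (simp add: path_image_def image_comp)
      then have "\<phi> ` \<psi> ` path_image g = \<phi> ` \<psi> ` path_image h" by simp
      moreover have "\<phi> ` \<psi> ` A = A" if "A \<subseteq> Y" for A
        unfolding image_image using \<psi>(2) that by (subst image_cong[where g = "\<lambda>x. x"]) auto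
      ultimately show ?thesis using g(2) h(2) by simp
    qed
    show "\<exists>M::nat. \<forall>r>0. \<forall>x\<in>Y. \<forall>F. finite F \<and> F \<subseteq> Y \<and> (\<forall>y\<in>F. dist x y \<le> q * r) \<and>
      (\<forall>y\<in>F. \<forall>z\<in>F. y \<noteq> z \<longrightarrow> r \<le> dist y z) \<longrightarrow> card F \<le> M" for q :: real
    proof -
      from doubling_packing[OF dbl, of q]
      obtain M :: nat where M: "\<forall>r>0. \<forall>x\<in>?M. \<forall>F. finite F \<and> F \<subseteq> ?M \<and> (\<forall>y\<in>F. mdist T x y \<le> q * r) \<and>
        (\<forall>y\<in>F. \<forall>z\<in>F. y \<noteq> z \<longrightarrow> r \<le> mdist T y z) \<longrightarrow> card F \<le> M" ..
      have md: "mdist T (\<psi> x) (\<psi> y) = dist x y" if "x \<in> Y" "y \<in> Y" for x y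
        using \<phi>[of "\<psi> x" "\<psi> y"] \<psi> that by simp
      have "card F \<le> M" if r: "0 < r" and x: "x \<in> Y" and F: "finite F" "F \<subseteq> Y" "\<forall>y\<in>F. dist x y \<le> q * r"
        "\<forall>y\<in>F. \<forall>z\<in>F. y \<noteq> z \<longrightarrow> r \<le> dist y z" for r x F
      proof -
        have i: "inj_on \<psi> F" using \<psi>(2) F(2) by (metis inj_onI subsetD)
        have "card (\<psi> ` F) \<le> M"
        proof (rule M[rule_format, of r "\<psi> x"])
          show "finite (\<psi> ` F) \<and> \<psi> ` F \<subseteq> ?M \<and> (\<forall>y\<in>\<psi> ` F. mdist T (\<psi> x) y \<le> q * r) \<and>
            (\<forall>y\<in>\<psi> ` F. \<forall>z\<in>\<psi> ` F. y \<noteq> z \<longrightarrow> r \<le> mdist T y z)"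
          proof (intro conjI)
            show "finite (\<psi> ` F)" using F(1) by simp
            show "\<psi> ` F \<subseteq> ?M" using \<psi>(1) F(2) by blast
            show "\<forall>y\<in>\<psi> ` F. mdist T (\<psi> x) y \<le> q * r" using md[OF x] F(2,3) by auto
            show "\<forall>y\<in>\<psi> ` F. \<forall>z\<in>\<psi> ` F. y \<noteq> z \<longrightarrow> r \<le> mdist T y z"
            proof (clarify)
              fix y z assume yz: "y \<in> F" "z \<in> F" "\<psi> y \<noteq> \<psi> z"
              have "y \<noteq> z" using yz(3) by auto
              then have "r \<le> dist y z" using F(4) yz(1,2) by simp
              then show "r \<le> mdist T (\<psi> y) (\<psi> z)" using md[OF subsetD[OF F(2) yz(1)] subsetD[OF F(2) yz(2)]] by simp
            qed
          qed
        qed (use r \<psi>(1) x in auto)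
        then show ?thesis using card_image[OF i] by simp
      qed
      then show ?thesis by blast
    qed
  qed
  have "Y \<noteq> {}" using two by (auto simp: Y_def)
  then obtain \<rho> A L \<beta> \<gamma> \<kappa> D where \<rho>:
    "\<And>x y. x \<in> Y \<Longrightarrow> y \<in> Y \<Longrightarrow> 0 \<le> \<rho> x y"
    "\<And>x y. x \<in> Y \<Longrightarrow> y \<in> Y \<Longrightarrow> \<rho> x y = \<rho> y x"
    "\<And>x y. x \<in> Y \<Longrightarrow> y \<in> Y \<Longrightarrow> \<rho> x y = 0 \<longleftrightarrow> x = y"
    "\<And>x y z. x \<in> Y \<Longrightarrow> y \<in> Y \<Longrightarrow> z \<in> Y \<Longrightarrow> \<rho> x z \<le> \<rho> x y + \<rho> y z"
    "\<And>x y z. x \<in> Y \<Longrightarrow> z \<in> Y \<Longrightarrow> y \<in> at.seg x z \<Longrightarrow> \<rho> x z = \<rho> x y + \<rho> y z"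
    "\<And>e. 0 < e \<Longrightarrow> \<exists>s>0. \<forall>x\<in>Y. \<forall>y\<in>Y. dist x y < s \<longrightarrow> \<rho> x y < e"
    "\<And>e. 0 < e \<Longrightarrow> \<exists>s>0. \<forall>x\<in>Y. \<forall>y\<in>Y. \<rho> x y < s \<longrightarrow> dist x y < e"
    "0 < A" "0 < L" "0 < \<beta>" "0 < \<gamma>"
    "\<And>x y z. x \<in> Y \<Longrightarrow> y \<in> Y \<Longrightarrow> z \<in> Y \<Longrightarrow> x \<noteq> y \<Longrightarrow> x \<noteq> z \<Longrightarrow>
       \<rho> x y \<le> A * ((L * (dist x y / dist x z)) powr \<beta> + (L * (dist x y / dist x z)) powr \<gamma>) * \<rho> x z"
    "0 < \<kappa>" "\<kappa> < (1::real)"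
    "\<And>n. small_cover Y \<rho> \<alpha> (D * \<kappa> ^ n) n"
    by (rule at.geodesic_metric[OF _ assms(2)]) blast+
  \<comment> \<open>The new metric is pulled back to the original carrier, so the identity will be
    the quasisymmetry. Off the carrier it is 0, since a metric has to be nonnegative and symmetric
    for all arguments of the type.\<close>
  define \<sigma> where "\<sigma> x y = (if x \<in> ?M \<and> y \<in> ?M then \<rho> (\<phi> x) (\<phi> y) else 0)" for x y
  have \<phi>Y: "\<phi> x \<in> Y" if "x \<in> ?M" for x using that by (simp add: Y_def)
  have \<sigma>: "\<sigma> x y = \<rho> (\<phi> x) (\<phi> y)" if "x \<in> ?M" "y \<in> ?M" for x y using that by (simp add: \<sigma>_def)
  interpret MS: Metric_space ?M \<sigma>
  proof
    show "0 \<le> \<sigma> x y" for x y using \<rho>(1) \<phi>Y by (simp add: \<sigma>_def)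
    show "\<sigma> x y = \<sigma> y x" for x y using \<rho>(2) \<phi>Y by (auto simp: \<sigma>_def)
    show "\<sigma> x y = 0 \<longleftrightarrow> x = y" if "x \<in> ?M" "y \<in> ?M" for x y
      using \<rho>(3)[OF \<phi>Y \<phi>Y] inj that by (simp add: \<sigma> inj_on_eq_iff)
    show "\<sigma> x z \<le> \<sigma> x y + \<sigma> y z" if "x \<in> ?M" "y \<in> ?M" "z \<in> ?M" for x y z
      using \<rho>(4)[OF \<phi>Y \<phi>Y \<phi>Y] that by (simp add: \<sigma>)
  qed
  define S where "S = metric (?M, \<sigma>)"
  have S: "mspace S = ?M" "mdist S = \<sigma>" by (simp_all add: S_def)
  \<comment> \<open>Being a metric tree depends only on the carrier and the topology, and the arcs
    are the same; both properties therefore carry over from the original space.\<close>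
  have top: "mtopology_of S = ?X"
  proof (rule topology_eq[THEN iffD2], intro allI)
    fix U
    have eq: "(\<exists>r>0. \<forall>y\<in>?M. \<sigma> x y < r \<longrightarrow> y \<in> U) \<longleftrightarrow> (\<exists>r>0. \<forall>y\<in>?M. mdist T x y < r \<longrightarrow> y \<in> U)"
      if x: "x \<in> ?M" for x
    proof
      assume "\<exists>r>0. \<forall>y\<in>?M. \<sigma> x y < r \<longrightarrow> y \<in> U"
      then obtain r where r: "0 < r" "\<forall>y\<in>?M. \<sigma> x y < r \<longrightarrow> y \<in> U" by blast
      obtain s where s: "0 < s" "\<forall>x\<in>Y. \<forall>y\<in>Y. dist x y < s \<longrightarrow> \<rho> x y < r" using \<rho>(6)[OF r(1)] by blast
      have "y \<in> U" if y: "y \<in> ?M" "mdist T x y < s" for y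
      proof -
        have "\<rho> (\<phi> x) (\<phi> y) < r" using s(2) \<phi>Y[OF x] \<phi>Y[OF y(1)] \<phi>[OF x y(1)] y(2) by simp
        then show ?thesis using r(2) y(1) \<sigma>[OF x y(1)] by simp
      qed
      then show "\<exists>r>0. \<forall>y\<in>?M. mdist T x y < r \<longrightarrow> y \<in> U" using s(1) by blast
    next
      assume "\<exists>r>0. \<forall>y\<in>?M. mdist T x y < r \<longrightarrow> y \<in> U"
      then obtain r where r: "0 < r" "\<forall>y\<in>?M. mdist T x y < r \<longrightarrow> y \<in> U" by blast
      obtain s where s: "0 < s" "\<forall>x\<in>Y. \<forall>y\<in>Y. \<rho> x y < s \<longrightarrow> dist x y < r" using \<rho>(7)[OF r(1)] by blast
      have "y \<in> U" if y: "y \<in> ?M" "\<sigma> x y < s" for y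
      proof -
        have "dist (\<phi> x) (\<phi> y) < r" using s(2) \<phi>Y[OF x] \<phi>Y[OF y(1)] \<sigma>[OF x y(1)] y(2) by simp
        then show ?thesis using r(2) y(1) \<phi>[OF x y(1)] by simp
      qed
      then show "\<exists>r>0. \<forall>y\<in>?M. \<sigma> x y < r \<longrightarrow> y \<in> U" using s(1) by blast
    qed
    show "openin (mtopology_of S) U \<longleftrightarrow> openin ?X U"
      unfolding openin_mtopology_of S
    proof (rule conj_cong[OF refl])
      assume "U \<subseteq> ?M"
      then show "(\<forall>x\<in>U. \<exists>r>0. \<forall>y\<in>?M. \<sigma> x y < r \<longrightarrow> y \<in> U) \<longleftrightarrow>
        (\<forall>x\<in>U. \<exists>r>0. \<forall>y\<in>?M. mdist T x y < r \<longrightarrow> y \<in> U)"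
        by (intro ball_cong[OF refl] eq) (rule subsetD)
    qed
  qed
  have "metric_tree S" using tree by (simp add: metric_tree_def top S(1))
  moreover have "geodesic_space S"
    unfolding geodesic_space_def
  proof (intro ballI)
    fix x y assume "x \<in> mspace S" "y \<in> mspace S"
    then have xy: "x \<in> ?M" "y \<in> ?M" by (auto simp: S)
    obtain g where g: "arc_param ?X x y g" using arcs[OF xy] by (auto simp: is_arc_def)
    have g01: "g 0 = x" "g 1 = y" using g by (auto simp: arc_param_def)
    have between: "g ` {0..1} \<subseteq> ?M \<and> \<phi> (g t) \<in> at.seg (\<phi> (g 0)) (\<phi> (g u))" if "0 \<le> t" "t \<le> u" "u \<le> 1" for t u
    proof (cases "x = y")
      case True
      then show ?thesis using g that xy by (auto simp: arc_param_def)
    next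
      case False
      note a = param_to_arc[OF g False]
      have "at.seg ((\<phi> \<circ> g) 0) ((\<phi> \<circ> g) u) = (\<phi> \<circ> g) ` {0..u}"
        using at.seg_subarc[of "\<phi> \<circ> g" 0 u] a that by simp
      then show ?thesis using a that by auto
    qed
    have gM: "g t \<in> ?M" if "t \<in> {0..1}" for t using between[of 0 0] that by auto
    \<comment> \<open>The sums telescope: each \<open>g (t k)\<close> lies on the arc from
      \<open>g 0\<close> to \<open>g (t (Suc k))\<close>, and the metric is additive there. Thus
      every partition gives the distance of the endpoints.\<close>
    have len: "(\<Sum>i<k. ennreal (\<sigma> (g (t i)) (g (t (Suc i))))) = ennreal (\<sigma> (g 0) (g (t k)))"
      if t: "t 0 = 0" "t n = 1" "mono_on {..n} t" and k: "k \<le> n" for n k t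
      using k
    proof (induction k)
      case 0
      then show ?case using t MS.zero[of "g 0" "g 0"] gM[of 0] by simp
    next
      case (Suc k)
      have o: "0 \<le> t k" "t k \<le> t (Suc k)" "t (Suc k) \<le> 1"
        using mono_onD[OF t(3), of 0 k] mono_onD[OF t(3), of k "Suc k"] mono_onD[OF t(3), of "Suc k" n] t(1,2) Suc.prems
        by auto
      have m: "g 0 \<in> ?M" "g (t k) \<in> ?M" "g (t (Suc k)) \<in> ?M" using gM o by auto
      have "\<sigma> (g 0) (g (t (Suc k))) = \<sigma> (g 0) (g (t k)) + \<sigma> (g (t k)) (g (t (Suc k)))"
        using \<rho>(5)[OF \<phi>Y[OF m(1)] \<phi>Y[OF m(3)]] between[OF o] by (simp add: \<sigma> m)
      then show ?case using Suc by (simp add: ennreal_plus)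
    qed
    define P where "P = {(n::nat, t::nat \<Rightarrow> real). t 0 = 0 \<and> t n = 1 \<and> mono_on {..n} t}"
    have "(1, \<lambda>i. if i = 0 then 0 else 1) \<in> P" by (auto simp: P_def mono_on_def)
    then have ne: "P \<noteq> {}" by blast
    have "curve_length S g = (SUP p\<in>P. ennreal (\<sigma> x y))"
      unfolding curve_length_def P_def[symmetric]
    proof (rule SUP_cong[OF refl])
      fix p assume p: "p \<in> P"
      obtain n t where nt: "p = (n, t)" by (cases p)
      then have "t 0 = 0" "t n = 1" "mono_on {..n} t" using p by (auto simp: P_def)
      then have "(\<Sum>i<n. ennreal (\<sigma> (g (t i)) (g (t (Suc i))))) = ennreal (\<sigma> x y)" using len[of t n n] g01 by simp
      then show "(case p of (n, t) \<Rightarrow> \<Sum>i<n. ennreal (mdist S (g (t i)) (g (t (Suc i))))) = ennreal (\<sigma> x y)"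
        by (simp add: nt S)
    qed
    also have "\<dots> = ennreal (\<sigma> x y)" using ne by (rule SUP_const)
    finally have "curve_length S g = ennreal (mdist S x y)" by (simp add: S)
    then show "\<exists>g. arc_param (mtopology_of S) x y g \<and> curve_length S g = ennreal (mdist S x y)"
      using g top by auto
  qed
  ultimately have geo: "geodesic_tree S" by (simp add: geodesic_tree_def)
  have "quasisymmetry T S id"
    unfolding quasisymmetry_def
  proof (intro conjI exI ballI impI)
    show "homeomorphic_map ?X (mtopology_of S) id" by (simp add: top)
    \<comment> \<open>The factor 2 pays for replacing the sum of two powers by their
      maximum.\<close>
    let ?\<eta> = "\<lambda>t. (2 * A) * max ((L * t) powr \<beta>) ((L * t) powr \<gamma>)"
    show "homeomorphic_map (top_of_set {0..}) (top_of_set {0..}) ?\<eta>"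
      using \<rho>(8-11) by (intro homeomorphic_map_powr) auto
    fix x y z assume xyz: "x \<in> ?M" "y \<in> ?M" "z \<in> ?M" "x \<noteq> y \<and> y \<noteq> z \<and> x \<noteq> z"
    define t where "t = mdist T x y / mdist T x z"
    have ne: "\<phi> x \<noteq> \<phi> y" "\<phi> x \<noteq> \<phi> z" using inj xyz by (auto simp: inj_on_eq_iff)
    have "\<rho> (\<phi> x) (\<phi> y) \<le> A * ((L * t) powr \<beta> + (L * t) powr \<gamma>) * \<rho> (\<phi> x) (\<phi> z)"
      using \<rho>(12)[OF \<phi>Y[OF xyz(1)] \<phi>Y[OF xyz(2)] \<phi>Y[OF xyz(3)] ne] \<phi>[OF xyz(1,2)] \<phi>[OF xyz(1,3)]
      by (simp add: t_def)
    then have "\<sigma> x y \<le> A * ((L * t) powr \<beta> + (L * t) powr \<gamma>) * \<sigma> x z" using xyz by (simp add: \<sigma>)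
    also have "\<dots> \<le> ?\<eta> t * \<sigma> x z"
    proof (rule mult_right_mono)
      have "A * ((L * t) powr \<beta> + (L * t) powr \<gamma>) \<le> A * (2 * max ((L * t) powr \<beta>) ((L * t) powr \<gamma>))"
        using \<rho>(8) by (intro mult_left_mono) auto
      then show "A * ((L * t) powr \<beta> + (L * t) powr \<gamma>) \<le> ?\<eta> t" by simp
    qed simp
    finally have "\<sigma> x y \<le> ?\<eta> t * \<sigma> x z" .
    moreover have "0 < \<sigma> x z" using MS.mdist_pos_eq[of x z] xyz by simp
    ultimately show "mdist S (id x) (id y) / mdist S (id x) (id z) \<le> ?\<eta> (mdist T x y / mdist T x z)"
      unfolding S id_apply t_def by (subst pos_divide_le_eq) auto
  qed
  then have qs: "quasisymmetrically_equivalent T S" by (auto simp: quasisymmetrically_equivalent_def)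
  have "small_cover (mspace S) (mdist S) \<alpha> (D * \<kappa> ^ n) n" for n
  proof -
    obtain C :: "nat set" and E b where C: "finite C" "Y \<subseteq> (\<Union>c\<in>C. E c)"
      "\<forall>c\<in>C. E c \<subseteq> Y \<and> 0 < b c \<and> b c \<le> 11 * (1/2) ^ n \<and> (\<forall>x\<in>E c. \<forall>y\<in>E c. \<rho> x y \<le> b c)"
      "(\<Sum>c\<in>C. b c powr \<alpha>) \<le> D * \<kappa> ^ n"
      using \<rho>(15)[of n] unfolding small_cover_def by blast
    show ?thesis
    proof (rule small_coverI[OF C(1), where b = b and E = "\<lambda>c. {x\<in>?M. \<phi> x \<in> E c}"])
      show "mspace S \<subseteq> (\<Union>c\<in>C. {x\<in>?M. \<phi> x \<in> E c})" using C(2) \<phi>Y by (auto simp: S)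
    qed (use C(3,4) in \<open>auto simp: S \<sigma>\<close>)
  qed
  then have "hausdorff_dim S \<le> ennreal \<alpha>" using \<rho>(13,14) assms(2) by (intro hausdorff_dim_le) auto
  then show ?thesis using geo qs by blast
qed

end
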